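(* Let $r\ge 4$ be an integer and let $f$ be a $C^r$ diffeomorphism of $\mathbb R^2$ for which $0$ is a hyperbolic fixed point whose eigenvalues $\lambda,\sigma$ are real with $|\lambda|<1<|\sigma|$ and satisfy $|\lambda|\,|\sigma|^{r-2}<1$. Then $f$ is $C^{r-2}$-linearizable at $0$: there exist a neighborhood $U$ of $0$ and a $C^{r-2}$ diffeomorphism $\phi$ from $U$ onto a neighborhood of $0$, with $\phi(0)=0$, such that $f\circ\phi=\phi\circ D_0f$ wherever both sides are defined in $U$. *)

theory Defs
  imports "HOL-Analysis.Analysis"
begin

text \<open>k-times continuously differentiable on a set U (intended for open U):
  C^0 means continuous; C^(k+1) means differentiable at every point of U and
  every directional derivative x \<mapsto> Df(x) v is C^k on U.\<close>
fun Ck_on :: "nat \<Rightarrow> ('a::real_normed_vector \<Rightarrow> 'b::real_normed_vector) \<Rightarrow> 'a set \<Rightarrow> bool" where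
  "Ck_on 0 f U = continuous_on U f"
| "Ck_on (Suc k) f U =
     (f differentiable_on U \<and> (\<forall>v. Ck_on k (\<lambda>x. frechet_derivative f (at x) v) U))"

definition Ck_diffeo :: "nat \<Rightarrow> ('a::real_normed_vector \<Rightarrow> 'b::real_normed_vector) \<Rightarrow> 'a set \<Rightarrow> 'b set \<Rightarrow> bool" where
  "Ck_diffeo k \<phi> U V \<longleftrightarrow> open U \<and> open V \<and> bij_betw \<phi> U V \<and>
     Ck_on k \<phi> U \<and> Ck_on k (inv_into U \<phi>) V"

end

(* The idea is to look for the inverse h of the linearizing chart, that is, for solutions of
   the scalar equations h1 o f = lam h1 and h2 o f = sigma h2. Write k = r - 2.

   The unstable manifold is obtained as a curve K with K(sigma t) = f(K t), which at the same
   time linearizes f on it; taking it as the axis x = 0 one may assume f(0,y) = (0, sigma y).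
   Let H1 = a(y) x, where a linearizes the action of f on the normal bundle of that axis, and
   H2 = y. Then G1 = H1 o f - lam H1 vanishes to second order and G2 = H2 o f - sigma H2 to
   first order on the axis, and h1 = H1 + sum lam^(-n-1) G1 o f^n, h2 = H2 + sum
   sigma^(-n-1) G2 o f^n are formal solutions.

   The series converge in C^k because u |-> u o f acts on functions with
   |d_x^i d_y^j u| = O(|x|^(w-i)), i + j <= k (exponents truncated at 0), with norm close to
   |lam|^w |sigma|^k: for w = 2 this is less than |lam| exactly when |lam| |sigma|^k < 1.
   That d_y^j G1 = O(x^2) for all j <= k is what costs the two derivatives. *)

theory Submission
  imports Defs
begin

section \<open>Calculus of \<open>C\<^sup>k\<close> maps on open sets\<close>

text \<open>The sums run along forward orbits, which leave every neighbourhood of 0 in the y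
  direction. Hence the nonlinear part of the straightened map and the defects G1, G2 are cut off and
  extended by 0, and the series live on the strip |x| < 1, which the modified map sends into itself;
  near 0 the cut-off is 1 and the original equations are recovered. Rescaling z to r z beforehand
  makes the perturbation small in C^k, so that the norm of the pullback comes as close to |lam|^w
  |sigma|^k as needed.

  Only forward iterates occur, so only vanishing on the unstable axis matters and the stable
  manifold is never straightened. The second component has w = 1 and needs |lam| |sigma|^k <
  |sigma|, which the hypothesis gives with room to spare. The corrections vanish on the axis to
  order 2 and 1, which leaves Dh(0) triangular and invertible.

  The factor a and the tangent of the curve K solve equations v(t) = B(t) v(t/s) + c(t) on an
  interval. There each differentiation gains a factor 1/s, so they are as smooth as the
  coefficients.\<close>

lemma Ck_cong:
  assumes "open U" "\<And>x. x \<in> U \<Longrightarrow> f x = g x" "Ck_on k f U"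
  shows "Ck_on k g U"
  using assms
proof (induction k arbitrary: f g)
  case 0
  then show ?case by (simp cong: continuous_on_cong)
next
  case (Suc k)
  have hd: "(g has_derivative frechet_derivative f (at x)) (at x)" if "x \<in> U" for x
  proof -
    have "f differentiable at x"
      using Suc.prems that by (auto simp: differentiable_on_eq_differentiable_at)
    then have "(f has_derivative frechet_derivative f (at x)) (at x)"
      by (simp add: frechet_derivative_works)
    then show ?thesis
      by (rule has_derivative_transform_within_open[OF _ \<open>open U\<close> that]) (simp add: Suc.prems)
  qed
  have "g differentiable_on U"
    unfolding differentiable_on_eq_differentiable_at[OF \<open>open U\<close>] using hd differentiableI by blast
  moreover have fr: "frechet_derivative f (at x) = frechet_derivative g (at x)" if "x \<in> U" for x
    using frechet_derivative_at[OF hd[OF that]] .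
  moreover have "Ck_on k (\<lambda>x. frechet_derivative g (at x) v) U" for v
    using Suc.IH[OF \<open>open U\<close>, of "\<lambda>x. frechet_derivative f (at x) v" "\<lambda>x. frechet_derivative g (at x) v"]
      Suc.prems(3) fr by simp
  ultimately show ?case by simp
qed

text \<open>\<open>frechet_derivative\<close> is a choice operator. On an open set the derivative is
  unique, so any explicit family \<open>f'\<close> may replace it, and the inductions on
  \<open>k\<close> work with explicit derivatives.\<close>

lemma Ck_SucI:
  assumes "open U" "\<And>x. x \<in> U \<Longrightarrow> (f has_derivative f' x) (at x)"
    "\<And>v. Ck_on k (\<lambda>x. f' x v) U"
  shows "Ck_on (Suc k) f U"
proof -
  have "f differentiable_on U"
    unfolding differentiable_on_eq_differentiable_at[OF assms(1)] using assms(2) differentiableI by blast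
  moreover have "Ck_on k (\<lambda>x. frechet_derivative f (at x) v) U" for v
    using assms(3) by (rule Ck_cong[OF assms(1), rotated]) (simp add: frechet_derivative_at[OF assms(2), symmetric])
  ultimately show ?thesis by simp
qed

lemma Ck_Suc_ex:
  assumes "open U" "Ck_on (Suc k) f U"
  shows "\<exists>f'. (\<forall>x\<in>U. (f has_derivative f' x) (at x)) \<and> (\<forall>v. Ck_on k (\<lambda>x. f' x v) U)"
  using assms
  by (intro exI[of _ "\<lambda>x. frechet_derivative f (at x)"])
    (auto simp: differentiable_on_eq_differentiable_at frechet_derivative_works)

lemma Ck_SucD:
  assumes "open U" "Ck_on (Suc k) f U" "\<And>x. x \<in> U \<Longrightarrow> (f has_derivative f' x) (at x)"
  shows "Ck_on k (\<lambda>x. f' x v) U"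
proof -
  have "Ck_on k (\<lambda>x. frechet_derivative f (at x) v) U"
    using assms(2) by simp
  then show ?thesis
    by (rule Ck_cong[OF assms(1), rotated]) (simp add: frechet_derivative_at[OF assms(3), symmetric])
qed

lemma Ck_continuous:
  assumes "open U" "Ck_on k f U"
  shows "continuous_on U f"
  using assms by (cases k) (auto intro: differentiable_imp_continuous_on)

lemma Ck_mono:
  assumes "open U" "Ck_on k f U" "j \<le> k"
  shows "Ck_on j f U"
  using assms
proof (induction j arbitrary: k f)
  case 0
  then show ?case by (simp add: Ck_continuous)
next
  case (Suc j)
  then obtain k' where k: "k = Suc k'" "j \<le> k'" by (cases k) auto
  have "Ck_on j (\<lambda>x. frechet_derivative f (at x) v) U" for v
    using Suc.IH[OF \<open>open U\<close> _ k(2)] Suc.prems(2) k(1) by simp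
  then show ?case using Suc.prems(2) k(1) by simp
qed

lemma Ck_subset:
  assumes "open V" "V \<subseteq> U" "Ck_on k f U"
  shows "Ck_on k f V"
  using assms
proof (induction k arbitrary: f)
  case 0
  then show ?case by (simp add: continuous_on_subset)
next
  case (Suc k)
  then show ?case by (auto intro: differentiable_on_subset)
qed

section \<open>Constants, linear maps and algebraic operations\<close>

lemma Ck_const: "open U \<Longrightarrow> Ck_on k (\<lambda>x. c) U"
proof (induction k arbitrary: c)
  case (Suc k)
  then show ?case by (intro Ck_SucI[where f'="\<lambda>x h. 0"]) auto
qed simp

lemma Ck_bounded_linear:
  assumes "open U" "bounded_linear L"
  shows "Ck_on k L U"
proof (cases k)
  case 0
  then show ?thesis by (simp add: assms linear_continuous_on)
next
  case (Suc k')
  then show ?thesis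
    using Ck_SucI[OF assms(1) bounded_linear_imp_has_derivative[OF assms(2)] Ck_const[OF assms(1)]] by simp
qed

lemma Ck_add:
  assumes "open U" "Ck_on k f U" "Ck_on k g U"
  shows "Ck_on k (\<lambda>x. f x + g x) U"
  using assms
proof (induction k arbitrary: f g)
  case 0
  then show ?case by (simp add: continuous_on_add)
next
  case (Suc k)
  obtain f' where f': "\<And>x. x \<in> U \<Longrightarrow> (f has_derivative f' x) (at x)" "\<And>v. Ck_on k (\<lambda>x. f' x v) U"
    using Ck_Suc_ex[OF Suc.prems(1,2)] by blast
  obtain g' where g': "\<And>x. x \<in> U \<Longrightarrow> (g has_derivative g' x) (at x)" "\<And>v. Ck_on k (\<lambda>x. g' x v) U"
    using Ck_Suc_ex[OF Suc.prems(1,3)] by blast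
  show ?case
  proof (rule Ck_SucI[where f'="\<lambda>x h. f' x h + g' x h"])
    show "Ck_on k (\<lambda>x. f' x v + g' x v) U" for v
      by (rule Suc.IH[OF Suc.prems(1) f'(2) g'(2)])
    show "((\<lambda>x. f x + g x) has_derivative (\<lambda>h. f' x h + g' x h)) (at x)" if "x \<in> U" for x
      by (rule has_derivative_add[OF f'(1)[OF that] g'(1)[OF that]])
  qed (rule Suc.prems(1))
qed

lemma (in bounded_bilinear) Ck_bilinear:
  assumes "open U" "Ck_on k f U" "Ck_on k g U"
  shows "Ck_on k (\<lambda>x. prod (f x) (g x)) U"
  using assms
proof (induction k arbitrary: f g)
  case 0
  then show ?case by (simp add: continuous_on)
next
  case (Suc k)
  obtain f' where f': "\<And>x. x \<in> U \<Longrightarrow> (f has_derivative f' x) (at x)" "\<And>v. Ck_on k (\<lambda>x. f' x v) U"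
    using Ck_Suc_ex[OF Suc.prems(1,2)] by blast
  obtain g' where g': "\<And>x. x \<in> U \<Longrightarrow> (g has_derivative g' x) (at x)" "\<And>v. Ck_on k (\<lambda>x. g' x v) U"
    using Ck_Suc_ex[OF Suc.prems(1,3)] by blast
  have fk: "Ck_on k f U" and gk: "Ck_on k g U"
    using Ck_mono[OF \<open>open U\<close> Suc.prems(2), of k] Ck_mono[OF \<open>open U\<close> Suc.prems(3), of k] by auto
  show ?case
  proof (rule Ck_SucI[where f'="\<lambda>x h. prod (f x) (g' x h) + prod (f' x h) (g x)"])
    show "Ck_on k (\<lambda>x. prod (f x) (g' x v) + prod (f' x v) (g x)) U" for v
      by (rule Ck_add[OF Suc.prems(1) Suc.IH[OF Suc.prems(1) fk g'(2)] Suc.IH[OF Suc.prems(1) f'(2) gk]])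
    show "((\<lambda>x. prod (f x) (g x)) has_derivative (\<lambda>h. prod (f x) (g' x h) + prod (f' x h) (g x))) (at x)"
      if "x \<in> U" for x
      by (rule FDERIV[OF f'(1)[OF that] g'(1)[OF that]])
  qed (rule Suc.prems(1))
qed

lemmas Ck_mult = bounded_bilinear.Ck_bilinear[OF bounded_bilinear_mult]
  and Ck_scaleR = bounded_bilinear.Ck_bilinear[OF bounded_bilinear_scaleR]

lemma Ck_linear_compose:
  assumes "open U" "bounded_linear L" "Ck_on k f U"
  shows "Ck_on k (\<lambda>x. L (f x)) U"
proof -
  show ?thesis using assms(3)
  proof (induction k arbitrary: f)
    case 0
    then show ?case by (simp add: assms bounded_linear.continuous_on)
  next
    case (Suc k)
    obtain f' where f': "\<And>x. x \<in> U \<Longrightarrow> (f has_derivative f' x) (at x)" "\<And>v. Ck_on k (\<lambda>x. f' x v) U"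
      using Ck_Suc_ex[OF \<open>open U\<close> Suc.prems] by blast
    show ?case
    proof (rule Ck_SucI[where f'="\<lambda>x h. L (f' x h)"])
      show "((\<lambda>x. L (f x)) has_derivative (\<lambda>h. L (f' x h))) (at x)" if "x \<in> U" for x
        by (rule bounded_linear.has_derivative[OF assms(2) f'(1)[OF that]])
    qed (rule assms(1) Suc.IH f'(2))+
  qed
qed

lemma Ck_minus: "open U \<Longrightarrow> Ck_on k f U \<Longrightarrow> Ck_on k (\<lambda>x. - f x) U"
  by (rule Ck_linear_compose[OF _ bounded_linear_minus[OF bounded_linear_ident]])

lemma Ck_diff:
  assumes "open U" "Ck_on k f U" "Ck_on k g U"
  shows "Ck_on k (\<lambda>x. f x - g x) U"
  using Ck_add[OF assms(1,2) Ck_minus[OF assms(1,3)]] by simp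

lemma Ck_sum:
  assumes "open U" "\<And>i. i \<in> I \<Longrightarrow> Ck_on k (f i) U"
  shows "Ck_on k (\<lambda>x. \<Sum>i\<in>I. f i x) U"
  using assms(2)
proof (induction I rule: infinite_finite_induct)
  case (insert i I)
  have "Ck_on k (\<lambda>x. f i x + (\<Sum>i\<in>I. f i x)) U"
    by (rule Ck_add[OF assms(1) insert.prems[OF insertI1] insert.IH[OF insert.prems[OF insertI2]]])
  then show ?case unfolding sum.insert[OF insert.hyps] .
qed (simp_all only: sum.empty sum.infinite Ck_const[OF assms(1)] not_False_eq_True)

lemma Ck_power: "open U \<Longrightarrow> Ck_on k f U \<Longrightarrow> Ck_on k (\<lambda>x. f x ^ n :: real) U"
  by (induction n) (simp_all only: power_0 power_Suc Ck_const Ck_mult)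

lemma Ck_fst: "open U \<Longrightarrow> Ck_on k f U \<Longrightarrow> Ck_on k (\<lambda>x. fst (f x)) U"
  by (rule Ck_linear_compose[OF _ bounded_linear_fst])

lemma Ck_snd: "open U \<Longrightarrow> Ck_on k f U \<Longrightarrow> Ck_on k (\<lambda>x. snd (f x)) U"
  by (rule Ck_linear_compose[OF _ bounded_linear_snd])

lemma Ck_ident: "open U \<Longrightarrow> Ck_on k (\<lambda>x. x) U"
  by (rule Ck_bounded_linear[OF _ bounded_linear_ident])

lemma Ck_Pair:
  assumes "open U" "Ck_on k f U" "Ck_on k g U"
  shows "Ck_on k (\<lambda>x. (f x, g x)) U"
proof -
  have "bounded_linear (\<lambda>a::'b. (a, 0::'c))" "bounded_linear (\<lambda>b::'c. (0::'b, b))"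
    by (auto intro!: bounded_linear_Pair)
  from Ck_add[OF assms(1) Ck_linear_compose[OF assms(1) this(1) assms(2)]
      Ck_linear_compose[OF assms(1) this(2) assms(3)]]
  show ?thesis by simp
qed

section \<open>Composition, reciprocals and local inverses\<close>

lemma linear_euclidean_expand:
  fixes L :: "'b::euclidean_space \<Rightarrow> 'c::real_normed_vector"
  assumes "linear L"
  shows "L v = (\<Sum>b\<in>Basis. (v \<bullet> b) *\<^sub>R L b)"
proof -
  have "L v = L (\<Sum>b\<in>Basis. (v \<bullet> b) *\<^sub>R b)" by (simp add: euclidean_representation)
  also have "\<dots> = (\<Sum>b\<in>Basis. (v \<bullet> b) *\<^sub>R L b)"
    using assms by (simp add: linear_sum linear_scale)
  finally show ?thesis .
qed

text \<open>\<open>Ck_on\<close> controls a derivative only in a fixed direction. When the direction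
  varies with \<open>x\<close>, as in the chain rule, it is expanded in a finite basis, which is
  where the middle space of a composition has to be Euclidean.\<close>

lemma Ck_apply:
  fixes B :: "'a::real_normed_vector \<Rightarrow> 'b::euclidean_space \<Rightarrow> 'c::real_normed_vector"
  assumes "open U" "\<And>x. x \<in> U \<Longrightarrow> linear (B x)" "\<And>w. Ck_on k (\<lambda>x. B x w) U" "Ck_on k v U"
  shows "Ck_on k (\<lambda>x. B x (v x)) U"
proof (rule Ck_cong[OF \<open>open U\<close>])
  show "(\<Sum>b\<in>Basis. (v x \<bullet> b) *\<^sub>R B x b) = B x (v x)" if "x \<in> U" for x
    using linear_euclidean_expand[OF assms(2)[OF that], of "v x"] by simp
  show "Ck_on k (\<lambda>x. \<Sum>b\<in>Basis. (v x \<bullet> b) *\<^sub>R B x b) U"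
    by (intro Ck_sum Ck_scaleR assms(1,3,4) Ck_linear_compose[OF _ bounded_linear_inner_left])
qed

lemma Ck_compose:
  fixes f :: "'b::euclidean_space \<Rightarrow> 'c::real_normed_vector"
  assumes "open U" "open V" "Ck_on k g U" "Ck_on k f V" "\<And>x. x \<in> U \<Longrightarrow> g x \<in> V"
  shows "Ck_on k (\<lambda>x. f (g x)) U"
  using assms(3,4)
proof (induction k arbitrary: f)
  case 0
  then show ?case
    using assms(5) by (auto intro: continuous_on_compose2)
next
  case (Suc k)
  obtain f' where f': "\<And>x. x \<in> V \<Longrightarrow> (f has_derivative f' x) (at x)" "\<And>v. Ck_on k (\<lambda>x. f' x v) V"
    using Ck_Suc_ex[OF \<open>open V\<close> Suc.prems(2)] by blast
  obtain g' where g': "\<And>x. x \<in> U \<Longrightarrow> (g has_derivative g' x) (at x)" "\<And>v. Ck_on k (\<lambda>x. g' x v) U"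
    using Ck_Suc_ex[OF \<open>open U\<close> Suc.prems(1)] by blast
  have gk: "Ck_on k g U"
    using Ck_mono[OF \<open>open U\<close> Suc.prems(1), of k] by auto
  show ?case
  proof (rule Ck_SucI[where f'="\<lambda>x h. f' (g x) (g' x h)"])
    show "((\<lambda>x. f (g x)) has_derivative (\<lambda>h. f' (g x) (g' x h))) (at x)" if "x \<in> U" for x
      using has_derivative_compose[OF g'(1)[OF that] f'(1)[OF assms(5)[OF that]]] .
    show "Ck_on k (\<lambda>x. f' (g x) (g' x v)) U" for v
    proof (rule Ck_apply[OF \<open>open U\<close>])
      show "linear (f' (g x))" if "x \<in> U" for x
        using f'(1)[OF assms(5)[OF that]] by (rule has_derivative_linear)
    qed (intro \<open>open U\<close> Suc.IH gk f' g')+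
  qed (rule \<open>open U\<close>)
qed

lemma Ck_inverse:
  fixes f :: "'a::real_normed_vector \<Rightarrow> real"
  assumes "open U" "Ck_on k f U" "\<And>x. x \<in> U \<Longrightarrow> f x \<noteq> 0"
  shows "Ck_on k (\<lambda>x. inverse (f x)) U"
  using assms(2)
proof (induction k)
  case 0
  then show ?case using assms(3) by (auto intro!: continuous_on_inverse)
next
  case (Suc k)
  obtain f' where f': "\<And>x. x \<in> U \<Longrightarrow> (f has_derivative f' x) (at x)" "\<And>v. Ck_on k (\<lambda>x. f' x v) U"
    using Ck_Suc_ex[OF \<open>open U\<close> Suc.prems] by blast
  have IH: "Ck_on k (\<lambda>x. inverse (f x)) U"
    using Suc.IH Ck_mono[OF \<open>open U\<close> Suc.prems, of k] by auto
  show ?case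
  proof (rule Ck_SucI[where f'="\<lambda>x h. - (inverse (f x) * f' x h * inverse (f x))"])
    show "((\<lambda>x. inverse (f x)) has_derivative (\<lambda>h. - (inverse (f x) * f' x h * inverse (f x)))) (at x)"
      if "x \<in> U" for x
      by (rule Deriv.has_derivative_inverse[OF assms(3)[OF that] f'(1)[OF that]])
    show "Ck_on k (\<lambda>x. - (inverse (f x) * f' x v * inverse (f x))) U" for v
      by (rule Ck_minus[OF assms(1) Ck_mult[OF assms(1) Ck_mult[OF assms(1) IH f'(2)] IH]])
  qed (rule assms(1))
qed

lemma Ck_divide:
  fixes f :: "'a::real_normed_vector \<Rightarrow> real"
  assumes "open U" "Ck_on k f U" "Ck_on k g U" "\<And>x. x \<in> U \<Longrightarrow> g x \<noteq> 0"
  shows "Ck_on k (\<lambda>x. f x / g x) U"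
  unfolding divide_inverse by (intro Ck_mult Ck_inverse assms)

lemmas Ck_intros = Ck_const Ck_ident Ck_add Ck_diff Ck_minus Ck_mult Ck_scaleR Ck_power
  Ck_fst Ck_snd Ck_Pair Ck_divide

lemma linear_prod_expand:
  fixes T :: "real \<times> real \<Rightarrow> 'b::real_vector"
  assumes "linear T"
  shows "T z = fst z *\<^sub>R T (1, 0) + snd z *\<^sub>R T (0, 1)"
proof -
  have "T z = T (fst z *\<^sub>R (1, 0) + snd z *\<^sub>R (0, 1))" by (simp add: scaleR_prod_def plus_prod_def)
  then show ?thesis
    using assms by (simp only: linear_add linear_scale)
qed

text \<open>Cramer's rule. It writes the inverse as a rational function of the matrix entries, so
  that the inverse of a \<open>C^j\<close> family of matrices is \<open>C^j\<close> by
  \<open>Ck_divide\<close>.\<close>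

lemma inv_linear_prod:
  fixes T :: "real \<times> real \<Rightarrow> real \<times> real"
  assumes "linear T" "bij T"
  defines "D \<equiv> fst (T (1,0)) * snd (T (0,1)) - snd (T (1,0)) * fst (T (0,1))"
  shows "D \<noteq> 0"
    and "inv T v = ((snd (T (0,1)) * fst v - fst (T (0,1)) * snd v) / D,
                    (fst (T (1,0)) * snd v - snd (T (1,0)) * fst v) / D)"
proof -
  note T = linear_prod_expand[OF assms(1)]
  have inj: "T z = 0 \<Longrightarrow> z = 0" for z
    using assms(1,2) by (metis bij_is_inj linear_injective_0)
  show D: "D \<noteq> 0"
  proof
    assume D0: "D = 0"
    \<comment> \<open>With columns \<open>(a, b)\<close> and \<open>(c, d)\<close> the two vectors
      are \<open>(d, -b)\<close> and \<open>(c, -a)\<close>; \<open>T\<close> sends them to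
      \<open>(D, 0)\<close> and \<open>(0, -D)\<close>.\<close>
    have "T (snd (T (0,1)), - snd (T (1,0))) = 0" "T (fst (T (0,1)), - fst (T (1,0))) = 0"
      using D0 by (auto simp: D_def T[of "(snd (T (0,1)), - snd (T (1,0)))"]
          T[of "(fst (T (0,1)), - fst (T (1,0)))"] prod_eq_iff algebra_simps)
    from inj[OF this(1)] inj[OF this(2)] have "fst (T (1,0)) = 0" "snd (T (1,0)) = 0"
      by (auto simp: zero_prod_def)
    then have "T (1,0) = 0" by (simp add: prod_eq_iff)
    from inj[OF this] show False by (simp add: zero_prod_def)
  qed
  have "T ((snd (T (0,1)) * fst v - fst (T (0,1)) * snd v) / D,
           (fst (T (1,0)) * snd v - snd (T (1,0)) * fst v) / D) = v" (is "T ?w = v")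
  proof -
    have cramer: "(d * x - c * y) / D * a + (a * y - b * x) / D * c = x"
      "(d * x - c * y) / D * b + (a * y - b * x) / D * d = y" if "D = a * d - b * c" for a b c d x y
      using D unfolding that by (simp_all add: divide_simps) (simp_all add: algebra_simps)
    show ?thesis
      unfolding T[of ?w] by (rule prod_eqI) (simp_all only: fst_add snd_add fst_scaleR snd_scaleR
        fst_conv snd_conv real_scaleR_def cramer[OF meta_eq_to_obj_eq[OF D_def]])
  qed
  then show "inv T v = ?w"
    using assms(2) by (metis bij_is_inj inv_f_eq)
qed

text \<open>The classical theorem yields a differentiable inverse with derivative
  \<open>inv (f' (g y))\<close>. The rest is bootstrapping: if \<open>g\<close> is
  \<open>C^j\<close> with \<open>j < k\<close>, then so is this expression, and \<open>g\<close> is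
  \<open>C^(j+1)\<close>.\<close>

theorem Ck_inverse_function_theorem:
  fixes f :: "real \<times> real \<Rightarrow> real \<times> real"
  assumes "open U" "Ck_on k f U" "1 \<le> k" "x0 \<in> U" "(f has_derivative f0) (at x0)" "bij f0"
  obtains U' V g where "open U'" "U' \<subseteq> U" "x0 \<in> U'" "open V" "homeomorphism U' V f g" "Ck_on k g V"
proof -
  obtain k' where k: "k = Suc k'" using assms(3) by (cases k) auto
  obtain f' where f': "\<And>x. x \<in> U \<Longrightarrow> (f has_derivative f' x) (at x)" "\<And>v. Ck_on k' (\<lambda>x. f' x v) U"
    using Ck_Suc_ex[OF \<open>open U\<close> assms(2)[unfolded k]] by blast
  have f0: "f' x0 = f0" using has_derivative_unique[OF f'(1)[OF assms(4)] assms(5)] .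
  define F where "F x = Blinfun (f' x)" for x
  have F: "blinfun_apply (F x) = f' x" if "x \<in> U" for x
    unfolding F_def using f'(1)[OF that] by (simp add: bounded_linear_Blinfun_apply has_derivative_bounded_linear)
  have lin0: "linear f0" using assms(5) by (rule has_derivative_linear)
  have bl: "bounded_linear (inv f0)"
    using lin0 assms(6) by (simp add: bij_is_inj inj_linear_imp_inv_bounded_linear linear_conv_bounded_linear)
  define I where "I = Blinfun (inv f0)"
  have I: "blinfun_apply I = inv f0" unfolding I_def using bl by (simp add: bounded_linear_Blinfun_apply)
  have inv: "I o\<^sub>L F x0 = id_blinfun"
    by (rule blinfun_eqI) (simp add: I F assms f0 bij_is_inj)
  \<comment> \<open>The classical theorem asks for continuity in operator norm; in finite dimension
    continuity in each direction suffices.\<close>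
  have cont: "continuous_on U F"
  proof (rule continuous_on_blinfun_componentwise)
    fix i :: "real \<times> real"
    have "continuous_on U (\<lambda>x. f' x i)" using Ck_continuous[OF \<open>open U\<close> f'(2)] .
    then show "continuous_on U (\<lambda>x. blinfun_apply (F x) i)"
      by (simp add: F cong: continuous_on_cong)
  qed
  obtain U' V g g' where U': "open U'" "U' \<subseteq> U" "x0 \<in> U'" "open V" "f x0 \<in> V" "homeomorphism U' V f g"
    and g': "\<And>y. y \<in> V \<Longrightarrow> (g has_derivative (g' y)) (at y)"
       "\<And>y. y \<in> V \<Longrightarrow> g' y = inv (blinfun_apply (F (g y)))"
       "\<And>y. y \<in> V \<Longrightarrow> bij (blinfun_apply (F (g y)))"
    using inverse_function_theorem[OF \<open>open U\<close> _ cont assms(4) inv] f'(1) F by metis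
  have gU: "g y \<in> U" if "y \<in> V" for y
    using U'(2,6) that by (auto simp: homeomorphism_def)
  have "Ck_on j g V" if "j \<le> k" for j
    using that
  proof (induction j)
    case 0
    then show ?case using U'(6) by (simp add: homeomorphism_def)
  next
    case (Suc j)
    have c: "Ck_on j (\<lambda>y. f' (g y) v) V" for v
      using Ck_compose[OF U'(4) \<open>open U\<close> Suc.IH Ck_mono[OF \<open>open U\<close> f'(2)] gU] Suc.prems k by auto
    have lin: "linear (f' (g y))" if "y \<in> V" for y
      using f'(1)[OF gU[OF that]] by (rule has_derivative_linear)
    have bij: "bij (f' (g y))" if "y \<in> V" for y
      using g'(3)[OF that] F[OF gU[OF that]] by simp
    have eq: "g' y = inv (f' (g y))" if "y \<in> V" for y
      using g'(2)[OF that] F[OF gU[OF that]] by simp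
    show ?case
    proof (rule Ck_SucI[OF U'(4) g'(1)])
      fix v
      show "Ck_on j (\<lambda>y. g' y v) V"
      proof (rule Ck_cong[OF U'(4)])
        show "Ck_on j (\<lambda>y. let D = fst (f' (g y) (1,0)) * snd (f' (g y) (0,1)) - snd (f' (g y) (1,0)) * fst (f' (g y) (0,1)) in
           ((snd (f' (g y) (0,1)) * fst v - fst (f' (g y) (0,1)) * snd v) / D,
                    (fst (f' (g y) (1,0)) * snd v - snd (f' (g y) (1,0)) * fst v) / D)) V"
          unfolding Let_def using inv_linear_prod(1)[OF lin bij]
          by (intro Ck_intros c U'(4)) auto
      qed (simp add: Let_def eq inv_linear_prod(2)[OF lin bij])
    qed
  qed
  from this[of k] show ?thesis using U' that by blast
qed

section \<open>Weighted \<open>C\<^sup>k\<close> bounds\<close>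

text \<open>The weight \<^term>\<open>w\<close> is the order of vanishing on the axis \<open>x = 0\<close>: it drops by one with each
  derivative in \<open>x\<close>, down to \<open>0\<close> (truncated subtraction), and is kept by derivatives in \<open>y\<close>.\<close>
primrec wbd :: "(real \<times> real) set \<Rightarrow> nat \<Rightarrow> nat \<Rightarrow> real \<Rightarrow> (real \<times> real \<Rightarrow> real) \<Rightarrow> bool" where
  "wbd S 0 w M u \<longleftrightarrow> continuous_on S u \<and> (\<forall>z\<in>S. \<bar>u z\<bar> \<le> M * \<bar>fst z\<bar> ^ w)"
| "wbd S (Suc k) w M u \<longleftrightarrow> (\<forall>z\<in>S. \<bar>u z\<bar> \<le> M * \<bar>fst z\<bar> ^ w) \<and>
     (\<exists>p q. (\<forall>z\<in>S. (u has_derivative (\<lambda>h. fst h * p z + snd h * q z)) (at z)) \<and>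
        wbd S k (w - 1) M p \<and> wbd S k w M q)"

lemma wbd_bound: "wbd S k w M u \<Longrightarrow> z \<in> S \<Longrightarrow> \<bar>u z\<bar> \<le> M * \<bar>fst z\<bar> ^ w"
  by (cases k) auto

lemma wbd_continuous: "wbd S k w M u \<Longrightarrow> continuous_on S u"
proof (cases k)
  case (Suc j)
  assume "wbd S k w M u"
  with Suc have "isCont u z" if "z \<in> S" for z
    using that has_derivative_continuous by fastforce
  then show ?thesis by (simp add: continuous_at_imp_continuous_on)
qed simp

lemma wbd_SucI:
  assumes "\<And>z. z \<in> S \<Longrightarrow> \<bar>u z\<bar> \<le> M * \<bar>fst z\<bar> ^ w"
    "\<And>z. z \<in> S \<Longrightarrow> (u has_derivative (\<lambda>h. fst h * p z + snd h * q z)) (at z)"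
    "wbd S k (w - 1) M p" "wbd S k w M q"
  shows "wbd S (Suc k) w M u"
  unfolding wbd.simps using assms by blast

lemma wbd_SucE:
  assumes "wbd S (Suc k) w M u"
  obtains p q where "\<And>z. z \<in> S \<Longrightarrow> (u has_derivative (\<lambda>h. fst h * p z + snd h * q z)) (at z)"
    "wbd S k (w - 1) M p" "wbd S k w M q"
  using assms by auto

lemma wbd_cong:
  assumes "open S" "\<And>z. z \<in> S \<Longrightarrow> u z = v z" "wbd S k w M u"
  shows "wbd S k w M v"
proof (cases k)
  case 0
  with assms show ?thesis by (auto cong: continuous_on_cong)
next
  case (Suc j)
  obtain p q where pq: "\<And>z. z \<in> S \<Longrightarrow> (u has_derivative (\<lambda>h. fst h * p z + snd h * q z)) (at z)"
    "wbd S j (w - 1) M p" "wbd S j w M q"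
    using wbd_SucE assms(3) Suc by blast
  show ?thesis unfolding Suc
  proof (rule wbd_SucI[OF _ _ pq(2,3)])
    show "(v has_derivative (\<lambda>h. fst h * p z + snd h * q z)) (at z)" if "z \<in> S" for z
      using has_derivative_transform_within_open[OF pq(1)[OF that] assms(1) that assms(2)] .
    show "\<bar>v z\<bar> \<le> M * \<bar>fst z\<bar> ^ w" if "z \<in> S" for z
      using wbd_bound[OF assms(3) that] assms(2)[OF that] by simp
  qed
qed

lemma wbd_subset: "wbd S k w M u \<Longrightarrow> T \<subseteq> S \<Longrightarrow> wbd T k w M u"
proof (induction k arbitrary: u w)
  case 0
  then show ?case by (auto intro: continuous_on_subset)
next
  case (Suc k)
  obtain p q where pq: "\<And>z. z \<in> S \<Longrightarrow> (u has_derivative (\<lambda>h. fst h * p z + snd h * q z)) (at z)"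
    "wbd S k (w - 1) M p" "wbd S k w M q"
    using wbd_SucE Suc.prems(1) by blast
  show ?case
    by (rule wbd_SucI[OF wbd_bound[OF Suc.prems(1)] pq(1) Suc.IH[OF pq(2)] Suc.IH[OF pq(3)]])
      (use Suc.prems(2) in auto)
qed

lemma wbd_order: "wbd S k w M u \<Longrightarrow> j \<le> k \<Longrightarrow> wbd S j w M u"
proof (induction j arbitrary: k u w)
  case 0
  then show ?case using wbd_continuous wbd_bound by auto
next
  case (Suc j)
  then obtain i where i: "k = Suc i" "j \<le> i" by (cases k) auto
  obtain p q where pq: "\<And>z. z \<in> S \<Longrightarrow> (u has_derivative (\<lambda>h. fst h * p z + snd h * q z)) (at z)"
    "wbd S i (w - 1) M p" "wbd S i w M q"
    using wbd_SucE Suc.prems(1) i(1) by blast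
  show ?case
    by (rule wbd_SucI[OF wbd_bound[OF Suc.prems(1)] pq(1) Suc.IH[OF pq(2) i(2)] Suc.IH[OF pq(3) i(2)]])
qed

lemma wbd_le: "wbd S k w M u \<Longrightarrow> M \<le> N \<Longrightarrow> wbd S k w N u"
proof (induction k arbitrary: u w)
  case 0
  have "M * \<bar>fst z\<bar> ^ w \<le> N * \<bar>fst z\<bar> ^ w" for z :: "real \<times> real"
    using 0(2) by (intro mult_right_mono) auto
  then show ?case using 0(1) order_trans by (fastforce simp: wbd.simps)
next
  case (Suc k)
  obtain p q where pq: "\<And>z. z \<in> S \<Longrightarrow> (u has_derivative (\<lambda>h. fst h * p z + snd h * q z)) (at z)"
    "wbd S k (w - 1) M p" "wbd S k w M q"
    using wbd_SucE Suc.prems(1) by blast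
  have "M * \<bar>fst z\<bar> ^ w \<le> N * \<bar>fst z\<bar> ^ w" for z :: "real \<times> real"
    using Suc.prems(2) by (intro mult_right_mono) auto
  then have "\<bar>u z\<bar> \<le> N * \<bar>fst z\<bar> ^ w" if "z \<in> S" for z
    using wbd_bound[OF Suc.prems(1) that] order_trans by blast
  from wbd_SucI[OF this pq(1) Suc.IH[OF pq(2) Suc.prems(2)] Suc.IH[OF pq(3) Suc.prems(2)]]
  show ?case .
qed

lemma wbd_Ck: "open S \<Longrightarrow> wbd S k w M u \<Longrightarrow> Ck_on k u S"
proof (induction k arbitrary: u w)
  case (Suc k)
  obtain p q where pq: "\<And>z. z \<in> S \<Longrightarrow> (u has_derivative (\<lambda>h. fst h * p z + snd h * q z)) (at z)"
    "wbd S k (w - 1) M p" "wbd S k w M q"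
    using wbd_SucE Suc.prems(2) by blast
  show ?case
    by (rule Ck_SucI[OF Suc.prems(1) pq(1)
          Ck_add[OF Suc.prems(1) Ck_mult[OF Suc.prems(1) Ck_const[OF Suc.prems(1)] Suc.IH[OF Suc.prems(1) pq(2)]]
            Ck_mult[OF Suc.prems(1) Ck_const[OF Suc.prems(1)] Suc.IH[OF Suc.prems(1) pq(3)]]]])
qed simp

lemma wbd_add: "wbd S k w M u \<Longrightarrow> wbd S k w N v \<Longrightarrow> wbd S k w (M + N) (\<lambda>z. u z + v z)"
proof (induction k arbitrary: u v w)
  case 0
  have "\<bar>u z + v z\<bar> \<le> (M + N) * \<bar>fst z\<bar> ^ w" if "z \<in> S" for z
    using wbd_bound[OF 0(1) that] wbd_bound[OF 0(2) that] by (simp add: distrib_right)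
  then show ?case using 0 by (auto intro: continuous_on_add)
next
  case (Suc k)
  obtain p q where pq: "\<And>z. z \<in> S \<Longrightarrow> (u has_derivative (\<lambda>h. fst h * p z + snd h * q z)) (at z)"
    "wbd S k (w - 1) M p" "wbd S k w M q"
    using wbd_SucE Suc.prems(1) by blast
  obtain p' q' where pq': "\<And>z. z \<in> S \<Longrightarrow> (v has_derivative (\<lambda>h. fst h * p' z + snd h * q' z)) (at z)"
    "wbd S k (w - 1) N p'" "wbd S k w N q'"
    using wbd_SucE Suc.prems(2) by blast
  show ?case
  proof (rule wbd_SucI[OF _ _ Suc.IH[OF pq(2) pq'(2)] Suc.IH[OF pq(3) pq'(3)]])
    show "\<bar>u z + v z\<bar> \<le> (M + N) * \<bar>fst z\<bar> ^ w" if "z \<in> S" for z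
      using wbd_bound[OF Suc.prems(1) that] wbd_bound[OF Suc.prems(2) that] by (simp add: distrib_right)
    show "((\<lambda>z. u z + v z) has_derivative (\<lambda>h. fst h * (p z + p' z) + snd h * (q z + q' z))) (at z)"
      if "z \<in> S" for z
      using has_derivative_add[OF pq(1)[OF that] pq'(1)[OF that]] by (simp add: algebra_simps)
  qed
qed

lemma wbd_const: "\<bar>c\<bar> \<le> M \<Longrightarrow> wbd S k 0 M (\<lambda>z. c)"
proof (induction k arbitrary: c)
  case (Suc k)
  show ?case
    by (rule wbd_SucI[where p="\<lambda>z. 0" and q="\<lambda>z. 0"]) (use Suc in auto)
qed simp

lemma wbd_zero: "0 \<le> M \<Longrightarrow> wbd S k w M (\<lambda>z. 0)"
proof (induction k arbitrary: w)
  case (Suc k)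
  show ?case
    by (rule wbd_SucI[where p="\<lambda>z. 0" and q="\<lambda>z. 0"]) (use Suc in auto)
qed simp

lemma wbd_cmult: "wbd S k w M u \<Longrightarrow> wbd S k w (\<bar>c\<bar> * M) (\<lambda>z. c * u z)"
proof (induction k arbitrary: u w)
  case 0
  have "\<bar>c * u z\<bar> \<le> \<bar>c\<bar> * M * \<bar>fst z\<bar> ^ w" if "z \<in> S" for z
    using mult_left_mono[OF wbd_bound[OF 0 that], of "\<bar>c\<bar>"] by (simp add: abs_mult mult.assoc)
  then show ?case using 0 by (auto intro!: continuous_intros)
next
  case (Suc k)
  obtain p q where pq: "\<And>z. z \<in> S \<Longrightarrow> (u has_derivative (\<lambda>h. fst h * p z + snd h * q z)) (at z)"
    "wbd S k (w - 1) M p" "wbd S k w M q"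
    using wbd_SucE Suc.prems(1) by blast
  show ?case
  proof (rule wbd_SucI[OF _ _ Suc.IH[OF pq(2)] Suc.IH[OF pq(3)]])
    show "\<bar>c * u z\<bar> \<le> \<bar>c\<bar> * M * \<bar>fst z\<bar> ^ w" if "z \<in> S" for z
      using mult_left_mono[OF wbd_bound[OF Suc.prems(1) that], of "\<bar>c\<bar>"] by (simp add: abs_mult mult.assoc)
    show "((\<lambda>z. c * u z) has_derivative (\<lambda>h. fst h * (c * p z) + snd h * (c * q z))) (at z)"
      if "z \<in> S" for z
      using has_derivative_mult_right[OF pq(1)[OF that], of c] by (simp add: algebra_simps)
  qed
qed

section \<open>Products, series and pullbacks where \<open>\<bar>fst z\<bar> \<le> 1\<close>\<close>

locale narrow =
  fixes S :: "(real \<times> real) set"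
  assumes S_open: "open S" and S_narrow: "z \<in> S \<Longrightarrow> \<bar>fst z\<bar> \<le> 1"
begin

text \<open>This is the purpose of the narrowness condition: a bound of higher weight implies every
  bound of lower weight with the same constant.\<close>

lemma pow_weight: "z \<in> S \<Longrightarrow> v \<le> w \<Longrightarrow> \<bar>fst z\<bar> ^ w \<le> \<bar>fst z\<bar> ^ v"
  using S_narrow by (intro power_decreasing) auto

lemma wbd_weight: "wbd S k w M u \<Longrightarrow> v \<le> w \<Longrightarrow> 0 \<le> M \<Longrightarrow> wbd S k v M u"
proof (induction k arbitrary: u v w)
  case 0
  have "\<bar>u z\<bar> \<le> M * \<bar>fst z\<bar> ^ v" if "z \<in> S" for z
    using wbd_bound[OF 0(1) that] mult_left_mono[OF pow_weight[OF that 0(2)] 0(3)] by linarith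
  then show ?case using 0 by auto
next
  case (Suc k)
  obtain p q where pq: "\<And>z. z \<in> S \<Longrightarrow> (u has_derivative (\<lambda>h. fst h * p z + snd h * q z)) (at z)"
    "wbd S k (w - 1) M p" "wbd S k w M q"
    using wbd_SucE Suc.prems(1) by blast
  have "\<bar>u z\<bar> \<le> M * \<bar>fst z\<bar> ^ v" if "z \<in> S" for z
    using wbd_bound[OF Suc.prems(1) that] mult_left_mono[OF pow_weight[OF that Suc.prems(2)] Suc.prems(3)] by linarith
  from wbd_SucI[OF this pq(1) Suc.IH[OF pq(2) diff_le_mono[OF Suc.prems(2)] Suc.prems(3)]
      Suc.IH[OF pq(3) Suc.prems(2,3)]]
  show ?case .
qed

text \<open>Weights add as orders of vanishing do. Each differentiation doubles the number of terms
  in the product rule, whence the factor \<open>2 ^ k\<close>.\<close>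

lemma wbd_mult:
  "wbd S k a M u \<Longrightarrow> wbd S k b N v \<Longrightarrow> 0 \<le> M \<Longrightarrow> 0 \<le> N \<Longrightarrow>
     wbd S k (a + b) (2 ^ k * (M * N)) (\<lambda>z. u z * v z)"
proof (induction k arbitrary: u v a b)
  case 0
  have "\<bar>u z * v z\<bar> \<le> M * N * \<bar>fst z\<bar> ^ (a + b)" if "z \<in> S" for z
    using mult_mono[OF wbd_bound[OF 0(1) that] wbd_bound[OF 0(2) that]] 0(3)
    by (simp add: abs_mult power_add mult_ac)
  then show ?case using 0 by (auto intro!: continuous_on_mult)
next
  case (Suc k)
  have MN: "0 \<le> M * N" using Suc.prems by simp
  obtain p q where pq: "\<And>z. z \<in> S \<Longrightarrow> (u has_derivative (\<lambda>h. fst h * p z + snd h * q z)) (at z)"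
    "wbd S k (a - 1) M p" "wbd S k a M q"
    using wbd_SucE Suc.prems(1) by blast
  obtain p' q' where pq': "\<And>z. z \<in> S \<Longrightarrow> (v has_derivative (\<lambda>h. fst h * p' z + snd h * q' z)) (at z)"
    "wbd S k (b - 1) N p'" "wbd S k b N q'"
    using wbd_SucE Suc.prems(2) by blast
  have u: "wbd S k a M u" and v: "wbd S k b N v"
    using wbd_order[OF Suc.prems(1)] wbd_order[OF Suc.prems(2)] by (auto simp del: wbd.simps)
  note nn = Suc.prems(3,4)
  \<comment> \<open>Truncated subtraction may leave a term with more weight than
    \<open>a + b - 1\<close>, as for \<open>a = 0\<close> and \<open>b > 0\<close>;
    \<open>wbd_weight\<close> gives the surplus away.\<close>
  have ab: "a + b - 1 \<le> a - 1 + b" "a + b - 1 \<le> a + (b - 1)" by auto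
  have nn2: "0 \<le> 2 ^ k * (M * N)" using MN by simp
  have e: "2 ^ k * (M * N) + 2 ^ k * (M * N) = 2 ^ Suc k * (M * N)" by simp
  show ?case
  proof (rule wbd_SucI)
    show "\<bar>u z * v z\<bar> \<le> 2 ^ Suc k * (M * N) * \<bar>fst z\<bar> ^ (a + b)" if "z \<in> S" for z
    proof -
      have "\<bar>u z * v z\<bar> \<le> M * N * \<bar>fst z\<bar> ^ (a + b)"
        using mult_mono[OF wbd_bound[OF Suc.prems(1) that] wbd_bound[OF Suc.prems(2) that]] nn(1)
        by (simp add: abs_mult power_add mult_ac)
      also have "\<dots> \<le> 2 ^ Suc k * (M * N * \<bar>fst z\<bar> ^ (a + b))"
        using mult_right_mono[OF one_le_power[of "2::real" "Suc k"], of "M * N * \<bar>fst z\<bar> ^ (a + b)"] MN by simp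
      finally show ?thesis by (simp add: mult.assoc)
    qed
    show "((\<lambda>z. u z * v z) has_derivative (\<lambda>h. fst h * (p z * v z + u z * p' z) + snd h * (q z * v z + u z * q' z))) (at z)"
      if "z \<in> S" for z
      using has_derivative_mult[OF pq(1)[OF that] pq'(1)[OF that]] by (simp add: algebra_simps)
    have "wbd S k (a + b - 1) (2 ^ k * (M * N) + 2 ^ k * (M * N)) (\<lambda>z. p z * v z + u z * p' z)"
      by (intro wbd_add wbd_weight[OF Suc.IH[OF pq(2) v nn] ab(1) nn2] wbd_weight[OF Suc.IH[OF u pq'(2) nn] ab(2) nn2])
    then show "wbd S k (a + b - 1) (2 ^ Suc k * (M * N)) (\<lambda>z. p z * v z + u z * p' z)"
      by (simp only: e)
    have "wbd S k (a + b) (2 ^ k * (M * N) + 2 ^ k * (M * N)) (\<lambda>z. q z * v z + u z * q' z)"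
      by (intro wbd_add Suc.IH[OF pq(3) v nn] Suc.IH[OF u pq'(3) nn])
    then show "wbd S k (a + b) (2 ^ Suc k * (M * N)) (\<lambda>z. q z * v z + u z * q' z)"
      by (simp only: e)
  qed
qed

text \<open>The constant \<open>M * r ^ n\<close> bounds a term together with all its derivatives.
  The series of the partial derivatives therefore satisfy the induction hypothesis with the same
  \<open>M\<close> and \<open>r\<close>, and they converge uniformly, which justifies termwise
  differentiation on the convex set \<open>S\<close>.\<close>

lemma wbd_suminf:
  assumes "convex S" "0 \<le> M" "0 \<le> r" "r < 1" "\<And>n. wbd S k w (M * r ^ n) (u n)"
  shows "wbd S k w (M / (1 - r)) (\<lambda>z. \<Sum>n. u n z)"
  using assms(5)
proof (induction k arbitrary: u w)
  have smr: "summable (\<lambda>n. M * r ^ n)" using assms by (intro summable_mult summable_geometric) auto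
  have smr': "(\<lambda>n. M * r ^ n) sums (M / (1 - r))"
    using geometric_sums[of r] assms sums_mult[of "\<lambda>n. r ^ n" "1 / (1 - r)" M] by auto
  have unif: "uniform_limit S (\<lambda>n z. \<Sum>i<n. u i z) (\<lambda>z. \<Sum>n. u n z) sequentially"
    if u: "\<And>n. wbd S k w (M * r ^ n) (u n)" for k w u
  proof (rule Weierstrass_m_test[OF _ smr])
    fix n z assume z: "z \<in> S"
    have "\<bar>u n z\<bar> \<le> M * r ^ n * \<bar>fst z\<bar> ^ w" using wbd_bound[OF u z] .
    also have "\<dots> \<le> M * r ^ n * 1"
      using S_narrow[OF z] assms by (intro mult_left_mono power_le_one) auto
    finally show "norm (u n z) \<le> M * r ^ n" by simp
  qed
  have bnd: "summable (\<lambda>n. u n z) \<and> \<bar>\<Sum>n. u n z\<bar> \<le> M / (1 - r) * \<bar>fst z\<bar> ^ w"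
    if u: "\<And>n. wbd S k w (M * r ^ n) (u n)" and z: "z \<in> S" for k w u z
  proof -
    have b: "norm (u n z) \<le> M * r ^ n * \<bar>fst z\<bar> ^ w" for n using wbd_bound[OF u z] by simp
    have s: "(\<lambda>n. M * r ^ n * \<bar>fst z\<bar> ^ w) sums (M / (1 - r) * \<bar>fst z\<bar> ^ w)"
      using smr' by (rule sums_mult2)
    have "summable (\<lambda>n. norm (u n z))"
      using summable_comparison_test'[OF sums_summable[OF s], of 0 "\<lambda>n. norm (u n z)"] b by simp
    then have "\<bar>\<Sum>n. u n z\<bar> \<le> (\<Sum>n. norm (u n z))" using summable_norm[of "\<lambda>n. u n z"] by simp
    also have "\<dots> \<le> (\<Sum>n. M * r ^ n * \<bar>fst z\<bar> ^ w)"
      by (rule suminf_le[OF b \<open>summable (\<lambda>n. norm (u n z))\<close> sums_summable[OF s]])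
    also have "\<dots> = M / (1 - r) * \<bar>fst z\<bar> ^ w" using s by (rule sums_unique[symmetric])
    finally show ?thesis using summable_norm_cancel[OF \<open>summable (\<lambda>n. norm (u n z))\<close>] by simp
  qed
  {
    case 0
    have "continuous_on S (\<lambda>z. \<Sum>n. u n z)"
      by (rule uniform_limit_theorem[OF _ unif[OF 0]])
        (use wbd_continuous[OF 0] in \<open>auto intro!: always_eventually continuous_on_sum\<close>)
    then show ?case using bnd[OF 0] by auto
  next
    case (Suc k)
    define P where "P n p q \<longleftrightarrow> (\<forall>z\<in>S. (u n has_derivative (\<lambda>h. fst h * p z + snd h * q z)) (at z)) \<and>
        wbd S k (w - 1) (M * r ^ n) p \<and> wbd S k w (M * r ^ n) q" for n p q
    have "\<forall>n. \<exists>p q. P n p q"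
      using Suc.prems unfolding P_def by simp
    then obtain p q where "\<And>n. P n (p n) (q n)" by metis
    then have pq: "\<And>n z. z \<in> S \<Longrightarrow> (u n has_derivative (\<lambda>h. fst h * p n z + snd h * q n z)) (at z)"
      "\<And>n. wbd S k (w - 1) (M * r ^ n) (p n)" "\<And>n. wbd S k w (M * r ^ n) (q n)"
      unfolding P_def by auto
    have der: "((\<lambda>z. \<Sum>n. u n z) has_derivative (\<lambda>h. fst h * (\<Sum>n. p n z) + snd h * (\<Sum>n. q n z))) (at z)"
      if z: "z \<in> S" for z
    proof -
      have "\<exists>g. \<forall>x\<in>S. (\<lambda>n. u n x) sums g x \<and>
          (g has_derivative (\<lambda>h. fst h * (\<Sum>n. p n x) + snd h * (\<Sum>n. q n x))) (at x within S)"
      proof (rule has_derivative_series[where f="\<lambda>n x. u n x" and f'="\<lambda>n x h. fst h * p n x + snd h * q n x"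
              and g'="\<lambda>x h. fst h * (\<Sum>n. p n x) + snd h * (\<Sum>n. q n x)" and l="\<Sum>n. u n z", OF assms(1) _ _ z])
        show "(u n has_derivative (\<lambda>h. fst h * p n x + snd h * q n x)) (at x within S)" if "x \<in> S" for n x
          using pq(1)[OF that] by (rule has_derivative_at_withinI)
        show "(\<lambda>n. u n z) sums (\<Sum>n. u n z)"
          by (rule summable_sums[OF conjunct1[OF bnd[OF Suc.prems z]]])
        fix e :: real assume e: "0 < e"
        have "\<forall>\<^sub>F n in sequentially. \<forall>x\<in>S. dist (\<Sum>i<n. p i x) (\<Sum>n. p n x) < e/2"
          by (rule uniform_limitD[OF unif[OF pq(2)]]) (use e in simp)
        moreover have "\<forall>\<^sub>F n in sequentially. \<forall>x\<in>S. dist (\<Sum>i<n. q i x) (\<Sum>n. q n x) < e/2"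
          by (rule uniform_limitD[OF unif[OF pq(3)]]) (use e in simp)
        ultimately show "\<forall>\<^sub>F n in sequentially. \<forall>x\<in>S. \<forall>h.
          norm ((\<Sum>i<n. fst h * p i x + snd h * q i x) - (fst h * (\<Sum>n. p n x) + snd h * (\<Sum>n. q n x))) \<le> e * norm h"
        proof eventually_elim
          case (elim n)
          show ?case
          proof (intro ballI allI)
            fix x h assume "x \<in> S"
            define A B where "A = (\<Sum>i<n. p i x) - (\<Sum>n. p n x)" and "B = (\<Sum>i<n. q i x) - (\<Sum>n. q n x)"
            have AB: "\<bar>A\<bar> \<le> e/2" "\<bar>B\<bar> \<le> e/2"
              using elim \<open>x \<in> S\<close> by (auto simp: A_def B_def dist_real_def less_imp_le)
            have "(\<Sum>i<n. fst h * p i x + snd h * q i x) - (fst h * (\<Sum>n. p n x) + snd h * (\<Sum>n. q n x))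
               = fst h * A + snd h * B"
              by (simp add: A_def B_def sum.distrib sum_distrib_left algebra_simps)
            also have "norm \<dots> \<le> norm h * (e/2) + norm h * (e/2)"
            proof -
              have "norm (fst h * A + snd h * B) \<le> \<bar>fst h\<bar> * \<bar>A\<bar> + \<bar>snd h\<bar> * \<bar>B\<bar>"
                by (metis abs_mult abs_triangle_ineq real_norm_def)
              also have "\<dots> \<le> norm h * (e/2) + norm h * (e/2)"
                using AB norm_fst_le[of "fst h" "snd h"] norm_snd_le[of "snd h" "fst h"]
                by (intro add_mono mult_mono) auto
              finally show ?thesis .
            qed
            finally show "norm ((\<Sum>i<n. fst h * p i x + snd h * q i x) - (fst h * (\<Sum>n. p n x) + snd h * (\<Sum>n. q n x))) \<le> e * norm h"
              by (simp add: mult.commute)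
          qed
        qed
      qed
      then obtain g where g: "\<And>x. x \<in> S \<Longrightarrow> (\<lambda>n. u n x) sums g x"
        "(g has_derivative (\<lambda>h. fst h * (\<Sum>n. p n z) + snd h * (\<Sum>n. q n z))) (at z within S)"
        using z by blast
      have "(g has_derivative (\<lambda>h. fst h * (\<Sum>n. p n z) + snd h * (\<Sum>n. q n z))) (at z)"
        using g(2) at_within_open[OF z S_open] by simp
      then show ?thesis
        by (rule has_derivative_transform_within_open[OF _ S_open z]) (metis g(1) sums_unique)
    qed
    show ?case
      by (rule wbd_SucI[OF conjunct2[OF bnd[OF Suc.prems]] der Suc.IH[OF pq(2)] Suc.IH[OF pq(3)]])
  }
qed

text \<open>The summand \<open>1 / \<bar>l\<bar>\<close> in \<open>R\<close> pays for the mixed term \<open>(\<partial>\<^sub>x u \<circ> F) * \<partial>\<^sub>y g1\<close>, whose first factor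
  is only known with weight \<open>w - 1\<close>.\<close>
lemma wbd_pullback:
  fixes l s \<epsilon> D :: real
  defines "L \<equiv> \<bar>l\<bar> + D * \<epsilon>" and "R \<equiv> \<bar>s\<bar> + D * \<epsilon> * (1 + 1 / \<bar>l\<bar>)"
  assumes l: "l \<noteq> 0" and eps: "0 \<le> \<epsilon>" and D: "2 ^ Suc K \<le> D" and L: "L \<le> 1" and R: "1 \<le> R"
    and g1: "wbd S K 1 \<epsilon> g1" and g2: "wbd S K 0 \<epsilon> g2"
    and maps: "\<And>z. z \<in> S \<Longrightarrow> (l * fst z + g1 z, s * snd z + g2 z) \<in> S"
    and M: "0 \<le> M"
  shows "j \<le> K \<Longrightarrow> wbd S j w M u \<Longrightarrow>
     wbd S j w (L ^ w * R ^ j * M) (\<lambda>z. u (l * fst z + g1 z, s * snd z + g2 z))"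
proof (induction j arbitrary: u w)
  define F where "F = (\<lambda>z. (l * fst z + g1 z, s * snd z + g2 z))"
  have D1: "1 \<le> D" using D order_trans[OF one_le_power[of "2::real" "Suc K"]] by simp
  have L0: "0 < L" "\<bar>l\<bar> \<le> L" using l eps D1 by (auto simp: L_def intro: add_pos_nonneg)
  have bound0: "\<bar>u (F z)\<bar> \<le> L ^ w * R ^ j * M * \<bar>fst z\<bar> ^ w" if u: "wbd S j w M u" and z: "z \<in> S" for u j w z
  proof -
    have "\<bar>l * fst z + g1 z\<bar> \<le> \<bar>l\<bar> * \<bar>fst z\<bar> + \<epsilon> * \<bar>fst z\<bar>"
      using wbd_bound[OF g1 z] abs_triangle_ineq[of "l * fst z" "g1 z"] by (simp add: abs_mult)
    also have "\<dots> \<le> L * \<bar>fst z\<bar>"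
      using mult_right_mono[OF mult_right_mono[OF D1 eps], of "\<bar>fst z\<bar>"] by (simp add: L_def algebra_simps)
    finally have 1: "\<bar>fst (F z)\<bar> \<le> L * \<bar>fst z\<bar>" by (simp add: F_def)
    have "\<bar>u (F z)\<bar> \<le> M * \<bar>fst (F z)\<bar> ^ w" using wbd_bound[OF u maps[OF z]] by (simp add: F_def)
    also have "\<dots> \<le> M * (L * \<bar>fst z\<bar>) ^ w" using 1 M by (intro mult_left_mono power_mono) auto
    also have "\<dots> = 1 * (L ^ w * M * \<bar>fst z\<bar> ^ w)" by (simp add: power_mult_distrib)
    also have "\<dots> \<le> R ^ j * (L ^ w * M * \<bar>fst z\<bar> ^ w)"
      using one_le_power[OF R, of j] M L0 by (intro mult_right_mono) auto
    finally show ?thesis by (simp add: mult_ac)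
  qed
  {
    case 0
    have "continuous_on S F" unfolding F_def
      by (intro continuous_intros wbd_continuous[OF g1] wbd_continuous[OF g2])
    then have "continuous_on S (\<lambda>z. u (F z))"
      by (rule continuous_on_compose2[OF wbd_continuous[OF 0(2)]]) (use maps in \<open>auto simp: F_def\<close>)
    then show ?case using bound0[OF 0(2)] by (simp add: F_def)
  next
    case (Suc j)
    obtain K' where K: "K = Suc K'" "j \<le> K'" using Suc.prems(1) by (cases K) auto
    have Kj: "j \<le> K" using K by simp
    obtain p1 q1 where pq1: "\<And>z. z \<in> S \<Longrightarrow> (g1 has_derivative (\<lambda>h. fst h * p1 z + snd h * q1 z)) (at z)"
      "wbd S K' (1 - 1) \<epsilon> p1" "wbd S K' 1 \<epsilon> q1"
      using wbd_SucE g1[unfolded K(1)] by blast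
    obtain p2 q2 where pq2: "\<And>z. z \<in> S \<Longrightarrow> (g2 has_derivative (\<lambda>h. fst h * p2 z + snd h * q2 z)) (at z)"
      "wbd S K' (0 - 1) \<epsilon> p2" "wbd S K' 0 \<epsilon> q2"
      using wbd_SucE g2[unfolded K(1)] by blast
    obtain p q where pq: "\<And>z. z \<in> S \<Longrightarrow> (u has_derivative (\<lambda>h. fst h * p z + snd h * q z)) (at z)"
      "wbd S j (w - 1) M p" "wbd S j w M q"
      using wbd_SucE Suc.prems(2) by blast
    have p1: "wbd S j 0 \<epsilon> p1" and q1: "wbd S j 1 \<epsilon> q1" and p2: "wbd S j 0 \<epsilon> p2" and q2: "wbd S j 0 \<epsilon> q2"
      using wbd_order[OF pq1(2) K(2)] wbd_order[OF pq1(3) K(2)] wbd_order[OF pq2(2) K(2)] wbd_order[OF pq2(3) K(2)]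
      by auto
    define A B where "A = L ^ (w - 1) * R ^ j * M" and "B = L ^ w * R ^ j * M"
    have AB0: "0 \<le> A" "0 \<le> B" using L0 R M by (auto simp: A_def B_def)
    have pF: "wbd S j (w - 1) A (\<lambda>z. p (F z))" and qF: "wbd S j w B (\<lambda>z. q (F z))"
      using Suc.IH[OF Kj pq(2)] Suc.IH[OF Kj pq(3)] by (auto simp: A_def B_def F_def)
    have BLA: "B \<le> A"
    proof -
      have "L ^ w \<le> L ^ (w - 1)" using L L0 by (intro power_decreasing) auto
      then show ?thesis unfolding A_def B_def using R M by (intro mult_right_mono) auto
    qed
    \<comment> \<open>The \<open>x\<close>-derivative of the inner map contributes a factor of at
      most \<open>L\<close>, which restores the power of \<open>L\<close> that \<open>p\<close> lost
      with its weight. For \<open>w = 0\<close> nothing was lost: truncation gives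
      \<open>A = B\<close>.\<close>
    have LA: "L * A \<le> R * B"
    proof (cases w)
      case 0
      then have "A = B" by (simp add: A_def B_def)
      moreover have "L \<le> R" using L R by simp
      ultimately show ?thesis using AB0 mult_right_mono by blast
    next
      case (Suc v)
      then have "L * A = B" by (simp add: A_def B_def)
      then show ?thesis using mult_right_mono[OF R AB0(2)] by simp
    qed
    have AlB: "A \<le> B / \<bar>l\<bar>"
    proof (cases w)
      case 0
      then have "A = B" by (simp add: A_def B_def)
      moreover have "B * \<bar>l\<bar> \<le> B * 1" using L L0 AB0 by (intro mult_left_mono) auto
      ultimately show ?thesis using l by (simp add: le_divide_eq)
    next
      case (Suc v)
      then have "B = L * A" by (simp add: A_def B_def)
      moreover have "A * \<bar>l\<bar> \<le> A * L" using L0 AB0 by (intro mult_left_mono) auto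
      ultimately show ?thesis using l by (simp add: le_divide_eq mult.commute)
    qed
    \<comment> \<open>The \<open>x\<close>-derivative contains two perturbation products, each with
      the constant \<open>2 ^ j\<close> of \<open>wbd_mult\<close>; this is what the lower bound on
      \<open>D\<close> pays for.\<close>
    have d2: "2 ^ j * 2 \<le> D"
      using D[unfolded power_Suc] power_increasing[OF Kj, of "2::real"] by linarith
    have "wbd S j (w - 1) (\<bar>l\<bar> * A + 2 ^ j * (A * \<epsilon>) + 2 ^ j * (B * \<epsilon>)) (\<lambda>z. l * p (F z) + p (F z) * p1 z + q (F z) * p2 z)"
    proof (intro wbd_add)
      show "wbd S j (w - 1) (\<bar>l\<bar> * A) (\<lambda>z. l * p (F z))" by (rule wbd_cmult[OF pF])
      show "wbd S j (w - 1) (2 ^ j * (A * \<epsilon>)) (\<lambda>z. p (F z) * p1 z)"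
        using wbd_mult[OF pF p1 AB0(1) eps] by simp
      show "wbd S j (w - 1) (2 ^ j * (B * \<epsilon>)) (\<lambda>z. q (F z) * p2 z)"
        using wbd_weight[OF wbd_mult[OF qF p2 AB0(2) eps], of "w - 1"] AB0(2) eps by simp
    qed
    moreover have "\<bar>l\<bar> * A + 2 ^ j * (A * \<epsilon>) + 2 ^ j * (B * \<epsilon>) \<le> R * B"
    proof -
      have "2 ^ j * (B * \<epsilon>) \<le> 2 ^ j * (A * \<epsilon>)" using BLA eps by (intro mult_left_mono mult_right_mono) auto
      then have "\<bar>l\<bar> * A + 2 ^ j * (A * \<epsilon>) + 2 ^ j * (B * \<epsilon>) \<le> \<bar>l\<bar> * A + 2 ^ j * 2 * (A * \<epsilon>)" by linarith
      also have "\<dots> \<le> \<bar>l\<bar> * A + D * (A * \<epsilon>)"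
        using d2 AB0(1) eps by (intro add_left_mono mult_right_mono) auto
      also have "\<dots> = L * A" by (simp add: L_def algebra_simps)
      finally show ?thesis using LA by linarith
    qed
    ultimately have X: "wbd S j (w - 1) (R * B) (\<lambda>z. l * p (F z) + p (F z) * p1 z + q (F z) * p2 z)"
      by (rule wbd_le)
    have "wbd S j w (2 ^ j * (A * \<epsilon>) + \<bar>s\<bar> * B + 2 ^ j * (B * \<epsilon>)) (\<lambda>z. p (F z) * q1 z + s * q (F z) + q (F z) * q2 z)"
    proof (intro wbd_add)
      show "wbd S j w (2 ^ j * (A * \<epsilon>)) (\<lambda>z. p (F z) * q1 z)"
        using wbd_weight[OF wbd_mult[OF pF q1 AB0(1) eps], of w] AB0(1) eps by simp
      show "wbd S j w (\<bar>s\<bar> * B) (\<lambda>z. s * q (F z))" by (rule wbd_cmult[OF qF])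
      show "wbd S j w (2 ^ j * (B * \<epsilon>)) (\<lambda>z. q (F z) * q2 z)"
        using wbd_mult[OF qF q2 AB0(2) eps] by simp
    qed
    moreover have "2 ^ j * (A * \<epsilon>) + \<bar>s\<bar> * B + 2 ^ j * (B * \<epsilon>) \<le> R * B"
    proof -
      have "2 ^ j \<le> D" using d2 zero_le_power[of "2::real" j] by linarith
      then have "2 ^ j * (A * \<epsilon>) \<le> D * (B / \<bar>l\<bar> * \<epsilon>)" "2 ^ j * (B * \<epsilon>) \<le> D * (B * \<epsilon>)"
        using AlB AB0 eps D1 by (intro mult_mono; simp)+
      moreover have "R * B = D * (B / \<bar>l\<bar> * \<epsilon>) + \<bar>s\<bar> * B + D * (B * \<epsilon>)"
        by (simp add: R_def algebra_simps)
      ultimately show ?thesis by linarith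
    qed
    ultimately have Y: "wbd S j w (R * B) (\<lambda>z. p (F z) * q1 z + s * q (F z) + q (F z) * q2 z)"
      by (rule wbd_le)
    have RB: "L ^ w * R ^ Suc j * M = R * B" by (simp add: B_def)
    have "wbd S (Suc j) w (R * B) (\<lambda>z. u (F z))"
    proof (rule wbd_SucI[OF _ _ X Y])
      show "\<bar>u (F z)\<bar> \<le> R * B * \<bar>fst z\<bar> ^ w" if "z \<in> S" for z
        using bound0[OF Suc.prems(2) that] unfolding RB .
      show "((\<lambda>z. u (F z)) has_derivative (\<lambda>h. fst h * (l * p (F z) + p (F z) * p1 z + q (F z) * p2 z)
         + snd h * (p (F z) * q1 z + s * q (F z) + q (F z) * q2 z))) (at z)" if z: "z \<in> S" for z
      proof -
        have "(F has_derivative (\<lambda>h. (l * fst h + (fst h * p1 z + snd h * q1 z), s * snd h + (fst h * p2 z + snd h * q2 z)))) (at z)"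
          unfolding F_def
          by (intro has_derivative_Pair has_derivative_add pq1(1)[OF z] pq2(1)[OF z] has_derivative_mult_right
              has_derivative_fst has_derivative_snd has_derivative_ident)
        from has_derivative_compose[OF this pq(1)]
        have "((\<lambda>z. u (F z)) has_derivative (\<lambda>h. (l * fst h + (fst h * p1 z + snd h * q1 z)) * p (F z)
            + (s * snd h + (fst h * p2 z + snd h * q2 z)) * q (F z))) (at z)"
          using maps[OF z] by (simp add: F_def)
        then show ?thesis by (simp add: algebra_simps)
      qed
    qed
    then show ?case using RB by (simp only: F_def)
  }
qed

end

text \<open>A Neumann series: by \<open>wbd_pullback\<close> the operator
  \<open>u \<mapsto> u \<circ> F / \<mu>\<close> has norm below 1 in the weighted \<open>C^k\<close>
  bounds, so iterating it on \<open>G / \<mu>\<close> gives a geometric series. Shifting the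
  summation index by one gives the equation.\<close>

lemma (in narrow) homological_equation:
  fixes l s \<epsilon> D \<mu> :: real
  defines "L \<equiv> \<bar>l\<bar> + D * \<epsilon>" and "R \<equiv> \<bar>s\<bar> + D * \<epsilon> * (1 + 1 / \<bar>l\<bar>)"
  assumes l: "l \<noteq> 0" and eps: "0 \<le> \<epsilon>" and D: "2 ^ Suc k \<le> D" and L: "L \<le> 1" and R: "1 \<le> R"
    and g1: "wbd S k 1 \<epsilon> g1" and g2: "wbd S k 0 \<epsilon> g2"
    and maps: "\<And>z. z \<in> S \<Longrightarrow> (l * fst z + g1 z, s * snd z + g2 z) \<in> S"
    and conv: "convex S" and mu: "L ^ w * R ^ k < \<bar>\<mu>\<bar>" and M: "0 \<le> M" and G: "wbd S k w M G"
  shows "\<exists>u C. wbd S k w C u \<and> (\<forall>z\<in>S. u (l * fst z + g1 z, s * snd z + g2 z) = \<mu> * u z - G z)"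
proof -
  define F where "F = (\<lambda>z. (l * fst z + g1 z, s * snd z + g2 z))"
  define \<rho> where "\<rho> = L ^ w * R ^ k"
  have D1: "1 \<le> D" using D order_trans[OF one_le_power[of "2::real" "Suc k"]] by simp
  have L0: "0 \<le> L" using eps D1 by (simp add: L_def)
  have \<rho>: "0 \<le> \<rho>" "\<rho> < \<bar>\<mu>\<bar>" using L0 R mu by (auto simp: \<rho>_def)
  then have \<mu>0: "\<mu> \<noteq> 0" by auto
  have it: "wbd S k w (\<rho> ^ n * M) (\<lambda>z. G ((F ^^ n) z))" for n
  proof (induction n)
    case 0
    show ?case using G by simp
  next
    case (Suc n)
    have "wbd S k w (L ^ w * R ^ k * (\<rho> ^ n * M)) (\<lambda>z. G ((F ^^ n) (l * fst z + g1 z, s * snd z + g2 z)))"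
      unfolding L_def R_def
      by (rule wbd_pullback[OF l eps D L[unfolded L_def] R[unfolded R_def] g1 g2 maps _ order_refl Suc])
        (use M \<rho> in auto)
    moreover have "(F ^^ Suc n) z = (F ^^ n) (l * fst z + g1 z, s * snd z + g2 z)" for z
      by (simp only: funpow_Suc_right o_apply) (simp add: F_def)
    moreover have "L ^ w * R ^ k * (\<rho> ^ n * M) = \<rho> ^ Suc n * M" by (simp add: \<rho>_def)
    ultimately show ?case by simp
  qed
  define u where "u n z = (1 / \<mu>) ^ Suc n * G ((F ^^ n) z)" for n z
  define r where "r = \<rho> / \<bar>\<mu>\<bar>"
  have r: "0 \<le> r" "r < 1" using \<rho> by (auto simp: r_def divide_less_eq)
  have un: "wbd S k w (M / \<bar>\<mu>\<bar> * r ^ n) (u n)" for n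
  proof -
    have "wbd S k w (\<bar>(1 / \<mu>) ^ Suc n\<bar> * (\<rho> ^ n * M)) (u n)"
      unfolding u_def by (rule wbd_cmult[OF it])
    moreover have "\<bar>(1 / \<mu>) ^ Suc n\<bar> * (\<rho> ^ n * M) = M / \<bar>\<mu>\<bar> * r ^ n"
      by (simp add: r_def power_divide power_abs abs_divide abs_mult)
    ultimately show ?thesis by (simp only:)
  qed
  have W: "wbd S k w (M / \<bar>\<mu>\<bar> / (1 - r)) (\<lambda>z. \<Sum>n. u n z)"
    by (rule wbd_suminf[OF conv _ r un]) (use M in simp)
  have sm: "summable (\<lambda>n. u n z)" if z: "z \<in> S" for z
  proof (rule summable_comparison_test')
    show "summable (\<lambda>n. M / \<bar>\<mu>\<bar> * r ^ n)" using r by (intro summable_mult summable_geometric) auto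
    show "norm (u n z) \<le> M / \<bar>\<mu>\<bar> * r ^ n" for n
    proof -
      have "\<bar>u n z\<bar> \<le> M / \<bar>\<mu>\<bar> * r ^ n * \<bar>fst z\<bar> ^ w" by (rule wbd_bound[OF un z])
      also have "\<dots> \<le> M / \<bar>\<mu>\<bar> * r ^ n * 1"
        using S_narrow[OF z] M r by (intro mult_left_mono power_le_one) auto
      finally show ?thesis by simp
    qed
  qed
  have "(\<Sum>n. u n (F z)) = \<mu> * (\<Sum>n. u n z) - G z" if z: "z \<in> S" for z
  proof -
    have eq: "u n (F z) = \<mu> * u (Suc n) z" for n
      using \<mu>0 by (simp add: u_def funpow_swap1)
    have "(\<Sum>n. u n (F z)) = \<mu> * (\<Sum>n. u (Suc n) z)"
      unfolding eq using sm[OF z] by (intro suminf_mult) (simp add: summable_Suc_iff[of "\<lambda>n. u n z"])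
    also have "(\<Sum>n. u (Suc n) z) = (\<Sum>n. u n z) - u 0 z"
      by (rule suminf_split_head[OF sm[OF z]])
    also have "u 0 z = G z / \<mu>" by (simp add: u_def)
    finally show ?thesis using \<mu>0 by (simp add: right_diff_distrib)
  qed
  then show ?thesis using W by (auto simp: F_def)
qed

section \<open>Linear functional equations on an interval\<close>

lemma Ck_vector_derivativeI:
  fixes f :: "real \<Rightarrow> 'b::real_normed_vector"
  assumes "open U" "\<And>t. t \<in> U \<Longrightarrow> (f has_vector_derivative f' t) (at t)" "Ck_on k f' U"
  shows "Ck_on (Suc k) f U"
  by (rule Ck_SucI[where f'="\<lambda>t h. h *\<^sub>R f' t", OF assms(1)])
    (use assms in \<open>auto simp: has_vector_derivative_def intro!: Ck_scaleR Ck_const\<close>)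

lemma Ck_vector_derivative_ex:
  fixes f :: "real \<Rightarrow> 'b::real_normed_vector"
  assumes "open U" "Ck_on (Suc k) f U"
  shows "\<exists>f'. (\<forall>t\<in>U. (f has_vector_derivative f' t) (at t)) \<and> Ck_on k f' U"
proof -
  obtain F where F: "\<And>x. x \<in> U \<Longrightarrow> (f has_derivative F x) (at x)" "\<And>v. Ck_on k (\<lambda>x. F x v) U"
    using Ck_Suc_ex[OF assms] by blast
  have "(f has_vector_derivative F t 1) (at t)" if "t \<in> U" for t
  proof -
    have "F t h = h *\<^sub>R F t 1" for h
      using linear_scale[OF has_derivative_linear[OF F(1)[OF that]], of h 1] by simp
    then have "F t = (\<lambda>h. h *\<^sub>R F t 1)" by (rule ext)
    then show ?thesis using F(1)[OF that] unfolding has_vector_derivative_def by simp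
  qed
  with F(2) show ?thesis by (intro exI[of _ "\<lambda>t. F t 1"]) auto
qed

section \<open>Geometric convergence on compact subintervals\<close>

lemma abs_divide_le_abs:
  fixes s t :: real
  assumes "1 \<le> \<bar>s\<bar>"
  shows "\<bar>t / s\<bar> \<le> \<bar>t\<bar>"
proof -
  have "\<bar>t\<bar> * 1 \<le> \<bar>t\<bar> * \<bar>s\<bar>" using assms by (intro mult_left_mono) auto
  then show ?thesis using assms by (simp add: abs_divide divide_le_eq)
qed

lemma geometric_limit:
  fixes x :: "nat \<Rightarrow> 'b::banach"
  assumes "0 \<le> r" "r < 1" "\<And>n. norm (x (Suc n) - x n) \<le> K * r ^ n"
  shows "convergent x" "norm (x n - lim x) \<le> K / (1 - r) * r ^ n"
proof -
  let ?d = "\<lambda>i. x (Suc i) - x i"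
  have sK: "summable (\<lambda>i. K * r ^ (i + n))" for n
    using assms(1,2) by (simp add: power_add summable_mult summable_mult2 mult.assoc[symmetric])
  have sn: "summable (\<lambda>i. norm (?d (i + n)))" for n
    by (rule summable_comparison_test'[OF sK[of n], of 0]) (use assms(3) in auto)
  have s: "summable (\<lambda>i. ?d (i + n))" for n by (rule summable_norm_cancel[OF sn])
  have lim: "(\<lambda>m. x (m + n)) \<longlonglongrightarrow> x n + (\<Sum>i. ?d (i + n))" for n
  proof -
    have "(\<lambda>m. x n + (\<Sum>i<m. ?d (i + n))) \<longlonglongrightarrow> x n + (\<Sum>i. ?d (i + n))"
      using summable_LIMSEQ[OF s] by (intro tendsto_intros)
    moreover have "x n + (\<Sum>i<m. ?d (i + n)) = x (m + n)" for m
      using sum_lessThan_telescope[of "\<lambda>i. x (i + n)" m] by simp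
    ultimately show ?thesis by simp
  qed
  show c: "convergent x"
    using lim[of 0] by (auto simp: convergent_def)
  have "lim x = x n + (\<Sum>i. ?d (i + n))"
    using LIMSEQ_ignore_initial_segment[OF c[unfolded convergent_LIMSEQ_iff], of n] lim[of n] LIMSEQ_unique by blast
  then have "norm (x n - lim x) = norm (\<Sum>i. ?d (i + n))" by simp
  also have "\<dots> \<le> (\<Sum>i. norm (?d (i + n)))" by (rule summable_norm[OF sn])
  also have "\<dots> \<le> (\<Sum>i. K * r ^ (i + n))" by (rule suminf_le[OF assms(3) sn sK])
  also have "\<dots> = K / (1 - r) * r ^ n"
  proof -
    have "(\<lambda>i. K * r ^ n * r ^ i) sums (K * r ^ n * (1 / (1 - r)))"
      using geometric_sums[of r] assms(1,2) by (intro sums_mult) auto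
    from sums_unique[OF this] show ?thesis by (simp add: power_add mult_ac)
  qed
  finally show "norm (x n - lim x) \<le> K / (1 - r) * r ^ n" .
qed

text \<open>The constant and the rate may depend on the closed subinterval, so no bounds are
  required at the ends of the open interval. The weight \<open>\<bar>t\<bar> ^ p\<close> is there
  because the substitution \<open>t / s\<close> shrinks it by \<open>\<bar>s\<bar> ^ p\<close>, a
  source of contraction independent of the equation's own constants.\<close>

definition geo :: "real \<Rightarrow> nat \<Rightarrow> (nat \<Rightarrow> real \<Rightarrow> 'b::real_normed_vector) \<Rightarrow> bool" where
  "geo d p u \<longleftrightarrow> (\<forall>\<delta>. \<delta> < d \<longrightarrow>
     (\<exists>K r. 0 \<le> K \<and> 0 \<le> r \<and> r < 1 \<and> (\<forall>n t. \<bar>t\<bar> \<le> \<delta> \<longrightarrow> norm (u n t) \<le> K * r ^ n * \<bar>t\<bar> ^ p)))"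

lemma geoE:
  assumes "geo d p u" "\<delta> < d"
  obtains K r where "0 \<le> K" "0 \<le> r" "r < 1" "\<And>n t. \<bar>t\<bar> \<le> \<delta> \<Longrightarrow> norm (u n t) \<le> K * r ^ n * \<bar>t\<bar> ^ p"
  using assms unfolding geo_def by metis

lemma geo_zero: "geo d p (\<lambda>n t. 0)"
  unfolding geo_def by (auto intro!: exI[of _ 0])

lemma geo_weaken:
  assumes "geo d p u" "q \<le> p"
  shows "geo d q u"
  unfolding geo_def
proof (intro allI impI)
  fix \<delta> assume "\<delta> < d"
  then obtain K r where K: "0 \<le> K" "0 \<le> r" "r < 1" "\<And>n t. \<bar>t\<bar> \<le> \<delta> \<Longrightarrow> norm (u n t) \<le> K * r ^ n * \<bar>t\<bar> ^ p"
    using geoE[OF assms(1)] by metis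
  have "norm (u n t) \<le> K * \<bar>\<delta>\<bar> ^ (p - q) * r ^ n * \<bar>t\<bar> ^ q" if t: "\<bar>t\<bar> \<le> \<delta>" for n t
  proof -
    have "\<bar>t\<bar> ^ p = \<bar>t\<bar> ^ (p - q) * \<bar>t\<bar> ^ q" using assms(2) by (simp add: power_add[symmetric])
    also have "\<dots> \<le> \<bar>\<delta>\<bar> ^ (p - q) * \<bar>t\<bar> ^ q" using t by (intro mult_right_mono power_mono) auto
    finally have "K * r ^ n * \<bar>t\<bar> ^ p \<le> K * r ^ n * (\<bar>\<delta>\<bar> ^ (p - q) * \<bar>t\<bar> ^ q)"
      using K by (intro mult_left_mono) auto
    with K(4)[OF t, of n] show ?thesis by (simp add: mult_ac)
  qed
  then show "\<exists>K r. 0 \<le> K \<and> 0 \<le> r \<and> r < 1 \<and> (\<forall>n t. \<bar>t\<bar> \<le> \<delta> \<longrightarrow> norm (u n t) \<le> K * r ^ n * \<bar>t\<bar> ^ q)"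
    using K(1-3) by (intro exI[of _ "K * \<bar>\<delta>\<bar> ^ (p - q)"] exI[of _ r]) auto
qed

lemma geo_cmult:
  assumes "geo d p u" "\<And>\<delta>. \<delta> < d \<Longrightarrow> \<exists>C. \<forall>n t. \<bar>t\<bar> \<le> \<delta> \<longrightarrow> norm (v n t) \<le> C * norm (u n (t / s))" "1 \<le> \<bar>s\<bar>"
  shows "geo d p v"
  unfolding geo_def
proof (intro allI impI)
  fix \<delta> assume d: "\<delta> < d"
  then obtain K r where K: "0 \<le> K" "0 \<le> r" "r < 1" "\<And>n t. \<bar>t\<bar> \<le> \<delta> \<Longrightarrow> norm (u n t) \<le> K * r ^ n * \<bar>t\<bar> ^ p"
    using geoE[OF assms(1)] by metis
  obtain C where C: "\<And>n t. \<bar>t\<bar> \<le> \<delta> \<Longrightarrow> norm (v n t) \<le> C * norm (u n (t / s))"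
    using assms(2)[OF d] by blast
  have "norm (v n t) \<le> \<bar>C\<bar> * K * r ^ n * \<bar>t\<bar> ^ p" if t: "\<bar>t\<bar> \<le> \<delta>" for n t
  proof -
    have le: "\<bar>t / s\<bar> \<le> \<bar>t\<bar>" by (rule abs_divide_le_abs[OF assms(3)])
    have "norm (v n t) \<le> C * norm (u n (t / s))" using C[OF t] .
    also have "\<dots> \<le> \<bar>C\<bar> * (K * r ^ n * \<bar>t / s\<bar> ^ p)"
      using K(4)[of "t / s" n] le t by (intro mult_mono) auto
    also have "\<dots> \<le> \<bar>C\<bar> * (K * r ^ n * \<bar>t\<bar> ^ p)"
      using K le by (intro mult_left_mono power_mono) auto
    finally show ?thesis by (simp add: mult_ac)
  qed
  then show "\<exists>K r. 0 \<le> K \<and> 0 \<le> r \<and> r < 1 \<and> (\<forall>n t. \<bar>t\<bar> \<le> \<delta> \<longrightarrow> norm (v n t) \<le> K * r ^ n * \<bar>t\<bar> ^ p)"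
    using K(1-3) by (intro exI[of _ "\<bar>C\<bar> * K"] exI[of _ r]) auto
qed

text \<open>At \<open>t / s\<close> the weight is smaller by the factor
  \<open>\<bar>s\<bar> ^ p\<close>, so the recursion contracts with rate
  \<open>\<theta> / \<bar>s\<bar> ^ p\<close>, even when \<open>\<theta>\<close> exceeds 1.\<close>

lemma geo_rec:
  fixes u :: "nat \<Rightarrow> real \<Rightarrow> 'b::real_normed_vector" and e :: "nat \<Rightarrow> real \<Rightarrow> 'c::real_normed_vector"
  assumes s: "1 \<le> \<bar>s\<bar>" and th: "0 \<le> \<theta>" "\<theta> < \<bar>s\<bar> ^ p"
    and rec: "\<And>n t. \<bar>t\<bar> < d \<Longrightarrow> norm (u (Suc n) t) \<le> \<theta> * norm (u n (t / s)) + norm (e n t)"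
    and e: "geo d p e"
    and u0: "\<And>\<delta>. \<delta> < d \<Longrightarrow> \<exists>K. \<forall>t. \<bar>t\<bar> \<le> \<delta> \<longrightarrow> norm (u 0 t) \<le> K * \<bar>t\<bar> ^ p"
  shows "geo d p u"
  unfolding geo_def
proof (intro allI impI)
  fix \<delta> assume d: "\<delta> < d"
  obtain Ke re where E: "0 \<le> Ke" "0 \<le> re" "re < 1" "\<And>n t. \<bar>t\<bar> \<le> \<delta> \<Longrightarrow> norm (e n t) \<le> Ke * re ^ n * \<bar>t\<bar> ^ p"
    using geoE[OF e d] by metis
  obtain K0 where K0: "\<And>t. \<bar>t\<bar> \<le> \<delta> \<Longrightarrow> norm (u 0 t) \<le> K0 * \<bar>t\<bar> ^ p"
    using u0[OF d] by blast
  define q where "q = \<theta> / \<bar>s\<bar> ^ p"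
  have q: "0 \<le> q" "q < 1" using th s by (auto simp: q_def divide_less_eq)
  \<comment> \<open>Strictly between the contraction rate \<open>q\<close> and 1, and no smaller
    than the rate of the error. The gap \<open>r - q\<close> lets \<open>K\<close> absorb the error:
    \<open>q * K + Ke \<le> r * K\<close>.\<close>
  define r where "r = (max q re + 1) / 2"
  have r: "0 \<le> r" "r < 1" "re \<le> r" "q < r" using q E by (auto simp: r_def max_def field_simps)
  define K where "K = max (max K0 0) (Ke / (r - q))"
  have K: "0 \<le> K" "K0 \<le> K" "Ke / (r - q) \<le> K" by (auto simp: K_def)
  then have KK: "q * K + Ke \<le> r * K" using r by (simp add: divide_le_eq algebra_simps)
  have "norm (u n t) \<le> K * r ^ n * \<bar>t\<bar> ^ p" if "\<bar>t\<bar> \<le> \<delta>" for n t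
    using that
  proof (induction n arbitrary: t)
    case 0
    then show ?case using K0[OF 0] mult_right_mono[OF K(2), of "\<bar>t\<bar> ^ p"] by simp
  next
    case (Suc n)
    have le: "\<bar>t / s\<bar> \<le> \<bar>t\<bar>" by (rule abs_divide_le_abs[OF s])
    have "norm (u (Suc n) t) \<le> \<theta> * norm (u n (t / s)) + norm (e n t)"
      using rec Suc.prems d by simp
    also have "\<dots> \<le> \<theta> * (K * r ^ n * \<bar>t / s\<bar> ^ p) + Ke * re ^ n * \<bar>t\<bar> ^ p"
      using Suc.IH[of "t / s"] le Suc.prems th E(4)[OF Suc.prems] by (intro add_mono mult_left_mono) auto
    also have "\<theta> * (K * r ^ n * \<bar>t / s\<bar> ^ p) = q * K * (r ^ n * \<bar>t\<bar> ^ p)"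
      by (simp add: q_def abs_divide power_divide)
    also have "Ke * re ^ n * \<bar>t\<bar> ^ p \<le> Ke * r ^ n * \<bar>t\<bar> ^ p"
      using E r by (intro mult_right_mono mult_left_mono power_mono) auto
    also have "q * K * (r ^ n * \<bar>t\<bar> ^ p) + Ke * r ^ n * \<bar>t\<bar> ^ p = (q * K + Ke) * (r ^ n * \<bar>t\<bar> ^ p)"
      by (simp add: algebra_simps)
    also have "\<dots> \<le> r * K * (r ^ n * \<bar>t\<bar> ^ p)"
      using KK r by (intro mult_right_mono) auto
    finally show ?case by (simp add: mult_ac)
  qed
  then show "\<exists>K r. 0 \<le> K \<and> 0 \<le> r \<and> r < 1 \<and> (\<forall>n t. \<bar>t\<bar> \<le> \<delta> \<longrightarrow> norm (u n t) \<le> K * r ^ n * \<bar>t\<bar> ^ p)"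
    using K(1) r by blast
qed

lemma geo_lim:
  fixes f :: "nat \<Rightarrow> real \<Rightarrow> 'b::banach"
  assumes "geo d p (\<lambda>n t. f (Suc n) t - f n t)"
  shows "geo d p (\<lambda>n t. f n t - lim (\<lambda>n. f n t))"
    and "\<bar>t\<bar> < d \<Longrightarrow> (\<lambda>n. f n t) \<longlonglongrightarrow> lim (\<lambda>n. f n t)"
proof -
  show "geo d p (\<lambda>n t. f n t - lim (\<lambda>n. f n t))"
    unfolding geo_def
  proof (intro allI impI)
    fix \<delta> assume d: "\<delta> < d"
    obtain K r where K: "0 \<le> K" "0 \<le> r" "r < 1"
      "\<And>n t. \<bar>t\<bar> \<le> \<delta> \<Longrightarrow> norm (f (Suc n) t - f n t) \<le> K * r ^ n * \<bar>t\<bar> ^ p"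
      using geoE[OF assms d] by metis
    have "norm (f n t - lim (\<lambda>n. f n t)) \<le> K / (1 - r) * r ^ n * \<bar>t\<bar> ^ p" if "\<bar>t\<bar> \<le> \<delta>" for n t
      using geometric_limit(2)[of r "\<lambda>n. f n t" "K * \<bar>t\<bar> ^ p" n] K(2,3) K(4)[OF that] by (simp add: mult_ac)
    then show "\<exists>K r. 0 \<le> K \<and> 0 \<le> r \<and> r < 1 \<and> (\<forall>n t. \<bar>t\<bar> \<le> \<delta> \<longrightarrow> norm (f n t - lim (\<lambda>n. f n t)) \<le> K * r ^ n * \<bar>t\<bar> ^ p)"
      using K(1-3) by (intro exI[of _ "K / (1 - r)"] exI[of _ r]) auto
  qed
  assume t: "\<bar>t\<bar> < d"
  obtain K r where K: "0 \<le> K" "0 \<le> r" "r < 1"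
      "\<And>n x. \<bar>x\<bar> \<le> \<bar>t\<bar> \<Longrightarrow> norm (f (Suc n) x - f n x) \<le> K * r ^ n * \<bar>x\<bar> ^ p"
    using geoE[OF assms t] by metis
  have "convergent (\<lambda>n. f n t)"
    using geometric_limit(1)[of r "\<lambda>n. f n t" "K * \<bar>t\<bar> ^ p"] K(2,3) K(4)[of t] by (simp add: mult_ac)
  then show "(\<lambda>n. f n t) \<longlonglongrightarrow> lim (\<lambda>n. f n t)" by (simp add: convergent_LIMSEQ_iff)
qed

lemma geo_LIMSEQ:
  fixes f :: "nat \<Rightarrow> real \<Rightarrow> 'b::real_normed_vector"
  assumes "geo d p (\<lambda>n t. f n t - g t)" "\<bar>t\<bar> < d"
  shows "(\<lambda>n. f n t) \<longlonglongrightarrow> g t"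
proof -
  obtain K r where K: "0 \<le> K" "0 \<le> r" "r < 1" "\<And>n x. \<bar>x\<bar> \<le> \<bar>t\<bar> \<Longrightarrow> norm (f n x - g x) \<le> K * r ^ n * \<bar>x\<bar> ^ p"
    using geoE[OF assms] by metis
  have "(\<lambda>n. K * r ^ n * \<bar>t\<bar> ^ p) \<longlonglongrightarrow> K * 0 * \<bar>t\<bar> ^ p"
    using K(2,3) by (intro tendsto_intros LIMSEQ_power_zero) auto
  then have "(\<lambda>n. f n t - g t) \<longlonglongrightarrow> 0"
    using K(4)[of t] by (intro Lim_null_comparison[of "\<lambda>n. f n t - g t"]) (auto simp: always_eventually)
  then show ?thesis by (simp add: LIM_zero_iff)
qed

lemma geo_uniform:
  fixes f :: "nat \<Rightarrow> real \<Rightarrow> 'b::real_normed_vector"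
  assumes "geo d 0 (\<lambda>n t. f n t - g t)" "\<delta> < d" "0 < e"
  shows "\<forall>\<^sub>F n in sequentially. \<forall>t. \<bar>t\<bar> \<le> \<delta> \<longrightarrow> norm (f n t - g t) \<le> e"
proof -
  obtain K r where K: "0 \<le> K" "0 \<le> r" "r < 1" "\<And>n x. \<bar>x\<bar> \<le> \<delta> \<Longrightarrow> norm (f n x - g x) \<le> K * r ^ n"
    using geoE[OF assms(1,2)] by (metis mult.right_neutral power_0)
  have "(\<lambda>n. K * r ^ n) \<longlonglongrightarrow> K * 0"
    using K(2,3) by (intro tendsto_intros LIMSEQ_power_zero) auto
  then have "\<forall>\<^sub>F n in sequentially. K * r ^ n < e" using assms(3) by (simp add: order_tendstoD)
  then show ?thesis
    by eventually_elim (use K(4) order_trans less_imp_le in blast)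
qed

lemma geo_continuous:
  fixes f :: "nat \<Rightarrow> real \<Rightarrow> 'b::real_normed_vector"
  assumes "geo d 0 (\<lambda>n t. f n t - g t)" "\<And>n. continuous_on {-d<..<d} (f n)"
  shows "continuous_on {-d<..<d} g"
proof -
  have "isCont g t" if t: "t \<in> {-d<..<d}" for t
  proof -
    obtain \<delta> where \<delta>: "\<bar>t\<bar> < \<delta>" "\<delta> < d" using t dense[of "\<bar>t\<bar>" d] by (auto simp: abs_less_iff)
    have "uniform_limit {-\<delta><..<\<delta>} f g sequentially"
      unfolding uniform_limit_iff
    proof (intro allI impI)
      fix e :: real assume "0 < e"
      from geo_uniform[OF assms(1) \<delta>(2), of "e/2"] \<open>0 < e\<close>
      have "\<forall>\<^sub>F n in sequentially. \<forall>t. \<bar>t\<bar> \<le> \<delta> \<longrightarrow> norm (f n t - g t) \<le> e/2" by simp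
      then show "\<forall>\<^sub>F n in sequentially. \<forall>x\<in>{-\<delta><..<\<delta>}. dist (f n x) (g x) < e"
      proof eventually_elim
        case (elim n)
        show ?case
        proof
          fix x assume "x \<in> {-\<delta><..<\<delta>}"
          then have "norm (f n x - g x) \<le> e / 2" using elim by auto
          then show "dist (f n x) (g x) < e" using \<open>0 < e\<close> by (simp add: dist_norm)
        qed
      qed
    qed
    moreover have "continuous_on {-\<delta><..<\<delta>} (f n)" for n
      by (rule continuous_on_subset[OF assms(2)]) (use \<delta> in auto)
    ultimately have "continuous_on {-\<delta><..<\<delta>} g"
      by (intro uniform_limit_theorem[of _ f]) (auto intro: always_eventually)
    then show ?thesis using \<delta>(1) by (auto simp: continuous_on_eq_continuous_at abs_less_iff)
  qed
  then show ?thesis by (simp add: continuous_at_imp_continuous_on)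
qed

lemma geo_derivative:
  fixes f :: "nat \<Rightarrow> real \<Rightarrow> 'b::banach"
  assumes "geo d 0 (\<lambda>n t. f n t - g t)" "geo d 0 (\<lambda>n t. f' n t - g' t)"
    "\<And>n t. \<bar>t\<bar> < d \<Longrightarrow> (f n has_vector_derivative f' n t) (at t)" "\<bar>t\<bar> < d"
  shows "(g has_vector_derivative g' t) (at t)"
proof -
  obtain \<delta> where \<delta>: "\<bar>t\<bar> < \<delta>" "\<delta> < d" using assms(4) dense[of "\<bar>t\<bar>" d] by auto
  let ?S = "{-\<delta><..<\<delta>}"
  have "\<exists>h. \<forall>x\<in>?S. (\<lambda>n. f n x) \<longlonglongrightarrow> h x \<and> (h has_derivative (\<lambda>y. y *\<^sub>R g' x)) (at x within ?S)"
  proof (rule has_derivative_sequence[where f'="\<lambda>n x y. y *\<^sub>R f' n x" and l="g t" and ?x0.0=t])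
    show "(f n has_derivative (\<lambda>y. y *\<^sub>R f' n x)) (at x within ?S)" if "x \<in> ?S" for n x
      using assms(3)[of x n] that \<delta> by (auto simp: has_vector_derivative_def intro: has_derivative_at_withinI)
    show "\<forall>\<^sub>F n in sequentially. \<forall>x\<in>?S. \<forall>h. norm (h *\<^sub>R f' n x - h *\<^sub>R g' x) \<le> e * norm h" if "0 < e" for e
      using geo_uniform[OF assms(2) \<delta>(2) that]
    proof eventually_elim
      case (elim n)
      show ?case
      proof (intro ballI allI)
        fix x h :: real assume x: "x \<in> ?S"
        have "norm (h *\<^sub>R f' n x - h *\<^sub>R g' x) = \<bar>h\<bar> * norm (f' n x - g' x)"
          by (simp add: scaleR_diff_right[symmetric])
        also have "\<dots> \<le> \<bar>h\<bar> * e" using elim x by (intro mult_left_mono) auto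
        finally show "norm (h *\<^sub>R f' n x - h *\<^sub>R g' x) \<le> e * norm h" by (simp add: mult.commute)
      qed
    qed
    show "(\<lambda>n. f n t) \<longlonglongrightarrow> g t" by (rule geo_LIMSEQ[OF assms(1,4)])
  qed (use \<delta> in auto)
  then obtain h where h: "\<And>x. x \<in> ?S \<Longrightarrow> (\<lambda>n. f n x) \<longlonglongrightarrow> h x"
    "\<And>x. x \<in> ?S \<Longrightarrow> (h has_derivative (\<lambda>y. y *\<^sub>R g' x)) (at x within ?S)" by blast
  have eq: "h x = g x" if "x \<in> ?S" for x
    using h(1)[OF that] geo_LIMSEQ[OF assms(1), of x] that \<delta> by (intro LIMSEQ_unique[of "\<lambda>n. f n x"]) auto
  have tS: "t \<in> ?S" using \<delta> by auto
  have "(h has_derivative (\<lambda>y. y *\<^sub>R g' t)) (at t)"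
    using h(2)[OF tS] at_within_open[OF tS open_greaterThanLessThan] by simp
  from has_derivative_transform_within_open[OF this open_greaterThanLessThan tS eq]
  show ?thesis by (simp add: has_vector_derivative_def)
qed

lemma vanishing_linear_bound:
  fixes f :: "real \<Rightarrow> 'b::real_normed_vector"
  assumes "Ck_on 1 f {-d<..<d}" "f 0 = 0" "\<delta> < d"
  shows "\<exists>K. \<forall>t. \<bar>t\<bar> \<le> \<delta> \<longrightarrow> norm (f t) \<le> K * \<bar>t\<bar>"
proof (cases "0 \<le> \<delta>")
  case True
  obtain f' where f': "\<And>t. t \<in> {-d<..<d} \<Longrightarrow> (f has_vector_derivative f' t) (at t)" "Ck_on 0 f' {-d<..<d}"
    using Ck_vector_derivative_ex[OF open_greaterThanLessThan assms(1)[unfolded One_nat_def]] by blast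
  have "continuous_on {-\<delta>..\<delta>} f'"
    by (rule continuous_on_subset[of "{-d<..<d}"]) (use f'(2) assms(3) in auto)
  then have "bounded (f' ` {-\<delta>..\<delta>})"
    by (intro compact_imp_bounded compact_continuous_image) auto
  then obtain K where K: "\<And>t. t \<in> {-\<delta>..\<delta>} \<Longrightarrow> norm (f' t) \<le> K" unfolding bounded_iff by blast
  have "norm (f t - f 0) \<le> K * norm (t - 0)" if "\<bar>t\<bar> \<le> \<delta>" for t
  proof (rule differentiable_bound[where S="{-\<delta>..\<delta>}" and f'="\<lambda>x h. h *\<^sub>R f' x"])
    show "(f has_derivative (\<lambda>h. h *\<^sub>R f' x)) (at x within {-\<delta>..\<delta>})" if "x \<in> {-\<delta>..\<delta>}" for x
      using f'(1)[of x] that assms(3) by (auto simp: has_vector_derivative_def intro: has_derivative_at_withinI)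
    show "onorm (\<lambda>h. h *\<^sub>R f' x) \<le> K" if "x \<in> {-\<delta>..\<delta>}" for x
    proof (rule onorm_le)
      fix h :: real
      show "norm (h *\<^sub>R f' x) \<le> K * norm h"
        using mult_left_mono[OF K[OF that], of "\<bar>h\<bar>"] by (simp add: mult.commute)
    qed
  qed (use that True in auto)
  then show ?thesis using assms(2) by (intro exI[of _ K]) auto
qed auto

section \<open>Families of linear maps along an interval\<close>

lemma linear_family_bound:
  fixes B :: "real \<Rightarrow> 'b::euclidean_space \<Rightarrow> 'c::real_normed_vector"
  assumes "\<And>t. \<bar>t\<bar> < d \<Longrightarrow> linear (B t)" "\<And>w. continuous_on {-d<..<d} (\<lambda>t. B t w)" "\<delta> < d"
  shows "\<exists>C\<ge>0. \<forall>t x. \<bar>t\<bar> \<le> \<delta> \<longrightarrow> norm (B t x) \<le> C * norm x"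
proof -
  have "\<exists>C\<ge>0. \<forall>t. \<bar>t\<bar> \<le> \<delta> \<longrightarrow> norm (B t b) \<le> C" for b
  proof -
    have "continuous_on {-\<delta>..\<delta>} (\<lambda>t. B t b)"
      by (rule continuous_on_subset[OF assms(2)]) (use assms(3) in auto)
    then have "bounded ((\<lambda>t. B t b) ` {-\<delta>..\<delta>})"
      by (intro compact_imp_bounded compact_continuous_image) auto
    then obtain C where "\<And>t. t \<in> {-\<delta>..\<delta>} \<Longrightarrow> norm (B t b) \<le> C" unfolding bounded_iff by blast
    then show ?thesis by (intro exI[of _ "max 0 C"]) (auto simp: max.coboundedI2 abs_le_iff)
  qed
  then obtain C where C: "\<And>b. 0 \<le> C b" "\<And>b t. \<bar>t\<bar> \<le> \<delta> \<Longrightarrow> norm (B t b) \<le> C b" by metis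
  show ?thesis
  proof (intro exI[of _ "\<Sum>b\<in>Basis. C b"] conjI allI impI)
    fix t x assume t: "\<bar>t\<bar> \<le> \<delta>"
    have "norm (B t x) = norm (\<Sum>b\<in>Basis. (x \<bullet> b) *\<^sub>R B t b)"
      using linear_euclidean_expand[OF assms(1), of t x] t assms(3) by simp
    also have "\<dots> \<le> (\<Sum>b\<in>Basis. norm ((x \<bullet> b) *\<^sub>R B t b))" by (rule norm_sum)
    also have "\<dots> \<le> (\<Sum>b\<in>Basis. norm x * C b)"
      using C t Basis_le_norm by (intro sum_mono) (auto intro!: mult_mono)
    finally show "norm (B t x) \<le> (\<Sum>b\<in>Basis. C b) * norm x"
      by (simp add: sum_distrib_left mult.commute)
  qed (use C in \<open>auto intro: sum_nonneg\<close>)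
qed


text \<open>The derivative is chosen separately for every \<open>w\<close>; uniqueness of
  derivatives forces these choices to depend linearly on \<open>w\<close>.\<close>

lemma linear_family_derivative:
  fixes B :: "real \<Rightarrow> 'b::real_normed_vector \<Rightarrow> 'c::real_normed_vector"
  assumes "open I" "\<And>t. t \<in> I \<Longrightarrow> linear (B t)" "\<And>w. Ck_on (Suc m) (\<lambda>t. B t w) I"
  obtains B' where "\<And>t. t \<in> I \<Longrightarrow> linear (B' t)"
    "\<And>t w. t \<in> I \<Longrightarrow> ((\<lambda>t. B t w) has_vector_derivative B' t w) (at t)"
    "\<And>w. Ck_on m (\<lambda>t. B' t w) I"
proof -
  define P where "P w g \<longleftrightarrow> (\<forall>t\<in>I. ((\<lambda>t. B t w) has_vector_derivative g t) (at t)) \<and> Ck_on m g I" for w g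
  have "\<forall>w. \<exists>g. P w g"
    unfolding P_def using Ck_vector_derivative_ex[OF assms(1,3)] by blast
  then obtain g where g: "\<And>w. P w (g w)" by metis
  have d: "((\<lambda>t. B t w) has_vector_derivative g w t) (at t)" if "t \<in> I" for t w
    using g that unfolding P_def by blast
  have "linear (\<lambda>w. g w t)" if t: "t \<in> I" for t
  proof (rule linearI)
    fix x y :: 'b and r :: real
    have "((\<lambda>t. B t (x + y)) has_vector_derivative g x t + g y t) (at t)"
      by (rule has_vector_derivative_transform_within_open[OF has_vector_derivative_add[OF d[OF t] d[OF t]] assms(1) t])
        (simp add: linear_add[OF assms(2)])
    from vector_derivative_unique_at[OF this d[OF t]] show "g (x + y) t = g x t + g y t" ..
    have "((\<lambda>t. B t (r *\<^sub>R x)) has_vector_derivative r *\<^sub>R g x t) (at t)"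
      by (rule has_vector_derivative_transform_within_open[OF
            bounded_linear.has_vector_derivative[OF bounded_linear_scaleR_right d[OF t]] assms(1) t])
        (simp add: linear_scale[OF assms(2)])
    from vector_derivative_unique_at[OF this d[OF t]] show "g (r *\<^sub>R x) t = r *\<^sub>R g x t" ..
  qed
  with g d that[of "\<lambda>t w. g w t"] show ?thesis unfolding P_def by blast
qed

lemma has_vector_derivative_family_apply:
  fixes B :: "real \<Rightarrow> 'b::euclidean_space \<Rightarrow> 'c::real_normed_vector"
  assumes "open I" "t \<in> I" "\<And>\<tau>. \<tau> \<in> I \<Longrightarrow> linear (B \<tau>)" "linear (B' t)"
    "\<And>w. ((\<lambda>t. B t w) has_vector_derivative B' t w) (at t)" "(v has_vector_derivative v') (at t)"
  shows "((\<lambda>\<tau>. B \<tau> (v \<tau>)) has_vector_derivative B' t (v t) + B t v') (at t)"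
proof -
  have "((\<lambda>\<tau>. \<Sum>b\<in>Basis. (v \<tau> \<bullet> b) *\<^sub>R B \<tau> b) has_vector_derivative
      (\<Sum>b\<in>Basis. (v t \<bullet> b) *\<^sub>R B' t b + (v' \<bullet> b) *\<^sub>R B t b)) (at t)"
    by (intro has_vector_derivative_sum has_vector_derivative_scaleR assms(5)
        bounded_linear.has_vector_derivative[OF bounded_linear_inner_left assms(6), unfolded has_real_derivative_iff_has_vector_derivative[symmetric]])
  then have "((\<lambda>\<tau>. \<Sum>b\<in>Basis. (v \<tau> \<bullet> b) *\<^sub>R B \<tau> b) has_vector_derivative B' t (v t) + B t v') (at t)"
    by (simp add: sum.distrib linear_euclidean_expand[OF assms(4), of "v t"]
        linear_euclidean_expand[OF assms(3)[OF assms(2)], of v'])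
  then show ?thesis
    by (rule has_vector_derivative_transform_within_open[OF _ assms(1,2)])
      (simp add: linear_euclidean_expand[OF assms(3), symmetric])
qed

lemma has_vector_derivative_rescale:
  fixes s :: real
  assumes "(v has_vector_derivative v') (at (t / s))"
  shows "((\<lambda>t. v (t / s)) has_vector_derivative (1 / s) *\<^sub>R v') (at t)"
proof -
  have "((\<lambda>t. t / s) has_vector_derivative 1 / s) (at t)"
    unfolding has_real_derivative_iff_has_vector_derivative[symmetric]
    using DERIV_cdivide[OF DERIV_ident, of s] by simp
  from vector_diff_chain_at[OF this assms] show ?thesis by (simp add: o_def)
qed

section \<open>Existence and smoothness of solutions of
  \<open>v t = B t (v (t / s)) + c t\<close>\<close>

locale dilation =
  fixes s d :: real
  assumes s: "1 < \<bar>s\<bar>"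
begin

abbreviation I where "I \<equiv> {-d<..<d}"

lemma s1: "1 \<le> \<bar>s\<bar>" and s0: "s \<noteq> 0" using s by auto

lemma I_iff: "t \<in> I \<longleftrightarrow> \<bar>t\<bar> < d" by (auto simp: abs_less_iff)

lemma div_I: "t \<in> I \<Longrightarrow> t / s \<in> I"
  using abs_divide_le_abs[OF s1, of t] unfolding I_iff by linarith

lemma Ck_rescale: "Ck_on k v I \<Longrightarrow> Ck_on k (\<lambda>t. v (t / s)) I"
  using Ck_compose[OF _ _ Ck_mult[OF _ Ck_ident Ck_const[where c="inverse s"]], of I I k v]
  by (simp only: divide_inverse[symmetric] div_I open_greaterThanLessThan)

text \<open>The derivatives of the iterates converge because differentiating the equation divides its
  linear part by \<open>s\<close>, so that it contracts even when the original equation does not.\<close>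
lemma derivative_solution:
  fixes B B' :: "real \<Rightarrow> 'b::euclidean_space \<Rightarrow> 'b"
  assumes lin: "\<And>t. t \<in> I \<Longrightarrow> linear (B t)" "\<And>t. t \<in> I \<Longrightarrow> linear (B' t)"
    and B: "\<And>t x. t \<in> I \<Longrightarrow> norm (B t x) \<le> \<theta> * norm x" "0 \<le> \<theta>" "\<theta> < \<bar>s\<bar>" "\<theta> < \<bar>s\<bar> ^ p"
    and B': "\<And>t w. t \<in> I \<Longrightarrow> ((\<lambda>t. B t w) has_vector_derivative B' t w) (at t)"
      "\<And>w. continuous_on I (\<lambda>t. B' t w)"
    and c': "\<And>t. t \<in> I \<Longrightarrow> (c has_vector_derivative c' t) (at t)"
    and v: "\<And>t. t \<in> I \<Longrightarrow> v t = B t (v (t / s)) + c t"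
      "\<And>\<delta>. \<delta> < d \<Longrightarrow> \<exists>K. \<forall>t. \<bar>t\<bar> \<le> \<delta> \<longrightarrow> norm (v t - x0) \<le> K * \<bar>t\<bar> ^ p"
    and \<omega>: "continuous_on I \<omega>"
      "\<And>t. t \<in> I \<Longrightarrow> \<omega> t = (1 / s) *\<^sub>R B t (\<omega> (t / s)) + (B' t (v (t / s)) + c' t)"
    and t: "t \<in> I"
  shows "(v has_vector_derivative \<omega> t) (at t)"
proof -
  define f where "f = rec_nat (\<lambda>t. x0) (\<lambda>_ g t. B t (g (t / s)) + c t)"
  have f: "f 0 = (\<lambda>t. x0)" "\<And>n. f (Suc n) = (\<lambda>t. B t (f n (t / s)) + c t)"
    by (simp_all add: f_def)
  define f' where "f' = rec_nat (\<lambda>t. 0) (\<lambda>n g t. B' t (f n (t / s)) + B t ((1 / s) *\<^sub>R g (t / s)) + c' t)"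
  have f': "f' 0 = (\<lambda>t. 0)" "\<And>n. f' (Suc n) = (\<lambda>t. B' t (f n (t / s)) + B t ((1 / s) *\<^sub>R f' n (t / s)) + c' t)"
    by (simp_all add: f'_def)
  have der: "(f n has_vector_derivative f' n t) (at t)" if "t \<in> I" for n t
    using that
  proof (induction n arbitrary: t)
    case (Suc n)
    show ?case unfolding f f'
      by (intro has_vector_derivative_add has_vector_derivative_family_apply[where I=I] lin B' c' Suc.prems
          has_vector_derivative_rescale Suc.IH div_I open_greaterThanLessThan)
  qed (simp add: f f')
  have gp: "geo d p (\<lambda>n t. f n t - v t)"
  proof (rule geo_rec[OF s1 B(2,4) _ geo_zero[where 'a='b]])
    fix n t assume "\<bar>t\<bar> < d"
    then have t: "t \<in> I" by (auto simp: abs_less_iff)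
    have "f (Suc n) t - v t = B t (f n (t / s) - v (t / s))"
      by (simp add: f v(1)[OF t] linear_diff[OF lin(1)[OF t]])
    then show "norm (f (Suc n) t - v t) \<le> \<theta> * norm (f n (t / s) - v (t / s)) + norm (0::'b)"
      using B(1)[OF t] by simp
  next
    fix \<delta> assume "\<delta> < d"
    then show "\<exists>K. \<forall>t. \<bar>t\<bar> \<le> \<delta> \<longrightarrow> norm (f 0 t - v t) \<le> K * \<bar>t\<bar> ^ p"
      using v(2)[of \<delta>] by (simp add: f norm_minus_commute)
  qed
  have g0: "geo d 0 (\<lambda>n t. f n t - v t)" by (rule geo_weaken[OF gp]) simp
  \<comment> \<open>The source term in the recursion for \<open>f' n - \<omega>\<close>: there
    \<open>B'\<close> acts on the error of the undifferentiated iterates, which is already known to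
    decay geometrically.\<close>
  have ge: "geo d 0 (\<lambda>n t. if t \<in> I then B' t (f n (t / s) - v (t / s)) else 0)"
  proof (rule geo_cmult[OF g0 _ s1])
    fix \<delta> assume \<delta>: "\<delta> < d"
    obtain C where C: "C \<ge> 0" "\<And>t x. \<bar>t\<bar> \<le> \<delta> \<Longrightarrow> norm (B' t x) \<le> C * norm x"
      using linear_family_bound[of d B', OF _ B'(2) \<delta>] lin(2) by (auto simp: abs_less_iff)
    then show "\<exists>C. \<forall>n t. \<bar>t\<bar> \<le> \<delta> \<longrightarrow>
        norm (if t \<in> I then B' t (f n (t / s) - v (t / s)) else 0) \<le> C * norm (f n (t / s) - v (t / s))"
      by (intro exI[of _ C]) auto
  qed
  have g': "geo d 0 (\<lambda>n t. f' n t - \<omega> t)"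
  proof (rule geo_rec[where \<theta>="\<theta> / \<bar>s\<bar>", OF s1 _ _ _ ge])
    show "0 \<le> \<theta> / \<bar>s\<bar>" "\<theta> / \<bar>s\<bar> < \<bar>s\<bar> ^ 0" using B s by (auto simp: divide_less_eq)
  next
    fix n t assume "\<bar>t\<bar> < d"
    then have t: "t \<in> I" by (auto simp: abs_less_iff)
    have "f' (Suc n) t - \<omega> t = (1 / s) *\<^sub>R B t (f' n (t / s) - \<omega> (t / s)) + B' t (f n (t / s) - v (t / s))"
      by (simp add: f' \<omega>(2)[OF t] linear_diff[OF lin(1)[OF t]] linear_diff[OF lin(2)[OF t]]
          linear_scale[OF lin(1)[OF t]] scaleR_diff_right)
    also have "norm \<dots> \<le> norm ((1 / s) *\<^sub>R B t (f' n (t / s) - \<omega> (t / s))) + norm (B' t (f n (t / s) - v (t / s)))"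
      by (rule norm_triangle_ineq)
    also have "norm ((1 / s) *\<^sub>R B t (f' n (t / s) - \<omega> (t / s))) \<le> \<theta> / \<bar>s\<bar> * norm (f' n (t / s) - \<omega> (t / s))"
      using mult_left_mono[OF B(1)[OF t, of "f' n (t / s) - \<omega> (t / s)"], of "1 / \<bar>s\<bar>"] by simp
    finally show "norm (f' (Suc n) t - \<omega> t) \<le> \<theta> / \<bar>s\<bar> * norm (f' n (t / s) - \<omega> (t / s)) +
        norm (if t \<in> I then B' t (f n (t / s) - v (t / s)) else 0)"
      using t by simp
  next
    fix \<delta> assume \<delta>: "\<delta> < d"
    have "continuous_on {-\<delta>..\<delta>} \<omega>"
      by (rule continuous_on_subset[OF \<omega>(1)]) (use \<delta> in auto)
    then have "bounded (\<omega> ` {-\<delta>..\<delta>})"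
      by (intro compact_imp_bounded compact_continuous_image) auto
    then obtain C where "\<And>t. t \<in> {-\<delta>..\<delta>} \<Longrightarrow> norm (\<omega> t) \<le> C" unfolding bounded_iff by blast
    then show "\<exists>K. \<forall>t. \<bar>t\<bar> \<le> \<delta> \<longrightarrow> norm (f' 0 t - \<omega> t) \<le> K * \<bar>t\<bar> ^ 0"
      by (intro exI[of _ C]) (auto simp: f' abs_le_iff)
  qed
  show ?thesis
    by (rule geo_derivative[OF g0 g' der]) (use t in \<open>auto simp: abs_less_iff\<close>)
qed

text \<open>Picard iteration starting from the constant \<open>x0\<close>. Because \<open>x0\<close>
  solves the equation up to order \<open>p\<close> at 0, the increments carry the weight
  \<open>\<bar>t\<bar> ^ p\<close>, and \<open>geo_rec\<close> tolerates every
  \<open>\<theta> < \<bar>s\<bar> ^ p\<close>.\<close>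

lemma iteration_solution:
  fixes B :: "real \<Rightarrow> 'b::euclidean_space \<Rightarrow> 'b"
  assumes lin: "\<And>t. t \<in> I \<Longrightarrow> linear (B t)"
    and B: "\<And>t x. t \<in> I \<Longrightarrow> norm (B t x) \<le> \<theta> * norm x" "0 \<le> \<theta>" "\<theta> < \<bar>s\<bar> ^ p"
      "\<And>w. continuous_on I (\<lambda>t. B t w)"
    and c: "continuous_on I c"
    and x0: "\<And>\<delta>. \<delta> < d \<Longrightarrow> \<exists>K. \<forall>t. \<bar>t\<bar> \<le> \<delta> \<longrightarrow> norm (B t x0 + c t - x0) \<le> K * \<bar>t\<bar> ^ p"
  obtains v where "continuous_on I v" "\<And>t. t \<in> I \<Longrightarrow> v t = B t (v (t / s)) + c t"
    "\<And>\<delta>. \<delta> < d \<Longrightarrow> \<exists>K. \<forall>t. \<bar>t\<bar> \<le> \<delta> \<longrightarrow> norm (v t - x0) \<le> K * \<bar>t\<bar> ^ p"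
proof -
  define f where "f = rec_nat (\<lambda>t. x0) (\<lambda>_ g t. B t (g (t / s)) + c t)"
  have f: "f 0 = (\<lambda>t. x0)" "\<And>n. f (Suc n) = (\<lambda>t. B t (f n (t / s)) + c t)"
    by (simp_all add: f_def)
  define v where "v t = lim (\<lambda>n. f n t)" for t
  have inc: "geo d p (\<lambda>n t. f (Suc n) t - f n t)"
  proof (rule geo_rec[OF s1 B(2,3) _ geo_zero[where 'a='b]])
    fix n t assume "\<bar>t\<bar> < d"
    then have t: "t \<in> I" by (auto simp: abs_less_iff)
    have "f (Suc (Suc n)) t - f (Suc n) t = B t (f (Suc n) (t / s) - f n (t / s))"
      by (simp only: f(2)[of "Suc n"] f(2)[of n] linear_diff[OF lin[OF t]]) (simp add: f)
    then show "norm (f (Suc (Suc n)) t - f (Suc n) t) \<le> \<theta> * norm (f (Suc n) (t / s) - f n (t / s)) + norm (0::'b)"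
      using B(1)[OF t] by simp
  qed (use x0 in \<open>simp add: f\<close>)
  have gp: "geo d p (\<lambda>n t. f n t - v t)" and lim: "\<And>t. \<bar>t\<bar> < d \<Longrightarrow> (\<lambda>n. f n t) \<longlonglongrightarrow> v t"
    unfolding v_def using geo_lim[OF inc] by auto
  have cont: "continuous_on I (f n)" for n
  proof (induction n)
    case (Suc n)
    have "Ck_on 0 (\<lambda>t. B t (f n (t / s)) + c t) I"
      by (rule Ck_add[OF open_greaterThanLessThan Ck_apply[OF open_greaterThanLessThan lin _ Ck_rescale]])
        (use B c Suc in auto)
    then show ?case by (simp add: f)
  qed (simp add: f)
  show thesis
  proof
    show "continuous_on I v"
      by (rule geo_continuous[OF geo_weaken[OF gp] cont]) simp
    show "v t = B t (v (t / s)) + c t" if t: "t \<in> I" for t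
    proof -
      have "(\<lambda>n. B t (f n (t / s)) + c t) \<longlonglongrightarrow> B t (v (t / s)) + c t"
        using lin[OF t] div_I[OF t] by (intro tendsto_intros bounded_linear.tendsto[OF _ lim])
          (auto simp: linear_conv_bounded_linear abs_less_iff)
      moreover have "(\<lambda>n. f (Suc n) t) \<longlonglongrightarrow> v t"
        using LIMSEQ_Suc[OF lim[of t]] t unfolding I_iff by blast
      ultimately show ?thesis unfolding f using LIMSEQ_unique by blast
    qed
    show "\<exists>K. \<forall>t. \<bar>t\<bar> \<le> \<delta> \<longrightarrow> norm (v t - x0) \<le> K * \<bar>t\<bar> ^ p" if \<delta>: "\<delta> < d" for \<delta>
    proof -
      obtain K r where "\<And>n t. \<bar>t\<bar> \<le> \<delta> \<Longrightarrow> norm (f n t - v t) \<le> K * r ^ n * \<bar>t\<bar> ^ p"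
        using geoE[OF gp \<delta>] by metis
      from this[of _ 0] show ?thesis by (intro exI[of _ K]) (simp add: f norm_minus_commute)
    qed
  qed
qed

text \<open>The derivative of \<open>v\<close> should solve the differentiated equation, whose
  linear part \<open>B / s\<close> contracts. By \<open>ex\<close> that equation has a
  \<open>C^m\<close> solution, and \<open>derivative_solution\<close> identifies it with the
  derivative of \<open>v\<close>. Existence enters as the assumption \<open>ex\<close> because
  \<open>contracting_solution\<close> uses this step inside its own induction.\<close>

lemma smooth_solution_step:
  fixes B :: "real \<Rightarrow> 'b::euclidean_space \<Rightarrow> 'b"
  assumes ex: "\<And>B \<theta> (c :: real \<Rightarrow> 'b). (\<And>t. t \<in> I \<Longrightarrow> linear (B t)) \<Longrightarrow> (\<And>t x. t \<in> I \<Longrightarrow> norm (B t x) \<le> \<theta> * norm x) \<Longrightarrow>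
      0 \<le> \<theta> \<Longrightarrow> \<theta> < 1 \<Longrightarrow> (\<And>w. Ck_on m (\<lambda>t. B t w) I) \<Longrightarrow> Ck_on m c I \<Longrightarrow>
      \<exists>v. Ck_on m v I \<and> (\<forall>t\<in>I. v t = B t (v (t / s)) + c t)"
    and lin: "\<And>t. t \<in> I \<Longrightarrow> linear (B t)"
    and B: "\<And>t x. t \<in> I \<Longrightarrow> norm (B t x) \<le> \<theta> * norm x" "0 \<le> \<theta>" "\<theta> < \<bar>s\<bar>" "\<theta> < \<bar>s\<bar> ^ p"
      "\<And>w. Ck_on (Suc m) (\<lambda>t. B t w) I"
    and c: "Ck_on (Suc m) c I"
    and v: "Ck_on m v I" "\<And>t. t \<in> I \<Longrightarrow> v t = B t (v (t / s)) + c t"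
      "\<And>\<delta>. \<delta> < d \<Longrightarrow> \<exists>K. \<forall>t. \<bar>t\<bar> \<le> \<delta> \<longrightarrow> norm (v t - x0) \<le> K * \<bar>t\<bar> ^ p"
  shows "Ck_on (Suc m) v I"
proof -
  have op: "open I" by simp
  obtain B' where B': "\<And>t. t \<in> I \<Longrightarrow> linear (B' t)"
    "\<And>t w. t \<in> I \<Longrightarrow> ((\<lambda>t. B t w) has_vector_derivative B' t w) (at t)"
    "\<And>w. Ck_on m (\<lambda>t. B' t w) I"
    using linear_family_derivative[of I B m, OF op lin B(5)] by blast
  obtain c' where c': "\<And>t. t \<in> I \<Longrightarrow> (c has_vector_derivative c' t) (at t)" "Ck_on m c' I"
    using Ck_vector_derivative_ex[OF op c] by blast
  have "\<exists>\<omega>. Ck_on m \<omega> I \<and> (\<forall>t\<in>I. \<omega> t = (1 / s) *\<^sub>R B t (\<omega> (t / s)) + (B' t (v (t / s)) + c' t))"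
  proof (rule ex[where \<theta>="\<theta> / \<bar>s\<bar>"])
    show "linear (\<lambda>x. (1 / s) *\<^sub>R B t x)" if "t \<in> I" for t
      using linear_compose[OF lin[OF that] linear_scaleR[of "1 / s"]] by (simp add: o_def)
    show "norm ((1 / s) *\<^sub>R B t x) \<le> \<theta> / \<bar>s\<bar> * norm x" if "t \<in> I" for t x
      using mult_left_mono[OF B(1)[OF that, of x], of "1 / \<bar>s\<bar>"] by simp
    show "0 \<le> \<theta> / \<bar>s\<bar>" "\<theta> / \<bar>s\<bar> < 1" using B s by auto
    show "Ck_on m (\<lambda>t. (1 / s) *\<^sub>R B t w) I" for w
      by (rule Ck_scaleR[OF op Ck_const[OF op] Ck_mono[OF op B(5)]]) simp
    show "Ck_on m (\<lambda>t. B' t (v (t / s)) + c' t) I"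
      by (rule Ck_add[OF op Ck_apply[OF op B'(1) B'(3) Ck_rescale[OF v(1)]] c'(2)])
  qed
  then obtain \<omega> where \<omega>: "Ck_on m \<omega> I" "\<And>t. t \<in> I \<Longrightarrow> \<omega> t = (1 / s) *\<^sub>R B t (\<omega> (t / s)) + (B' t (v (t / s)) + c' t)"
    by blast
  show ?thesis
  proof (rule Ck_vector_derivativeI[OF op _ \<omega>(1)])
    show "(v has_vector_derivative \<omega> t) (at t)" if "t \<in> I" for t
      by (rule derivative_solution[OF lin B'(1) B(1-4) B'(2) Ck_continuous[OF op B'(3)] c'(1) v(2,3)
            Ck_continuous[OF op \<omega>(1)] \<omega>(2) that])
  qed
qed

text \<open>For \<open>\<theta> < 1\<close> no weight is required, so \<open>p = 0\<close> and the
  iteration can start at 0. The induction generalizes over \<open>B\<close>, \<open>c\<close> and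
  \<open>\<theta>\<close>, since passing from \<open>m\<close> to \<open>Suc m\<close> solves the
  differentiated equation, which has other coefficients.\<close>

lemma contracting_solution:
  fixes B :: "real \<Rightarrow> 'b::euclidean_space \<Rightarrow> 'b"
  assumes "\<And>t. t \<in> I \<Longrightarrow> linear (B t)" "\<And>t x. t \<in> I \<Longrightarrow> norm (B t x) \<le> \<theta> * norm x"
    "0 \<le> \<theta>" "\<theta> < 1" "\<And>w. Ck_on m (\<lambda>t. B t w) I" "Ck_on m c I"
  shows "\<exists>v. Ck_on m v I \<and> (\<forall>t\<in>I. v t = B t (v (t / s)) + c t)"
  using assms
proof (induction m arbitrary: B c \<theta>)
  case 0
  have "continuous_on I c" "\<And>w. continuous_on I (\<lambda>t. B t w)" using 0 by auto
  moreover have "\<exists>K. \<forall>t. \<bar>t\<bar> \<le> \<delta> \<longrightarrow> norm (B t 0 + c t - 0) \<le> K * \<bar>t\<bar> ^ 0" if \<delta>: "\<delta> < d" for \<delta>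
  proof -
    have "continuous_on {-\<delta>..\<delta>} c"
      by (rule continuous_on_subset[OF \<open>continuous_on I c\<close>]) (use \<delta> in auto)
    then have "bounded (c ` {-\<delta>..\<delta>})"
      by (intro compact_imp_bounded compact_continuous_image) auto
    then obtain C where C: "\<And>t. t \<in> {-\<delta>..\<delta>} \<Longrightarrow> norm (c t) \<le> C" unfolding bounded_iff by blast
    have "norm (B t 0 + c t - 0) \<le> C * \<bar>t\<bar> ^ 0" if "\<bar>t\<bar> \<le> \<delta>" for t
    proof -
      have "t \<in> I" "t \<in> {-\<delta>..\<delta>}" using that \<delta> by auto
      then show ?thesis using C linear_0[OF 0(1)] by simp
    qed
    then show ?thesis by blast
  qed
  ultimately obtain v where "continuous_on I v" "\<And>t. t \<in> I \<Longrightarrow> v t = B t (v (t / s)) + c t"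
    using iteration_solution[where B=B and \<theta>=\<theta> and p=0 and c=c and ?x0.0=0] 0(1-4) by (metis power_0)
  then show ?case by auto
next
  case (Suc m)
  have op: "open I" by simp
  obtain v where v: "Ck_on m v I" "\<And>t. t \<in> I \<Longrightarrow> v t = B t (v (t / s)) + c t"
    using Suc.IH[OF Suc.prems(1-4) Ck_mono[OF op Suc.prems(5)] Ck_mono[OF op Suc.prems(6)]] by auto
  have bd: "\<exists>K. \<forall>t. \<bar>t\<bar> \<le> \<delta> \<longrightarrow> norm (v t - 0) \<le> K * \<bar>t\<bar> ^ 0" if \<delta>: "\<delta> < d" for \<delta>
  proof -
    have "continuous_on {-\<delta>..\<delta>} v"
      by (rule continuous_on_subset[OF Ck_continuous[OF op v(1)]]) (use \<delta> in auto)
    then have "bounded (v ` {-\<delta>..\<delta>})"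
      by (intro compact_imp_bounded compact_continuous_image) auto
    then obtain C where "\<And>t. t \<in> {-\<delta>..\<delta>} \<Longrightarrow> norm (v t) \<le> C" unfolding bounded_iff by blast
    then show ?thesis by (intro exI[of _ C]) (auto simp: abs_le_iff)
  qed
  have "Ck_on (Suc m) v I"
    by (rule smooth_solution_step[where p=0 and ?x0.0=0, OF Suc.IH Suc.prems(1-3) _ _ Suc.prems(5,6) v bd])
      (use Suc.prems(4) s in auto)
  with v show ?case by blast
qed

text \<open>For \<open>\<theta>\<close> between 1 and \<open>\<bar>s\<bar>\<close> continuous
  solutions need not be unique; the bound by \<open>\<bar>t\<bar>\<close> singles out the limit of
  the iterates that start at \<open>x0\<close>. After one differentiation the equation contracts,
  and \<open>contracting_solution\<close> applies.\<close>

lemma solution_smooth: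
  fixes B :: "real \<Rightarrow> 'b::euclidean_space \<Rightarrow> 'b"
  assumes lin: "\<And>t. t \<in> I \<Longrightarrow> linear (B t)"
    and B: "\<And>t x. t \<in> I \<Longrightarrow> norm (B t x) \<le> \<theta> * norm x" "0 \<le> \<theta>" "\<theta> < \<bar>s\<bar>"
    and v: "continuous_on I v" "\<And>t. t \<in> I \<Longrightarrow> v t = B t (v (t / s)) + c t"
      "\<And>\<delta>. \<delta> < d \<Longrightarrow> \<exists>K. \<forall>t. \<bar>t\<bar> \<le> \<delta> \<longrightarrow> norm (v t - x0) \<le> K * \<bar>t\<bar>"
  shows "(\<And>w. Ck_on m (\<lambda>t. B t w) I) \<Longrightarrow> Ck_on m c I \<Longrightarrow> Ck_on m v I"
proof (induction m)
  case (Suc m)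
  have op: "open I" by simp
  have v1: "\<exists>K. \<forall>t. \<bar>t\<bar> \<le> \<delta> \<longrightarrow> norm (v t - x0) \<le> K * \<bar>t\<bar> ^ 1" if "\<delta> < d" for \<delta>
    using v(3)[OF that] by simp
  have th: "\<theta> < \<bar>s\<bar> ^ 1" using B by simp
  have vm: "Ck_on m v I"
    by (rule Suc.IH[OF Ck_mono[OF op Suc.prems(1)] Ck_mono[OF op Suc.prems(2)]]) auto
  show ?case
    by (rule smooth_solution_step[OF contracting_solution lin B th Suc.prems vm v(2) v1])
qed (use v in simp)

end

declare Ck_on.simps(2) [simp del]

section \<open>The unstable manifold\<close>

lemma C1_Lipschitz_cball:
  fixes g :: "real \<times> real \<Rightarrow> 'b::real_normed_vector"
  assumes "open N" "Ck_on 1 g N" "cball 0 \<rho> \<subseteq> N"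
  shows "\<exists>C\<ge>0. \<forall>x\<in>cball 0 \<rho>. \<forall>y\<in>cball 0 \<rho>. norm (g x - g y) \<le> C * norm (x - y)"
proof -
  obtain g' where g': "\<And>x. x \<in> N \<Longrightarrow> (g has_derivative g' x) (at x)" "\<And>v. Ck_on 0 (\<lambda>x. g' x v) N"
    using Ck_Suc_ex[OF assms(1) assms(2)[unfolded One_nat_def]] by blast
  have "\<exists>C. \<forall>x\<in>cball 0 \<rho>. norm (g' x v) \<le> C" for v
  proof -
    have "continuous_on (cball 0 \<rho>) (\<lambda>x. g' x v)"
      by (rule continuous_on_subset[OF _ assms(3)]) (use g'(2) in simp)
    then have "bounded ((\<lambda>x. g' x v) ` cball 0 \<rho>)"
      by (intro compact_imp_bounded compact_continuous_image) auto
    then show ?thesis unfolding bounded_iff by blast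
  qed
  then obtain C where C: "\<And>v x. x \<in> cball 0 \<rho> \<Longrightarrow> norm (g' x v) \<le> C v" by metis
  have "norm (g x - g y) \<le> (\<bar>C (1,0)\<bar> + \<bar>C (0,1)\<bar>) * norm (x - y)" if "x \<in> cball 0 \<rho>" "y \<in> cball 0 \<rho>" for x y
  proof (rule differentiable_bound[OF convex_cball _ _ that])
    fix z assume z: "z \<in> cball (0::real \<times> real) \<rho>"
    show "(g has_derivative g' z) (at z within cball 0 \<rho>)"
      using g'(1) z assms(3) has_derivative_at_withinI by blast
    show "onorm (g' z) \<le> \<bar>C (1,0)\<bar> + \<bar>C (0,1)\<bar>"
    proof (rule onorm_le)
      fix h
      have "linear (g' z)" using g'(1) z assms(3) has_derivative_linear by blast
      then have "norm (g' z h) \<le> \<bar>fst h\<bar> * norm (g' z (1, 0)) + \<bar>snd h\<bar> * norm (g' z (0, 1))"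
        by (subst linear_prod_expand) (auto intro!: norm_triangle_le)
      also have "\<dots> \<le> norm h * \<bar>C (1,0)\<bar> + norm h * \<bar>C (0,1)\<bar>"
        using C[OF z, of "(1,0)"] C[OF z, of "(0,1)"] norm_fst_le[of "fst h" "snd h"] norm_snd_le[of "snd h" "fst h"]
        by (intro add_mono mult_mono) auto
      finally show "norm (g' z h) \<le> (\<bar>C (1,0)\<bar> + \<bar>C (0,1)\<bar>) * norm h" by (simp add: algebra_simps)
    qed
  qed
  then show ?thesis by (intro exI[of _ "\<bar>C (1,0)\<bar> + \<bar>C (0,1)\<bar>"]) auto
qed

text \<open>On a compact ball a \<open>C^2\<close> map has a Lipschitz derivative. Comparing with
  the derivative at 0, and then using the mean value inequality for \<open>f - A\<close>, gives the
  other two estimates with the same constant.\<close>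

lemma C2_expansion:
  fixes f :: "real \<times> real \<Rightarrow> real \<times> real"
  assumes "open N" "0 \<in> N" "Ck_on (Suc (Suc m)) f N" "f 0 = 0" "(f has_derivative A) (at 0)"
  shows "\<exists>f' \<rho> C. 0 < \<rho> \<and> cball 0 \<rho> \<subseteq> N \<and> 0 \<le> C \<and>
    (\<forall>x\<in>N. (f has_derivative f' x) (at x)) \<and> (\<forall>w. Ck_on (Suc m) (\<lambda>x. f' x w) N) \<and>
    (\<forall>x\<in>cball 0 \<rho>. \<forall>y\<in>cball 0 \<rho>. \<forall>w. norm (f' x w - f' y w) \<le> C * norm (x - y) * norm w) \<and>
    (\<forall>x\<in>cball 0 \<rho>. \<forall>w. norm (f' x w - A w) \<le> C * norm x * norm w) \<and>
    (\<forall>x\<in>cball 0 \<rho>. norm (f x - A x) \<le> C * norm x ^ 2)"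
proof -
  obtain f' where f': "\<And>x. x \<in> N \<Longrightarrow> (f has_derivative f' x) (at x)" "\<And>v. Ck_on (Suc m) (\<lambda>x. f' x v) N"
    using Ck_Suc_ex[OF assms(1,3)] by blast
  obtain \<rho> where \<rho>: "0 < \<rho>" "cball 0 \<rho> \<subseteq> N" using open_contains_cball assms(1,2) by metis
  have lin: "linear (f' x)" if "x \<in> N" for x using f'(1)[OF that] has_derivative_linear by blast
  have f'0: "f' 0 = A" using has_derivative_unique[OF f'(1)[OF assms(2)] assms(5)] .
  have "\<exists>C\<ge>0. \<forall>x\<in>cball 0 \<rho>. \<forall>y\<in>cball 0 \<rho>. norm (f' x v - f' y v) \<le> C * norm (x - y)" for v
    by (rule C1_Lipschitz_cball[OF assms(1) _ \<rho>(2)]) (rule Ck_mono[OF assms(1) f'(2)], simp)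
  then obtain L where L: "\<And>v. 0 \<le> L v"
    "\<And>v x y. x \<in> cball 0 \<rho> \<Longrightarrow> y \<in> cball 0 \<rho> \<Longrightarrow> norm (f' x v - f' y v) \<le> L v * norm (x - y)" by metis
  define C where "C = L (1,0) + L (0,1)"
  have C0: "0 \<le> C" using L(1) by (simp add: C_def)
  have lip: "norm (f' x w - f' y w) \<le> C * norm (x - y) * norm w" if x: "x \<in> cball 0 \<rho>" and y: "y \<in> cball 0 \<rho>" for x y w
  proof -
    have "x \<in> N" "y \<in> N" using x y \<rho>(2) by blast+
    then have "f' x w - f' y w = fst w *\<^sub>R (f' x (1,0) - f' y (1,0)) + snd w *\<^sub>R (f' x (0,1) - f' y (0,1))"
      using linear_prod_expand[OF lin, of x w] linear_prod_expand[OF lin, of y w]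
      by (simp add: algebra_simps)
    also have "norm \<dots> \<le> \<bar>fst w\<bar> * norm (f' x (1,0) - f' y (1,0)) + \<bar>snd w\<bar> * norm (f' x (0,1) - f' y (0,1))"
      by (auto intro!: norm_triangle_le)
    also have "\<dots> \<le> norm w * (L (1,0) * norm (x - y)) + norm w * (L (0,1) * norm (x - y))"
      using L(2)[OF x y] norm_fst_le[of "fst w" "snd w"] norm_snd_le[of "snd w" "fst w"]
      by (intro add_mono mult_mono) auto
    finally show ?thesis by (simp add: C_def algebra_simps)
  qed
  have lip0: "norm (f' x w - A w) \<le> C * norm x * norm w" if x: "x \<in> cball 0 \<rho>" for x w
    using lip[OF x, of 0 w] \<rho>(1) by (simp add: f'0)
  have "norm (f x - A x) \<le> C * norm x ^ 2" if x: "x \<in> cball 0 \<rho>" for x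
  proof -
    have bl: "bounded_linear A" using assms(5) by (rule has_derivative_bounded_linear)
    have sub: "cball 0 (norm x) \<subseteq> cball (0::real \<times> real) \<rho>" using x by auto
    have "norm ((f x - A x) - (f 0 - A 0)) \<le> C * norm x * norm (x - 0)"
    proof (rule differentiable_bound[where S="cball 0 (norm x)" and f'="\<lambda>z h. f' z h - A h"])
      fix z assume z: "z \<in> cball (0::real \<times> real) (norm x)"
      then have zr: "z \<in> cball 0 \<rho>" using sub by blast
      show "((\<lambda>z. f z - A z) has_derivative (\<lambda>h. f' z h - A h)) (at z within cball 0 (norm x))"
        using zr \<rho>(2) by (intro has_derivative_diff bounded_linear_imp_has_derivative[OF bl]
            has_derivative_at_withinI[OF f'(1)]) blast
      show "onorm (\<lambda>h. f' z h - A h) \<le> C * norm x"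
      proof (rule onorm_le)
        fix h
        have "norm (f' z h - A h) \<le> C * norm z * norm h" by (rule lip0[OF zr])
        also have "\<dots> \<le> C * norm x * norm h" using z C0 by (intro mult_right_mono mult_left_mono) auto
        finally show "norm (f' z h - A h) \<le> C * norm x * norm h" .
      qed
    qed auto
    then show ?thesis using assms(4) linear_0[OF bounded_linear.linear[OF bl]] by (simp add: power2_eq_square)
  qed
  with \<rho> C0 f' lip lip0 show ?thesis
    by (intro exI[of _ f'] exI[of _ \<rho>] exI[of _ C]) simp
qed

text \<open>\<open>K\<close> is the limit of the curves that take \<open>t\<close> to the
  \<open>n\<close>-th iterate under \<open>f\<close> of \<open>(0, t / s ^ n)\<close>. They agree
  with \<open>(0, t)\<close> up to \<open>O(t^2)\<close>, and on such differences
  \<open>g \<mapsto> f (g (t / s))\<close> contracts, since the Lipschitz constant of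
  \<open>f\<close> near 0 is below \<open>s^2\<close>. The tangent \<open>v\<close> of
  \<open>K\<close> solves a linear equation of the kind treated above, which gives the full
  smoothness.\<close>

theorem unstable_curve:
  fixes f :: "real \<times> real \<Rightarrow> real \<times> real" and l s :: real
  assumes "open N" "0 \<in> N" "Ck_on (Suc (Suc m)) f N" "f 0 = 0"
    "(f has_derivative (\<lambda>h. (l * fst h, s * snd h))) (at 0)" "\<bar>l\<bar> \<le> \<bar>s\<bar>" "1 < \<bar>s\<bar>"
  obtains d K where "0 < d" "Ck_on (Suc (Suc m)) K {-d<..<d}" "K 0 = 0" "(K has_vector_derivative (0, 1)) (at 0)"
    "\<And>t. \<bar>t\<bar> < d \<Longrightarrow> K t \<in> N" "\<And>t. \<bar>t\<bar> < d \<Longrightarrow> K t = f (K (t / s))"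
proof -
  define A where "A = (\<lambda>h::real \<times> real. (l * fst h, s * snd h))"
  have fA: "(f has_derivative A) (at 0)" unfolding A_def by (rule assms(5))
  have normA: "norm (A h) \<le> \<bar>s\<bar> * norm h" for h
  proof -
    have "(l * fst h)\<^sup>2 \<le> (s * fst h)\<^sup>2"
      using assms(6) by (intro abs_le_square_iff[THEN iffD1]) (auto simp: abs_mult intro: mult_right_mono)
    then have "norm (A h) \<le> sqrt ((s * fst h)\<^sup>2 + (s * snd h)\<^sup>2)"
      by (simp add: A_def norm_Pair)
    also have "(s * fst h)\<^sup>2 + (s * snd h)\<^sup>2 = s\<^sup>2 * ((fst h)\<^sup>2 + (snd h)\<^sup>2)"
      by (simp add: power_mult_distrib distrib_left)
    finally show ?thesis by (simp add: real_sqrt_mult norm_prod_def)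
  qed
  have linA: "linear A" unfolding A_def by (intro linearI) (auto simp: algebra_simps)
  obtain f' \<rho> C where E: "0 < \<rho> \<and> cball 0 \<rho> \<subseteq> N \<and> 0 \<le> C \<and>
      (\<forall>x\<in>N. (f has_derivative f' x) (at x)) \<and> (\<forall>w. Ck_on (Suc m) (\<lambda>x. f' x w) N) \<and>
      (\<forall>x\<in>cball 0 \<rho>. \<forall>y\<in>cball 0 \<rho>. \<forall>w. norm (f' x w - f' y w) \<le> C * norm (x - y) * norm w) \<and>
      (\<forall>x\<in>cball 0 \<rho>. \<forall>w. norm (f' x w - A w) \<le> C * norm x * norm w) \<and>
      (\<forall>x\<in>cball 0 \<rho>. norm (f x - A x) \<le> C * norm x ^ 2)"
    using C2_expansion[OF assms(1-4) fA] by (elim exE) (rule that)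
  from E have \<rho>: "0 < \<rho>" "cball 0 \<rho> \<subseteq> N" and C: "0 \<le> C" by simp_all
  from E have f': "\<And>x. x \<in> N \<Longrightarrow> (f has_derivative f' x) (at x)" "\<And>w. Ck_on (Suc m) (\<lambda>x. f' x w) N"
    by (elim conjE, blast)+
  from E have lip: "\<And>x y w. x \<in> cball 0 \<rho> \<Longrightarrow> y \<in> cball 0 \<rho> \<Longrightarrow> norm (f' x w - f' y w) \<le> C * norm (x - y) * norm w"
    and lip0: "\<And>x w. x \<in> cball 0 \<rho> \<Longrightarrow> norm (f' x w - A w) \<le> C * norm x * norm w"
    and quad: "\<And>x. x \<in> cball 0 \<rho> \<Longrightarrow> norm (f x - A x) \<le> C * norm x ^ 2"
    by (elim conjE, blast)+
  have s2: "\<bar>s\<bar> < s\<^sup>2" using assms(7) mult_strict_right_mono[of 1 "\<bar>s\<bar>" "\<bar>s\<bar>"] by (simp add: power2_eq_square)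
  \<comment> \<open>Strictly between \<open>\<bar>s\<bar>\<close>, the bound for \<open>A\<close>,
    and \<open>s\<^sup>2\<close>: the former leaves room for the nonlinearity, the latter makes the
    iteration contract with weight 2.\<close>
  define \<theta> where "\<theta> = (\<bar>s\<bar> + s\<^sup>2) / 2"
  have th: "\<bar>s\<bar> < \<theta>" "\<theta> < s\<^sup>2" "0 \<le> \<theta>" using s2 by (auto simp: \<theta>_def)
  \<comment> \<open>The solution of \<open>4 * C + \<bar>s\<bar> * R = s\<^sup>2 * R\<close>, which
    makes the region \<open>norm (x - (0, t)) \<le> R * t\<^sup>2\<close> invariant under the
    iteration; the 4 arises from \<open>norm x \<le> 2 * \<bar>t\<bar>\<close> in the quadratic
    Taylor estimate.\<close>
  define R where "R = 4 * C / (s\<^sup>2 - \<bar>s\<bar>)"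
  have R: "0 \<le> R" "4 * C + \<bar>s\<bar> * R = s\<^sup>2 * R" using C s2 by (auto simp: R_def divide_simps) (auto simp: algebra_simps)
  \<comment> \<open>So small that the deviation of \<open>f'\<close> from \<open>A\<close> is at
    most \<open>\<theta> - \<bar>s\<bar>\<close>, hence \<open>f'\<close> is bounded by
    \<open>\<theta>\<close> on \<open>W\<close>.\<close>
  define \<rho>' where "\<rho>' = min \<rho> ((\<theta> - \<bar>s\<bar>) / (C + 1))"
  have \<rho>': "0 < \<rho>'" "\<rho>' \<le> \<rho>" "C * \<rho>' \<le> \<theta> - \<bar>s\<bar>"
  proof -
    show "0 < \<rho>'" using \<rho> th C by (auto simp: \<rho>'_def)
    show "\<rho>' \<le> \<rho>" by (simp add: \<rho>'_def)
    have "C * \<rho>' \<le> (C + 1) * \<rho>'" using \<open>0 < \<rho>'\<close> by (simp add: algebra_simps)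
    also have "\<dots> \<le> (C + 1) * ((\<theta> - \<bar>s\<bar>) / (C + 1))" using C by (intro mult_left_mono) (auto simp: \<rho>'_def)
    finally show "C * \<rho>' \<le> \<theta> - \<bar>s\<bar>" using C by simp
  qed
  define W where "W = cball (0::real \<times> real) \<rho>'"
  have W: "W \<subseteq> cball 0 \<rho>" "W \<subseteq> N" using \<rho> \<rho>' by (auto simp: W_def)
  have lin: "linear (f' x)" if "x \<in> W" for x
    using f'(1) that W has_derivative_linear by blast
  have opn: "norm (f' x w) \<le> \<theta> * norm w" if x: "x \<in> W" for x w
  proof -
    have "norm (f' x w) \<le> norm (f' x w - A w) + norm (A w)" by (metis diff_add_cancel norm_triangle_ineq)
    also have "\<dots> \<le> C * norm x * norm w + \<bar>s\<bar> * norm w" by (rule add_mono[OF lip0[OF subsetD[OF W(1) x]] normA])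
    also have "C * norm x * norm w \<le> (\<theta> - \<bar>s\<bar>) * norm w"
      using x C \<rho>' by (intro mult_right_mono order_trans[OF mult_left_mono \<rho>'(3)]) (auto simp: W_def)
    finally show ?thesis by (simp add: algebra_simps)
  qed
  have flip: "norm (f x - f y) \<le> \<theta> * norm (x - y)" if "x \<in> W" "y \<in> W" for x y
  proof (rule differentiable_bound[where S=W and f'=f'])
    show "(f has_derivative f' z) (at z within W)" if "z \<in> W" for z
      using f'(1) that W has_derivative_at_withinI by blast
    show "onorm (f' z) \<le> \<theta>" if "z \<in> W" for z by (rule onorm_le) (rule opn[OF that])
  qed (use that in \<open>auto simp: W_def\<close>)
  \<comment> \<open>\<open>R * d \<le> 1\<close> gives
    \<open>R * t\<^sup>2 \<le> \<bar>t\<bar>\<close>, hence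
    \<open>norm x \<le> 2 * \<bar>t\<bar>\<close> in the invariant region, and
    \<open>d \<le> \<rho>' / 2\<close> then puts that region into \<open>W\<close>.\<close>
  define d where "d = min (1 / (R + 1)) (\<rho>' / 2)"
  have d: "0 < d" "d \<le> \<rho>' / 2" "R * d \<le> 1"
  proof -
    show "0 < d" "d \<le> \<rho>' / 2" using R \<rho>' by (auto simp: d_def)
    have "R * d \<le> R * (1 / (R + 1))" using R by (intro mult_left_mono) (auto simp: d_def)
    also have "\<dots> \<le> 1" using R(1) by simp
    finally show "R * d \<le> 1" .
  qed
  interpret dilation s d by unfold_locales (rule assms(7))
  have nearW: "x \<in> W \<and> norm x \<le> 2 * \<bar>t\<bar>" if "norm (x - (0, t)) \<le> R * t\<^sup>2" "\<bar>t\<bar> < d" for x t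
  proof -
    have "R * t\<^sup>2 = R * \<bar>t\<bar> * \<bar>t\<bar>" by (simp add: power2_eq_square)
    also have "\<dots> \<le> 1 * \<bar>t\<bar>"
      using that(2) R d by (intro mult_right_mono order_trans[OF mult_left_mono d(3)]) auto
    finally have "norm x \<le> 2 * \<bar>t\<bar>"
      using that(1) norm_triangle_sub[of x "(0, t)"] by (simp add: norm_Pair)
    then show ?thesis using that(2) d by (auto simp: W_def)
  qed
  define F where "F = rec_nat (\<lambda>t. (0::real, t)) (\<lambda>_ g t. f (g (t / s)))"
  have F: "F 0 = (\<lambda>t. (0, t))" "\<And>n. F (Suc n) = (\<lambda>t. f (F n (t / s)))" by (simp_all add: F_def)
  have td: "\<bar>t / s\<bar> < d" if "\<bar>t\<bar> < d" for t using abs_divide_le_abs[OF s1, of t] that by linarith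
  have tdI: "\<bar>t / s\<bar> < d" if "t \<in> I" for t using td that unfolding I_iff by blast
  have Fb: "norm (F n t - (0, t)) \<le> R * t\<^sup>2" if "\<bar>t\<bar> < d" for n t
    using that
  proof (induction n arbitrary: t)
    case 0
    then show ?case using R by (simp add: F)
  next
    case (Suc n)
    define x where "x = F n (t / s)"
    have x: "norm (x - (0, t / s)) \<le> R * (t / s)\<^sup>2" unfolding x_def by (rule Suc.IH[OF td[OF Suc.prems]])
    note xW = nearW[OF x td[OF Suc.prems]]
    have "F (Suc n) t - (0, t) = (f x - A x) + A (x - (0, t / s))"
      using s0 by (simp add: F x_def linear_diff[OF linA]) (simp add: A_def)
    also have "norm \<dots> \<le> C * norm x ^ 2 + \<bar>s\<bar> * norm (x - (0, t / s))"
      by (rule norm_triangle_le[OF add_mono[OF quad[OF subsetD[OF W(1) conjunct1[OF xW]]] normA]])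
    also have "\<dots> \<le> C * (2 * \<bar>t / s\<bar>) ^ 2 + \<bar>s\<bar> * (R * (t / s)\<^sup>2)"
      using xW x C by (intro add_mono mult_left_mono power_mono) auto
    also have "\<dots> = (4 * C + \<bar>s\<bar> * R) * (t / s)\<^sup>2"
      by (simp add: power_mult_distrib power_divide algebra_simps add_divide_distrib)
    also have "\<dots> = R * t\<^sup>2" using s0 by (simp add: R(2) power_divide)
    finally show ?case .
  qed
  have FW: "F n t \<in> W \<and> norm (F n t) \<le> 2 * \<bar>t\<bar>" if "\<bar>t\<bar> < d" for n t
    by (rule nearW[OF Fb[OF that] that])
  have inc: "geo d 2 (\<lambda>n t. F (Suc n) t - F n t)"
  proof (rule geo_rec[OF s1 th(3) _ _ geo_zero[where 'a="real"]])
    show "\<theta> < \<bar>s\<bar>\<^sup>2" using th by simp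
    show "norm (F (Suc (Suc n)) t - F (Suc n) t) \<le> \<theta> * norm (F (Suc n) (t / s) - F n (t / s)) + norm (0::real)"
      if "\<bar>t\<bar> < d" for n t
    proof -
      have "norm (f (F (Suc n) (t / s)) - f (F n (t / s))) \<le> \<theta> * norm (F (Suc n) (t / s) - F n (t / s))"
        by (rule flip) (use FW td[OF that] in blast)+
      then show ?thesis by (simp only: F(2)[of "Suc n"] F(2)[of n]) simp
    qed
    show "\<exists>K. \<forall>t. \<bar>t\<bar> \<le> \<delta> \<longrightarrow> norm (F (Suc 0) t - F 0 t) \<le> K * \<bar>t\<bar>\<^sup>2" if "\<delta> < d" for \<delta>
      using Fb[where n="Suc 0"] that by (intro exI[of _ R]) (auto simp: F(1))
  qed
  define K where "K t = lim (\<lambda>n. F n t)" for t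
  have gK: "geo d 2 (\<lambda>n t. F n t - K t)" and lK: "\<And>t. \<bar>t\<bar> < d \<Longrightarrow> (\<lambda>n. F n t) \<longlonglongrightarrow> K t"
    unfolding K_def using geo_lim[OF inc] by auto
  have Kb: "norm (K t - (0, t)) \<le> R * t\<^sup>2" if t: "\<bar>t\<bar> < d" for t
  proof (rule LIMSEQ_le_const2)
    show "(\<lambda>n. norm (F n t - (0, t))) \<longlonglongrightarrow> norm (K t - (0, t))"
      by (intro tendsto_intros lK t)
  qed (use Fb t in auto)
  have KW: "K t \<in> W \<and> norm (K t) \<le> 2 * \<bar>t\<bar>" if "\<bar>t\<bar> < d" for t
    by (rule nearW[OF Kb[OF that] that])
  have Keq: "K t = f (K (t / s))" if t: "\<bar>t\<bar> < d" for t
  proof -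
    have "isCont f (K (t / s))"
      using KW[OF td[OF t]] W by (intro has_derivative_continuous[OF f'(1)]) blast
    then have "(\<lambda>n. f (F n (t / s))) \<longlonglongrightarrow> f (K (t / s))"
      by (rule isCont_tendsto_compose) (rule lK[OF td[OF t]])
    moreover have "(\<lambda>n. f (F n (t / s))) \<longlonglongrightarrow> K t"
      using LIMSEQ_Suc[OF lK[OF t]] by (simp add: F)
    ultimately show ?thesis using LIMSEQ_unique by blast
  qed
  \<comment> \<open>The derivatives of the curves \<open>F n\<close>, by the chain rule. The factor
    \<open>1 / s\<close> allows convergence with weight 1, as
    \<open>\<theta> / \<bar>s\<bar> < \<bar>s\<bar>\<close>.\<close>
  define G where "G = rec_nat (\<lambda>t. (0::real, 1::real)) (\<lambda>n g t. (1 / s) *\<^sub>R f' (F n (t / s)) (g (t / s)))"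
  have G: "G 0 = (\<lambda>t. (0, 1))" "\<And>n. G (Suc n) = (\<lambda>t. (1 / s) *\<^sub>R f' (F n (t / s)) (G n (t / s)))"
    by (simp_all add: G_def)
  have FG: "(F n has_vector_derivative G n t) (at t)" if "\<bar>t\<bar> < d" for n t
    using that
  proof (induction n arbitrary: t)
    case 0
    show ?case unfolding F G by (auto intro!: derivative_eq_intros)
  next
    case (Suc n)
    have "((\<lambda>t. F n (t / s)) has_derivative (\<lambda>h. h *\<^sub>R (1 / s) *\<^sub>R G n (t / s))) (at t)"
      using has_vector_derivative_rescale[OF Suc.IH[OF td[OF Suc.prems]]] by (simp add: has_vector_derivative_def)
    moreover have FnW: "F n (t / s) \<in> W" using FW td[OF Suc.prems] by blast
    then have "(f has_derivative f' (F n (t / s))) (at (F n (t / s)))" using f'(1) W by blast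
    ultimately have "((\<lambda>t. f (F n (t / s))) has_derivative (\<lambda>h. f' (F n (t / s)) (h *\<^sub>R (1 / s) *\<^sub>R G n (t / s)))) (at t)"
      by (rule has_derivative_compose)
    then show ?case by (simp add: F G has_vector_derivative_def linear_scale[OF lin[OF FnW]])
  qed
  have Gb: "norm (G n t - (0, 1)) \<le> R * \<bar>t\<bar>" if "\<bar>t\<bar> < d" for n t
    using that
  proof (induction n arbitrary: t)
    case 0
    then show ?case using R by (simp add: G)
  next
    case (Suc n)
    define \<tau> where "\<tau> = t / s"
    have \<tau>: "\<bar>\<tau>\<bar> < d" unfolding \<tau>_def by (rule td[OF Suc.prems])
    define x g where "x = F n \<tau>" and "g = G n \<tau>"
    have g: "norm (g - (0, 1)) \<le> R * \<bar>\<tau>\<bar>" unfolding g_def by (rule Suc.IH[OF \<tau>])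
    have xW: "x \<in> W" "norm x \<le> 2 * \<bar>\<tau>\<bar>" unfolding x_def using FW[OF \<tau>] by blast+
    have "R * \<bar>\<tau>\<bar> \<le> 1" using \<tau> R d by (intro order_trans[OF mult_left_mono d(3)]) auto
    then have g2: "norm g \<le> 2" using g norm_triangle_sub[of g "(0, 1)"] by (simp add: norm_Pair)
    have "G (Suc n) t - (0, 1) = (1 / s) *\<^sub>R ((f' x g - A g) + A (g - (0, 1)))"
      using s0 by (simp add: G x_def g_def \<tau>_def linear_diff[OF linA]) (simp add: A_def algebra_simps)
    also have "norm \<dots> = (1 / \<bar>s\<bar>) * norm ((f' x g - A g) + A (g - (0, 1)))" by simp
    also have "\<dots> \<le> (1 / \<bar>s\<bar>) * (C * norm x * norm g + \<bar>s\<bar> * norm (g - (0, 1)))"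
      by (rule mult_left_mono[OF norm_triangle_le[OF add_mono[OF lip0[OF subsetD[OF W(1) xW(1)]] normA]]]) simp
    also have "\<dots> \<le> (1 / \<bar>s\<bar>) * (C * (2 * \<bar>\<tau>\<bar>) * 2 + \<bar>s\<bar> * (R * \<bar>\<tau>\<bar>))"
      using xW g g2 C by (intro mult_left_mono add_mono mult_mono) auto
    also have "\<dots> = (1 / \<bar>s\<bar>) * ((4 * C + \<bar>s\<bar> * R) * \<bar>\<tau>\<bar>)" by (simp add: algebra_simps)
    also have "\<dots> = R * \<bar>t\<bar>" unfolding R(2) using s0 by (simp add: \<tau>_def power2_eq_square)
    finally show ?case .
  qed
  have G2: "norm (G n t) \<le> 2" if "\<bar>t\<bar> < d" for n t
  proof -
    have "R * \<bar>t\<bar> \<le> 1" using that R d by (intro order_trans[OF mult_left_mono d(3)]) auto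
    then show ?thesis using Gb[OF that, of n] norm_triangle_sub[of "G n t" "(0, 1)"] by (simp add: norm_Pair)
  qed
  \<comment> \<open>The error from evaluating \<open>f'\<close> on two successive curves: the
    Lipschitz constant \<open>C\<close> of \<open>f'\<close>, times the bound 2 for
    \<open>G n\<close>, divided by \<open>\<bar>s\<bar>\<close>.\<close>
  have e: "geo d 1 (\<lambda>n t. if \<bar>t\<bar> < d then (2 * C / \<bar>s\<bar>) *\<^sub>R (F (Suc n) (t / s) - F n (t / s)) else 0)"
  proof (rule geo_cmult[OF geo_weaken[OF inc] _ s1])
    show "\<exists>C'. \<forall>n t. \<bar>t\<bar> \<le> \<delta> \<longrightarrow> norm (if \<bar>t\<bar> < d then (2 * C / \<bar>s\<bar>) *\<^sub>R (F (Suc n) (t / s) - F n (t / s)) else 0)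
         \<le> C' * norm (F (Suc n) (t / s) - F n (t / s))" if "\<delta> < d" for \<delta>
      using C by (intro exI[of _ "2 * C / \<bar>s\<bar>"]) auto
  qed simp
  have incG: "geo d 1 (\<lambda>n t. G (Suc n) t - G n t)"
  proof (rule geo_rec[where \<theta>="\<theta> / \<bar>s\<bar>", OF s1 _ _ _ e])
    show "0 \<le> \<theta> / \<bar>s\<bar>" using th by simp
    show "\<theta> / \<bar>s\<bar> < \<bar>s\<bar> ^ 1" using th s0 by (simp add: divide_less_eq power2_eq_square)
    show "norm (G (Suc (Suc n)) t - G (Suc n) t) \<le> \<theta> / \<bar>s\<bar> * norm (G (Suc n) (t / s) - G n (t / s))
        + norm (if \<bar>t\<bar> < d then (2 * C / \<bar>s\<bar>) *\<^sub>R (F (Suc n) (t / s) - F n (t / s)) else 0)" if t: "\<bar>t\<bar> < d" for n t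
    proof -
      define x y g h where "x = F (Suc n) (t / s)" and "y = F n (t / s)" and "g = G (Suc n) (t / s)" and "h = G n (t / s)"
      have xy: "x \<in> W" "y \<in> W" unfolding x_def y_def using FW td[OF t] by blast+
      have g2: "norm g \<le> 2" unfolding g_def by (rule G2[OF td[OF t]])
      have "G (Suc (Suc n)) t - G (Suc n) t = (1 / s) *\<^sub>R (f' y (g - h) + (f' x g - f' y g))"
      proof -
        have "G (Suc (Suc n)) t = (1 / s) *\<^sub>R f' x g" unfolding x_def g_def by (simp only: G(2)[of "Suc n"])
        moreover have "G (Suc n) t = (1 / s) *\<^sub>R f' y h" unfolding y_def h_def by (simp only: G(2)[of n])
        ultimately show ?thesis by (simp add: linear_diff[OF lin[OF xy(2)]] algebra_simps)
      qed
      also have "norm \<dots> = (1 / \<bar>s\<bar>) * norm (f' y (g - h) + (f' x g - f' y g))" by simp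
      also have "\<dots> \<le> (1 / \<bar>s\<bar>) * (\<theta> * norm (g - h) + C * norm (x - y) * 2)"
      proof (rule mult_left_mono[OF norm_triangle_le[OF add_mono[OF opn[OF xy(2)]]]])
        have "norm (f' x g - f' y g) \<le> C * norm (x - y) * norm g"
          by (rule lip[OF subsetD[OF W(1) xy(1)] subsetD[OF W(1) xy(2)]])
        also have "\<dots> \<le> C * norm (x - y) * 2" using g2 C by (intro mult_left_mono) auto
        finally show "norm (f' x g - f' y g) \<le> C * norm (x - y) * 2" .
      qed simp
      also have "\<dots> = \<theta> / \<bar>s\<bar> * norm (g - h) + norm ((2 * C / \<bar>s\<bar>) *\<^sub>R (x - y))"
        unfolding norm_scaleR using C by (simp add: algebra_simps)
      finally show ?thesis using t by (simp add: x_def y_def g_def h_def)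
    qed
    show "\<exists>K. \<forall>t. \<bar>t\<bar> \<le> \<delta> \<longrightarrow> norm (G (Suc 0) t - G 0 t) \<le> K * \<bar>t\<bar> ^ 1" if "\<delta> < d" for \<delta>
      using Gb[where n="Suc 0"] that by (intro exI[of _ R]) (auto simp: G(1))
  qed
  define v where "v t = lim (\<lambda>n. G n t)" for t
  have gv: "geo d 1 (\<lambda>n t. G n t - v t)" and lv: "\<And>t. \<bar>t\<bar> < d \<Longrightarrow> (\<lambda>n. G n t) \<longlonglongrightarrow> v t"
    unfolding v_def using geo_lim[OF incG] by auto
  have vb: "norm (v t - (0, 1)) \<le> R * \<bar>t\<bar>" if t: "\<bar>t\<bar> < d" for t
  proof (rule LIMSEQ_le_const2)
    show "(\<lambda>n. norm (G n t - (0, 1))) \<longlonglongrightarrow> norm (v t - (0, 1))"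
      by (intro tendsto_intros lv t)
  qed (use Gb t in auto)
  have Kv: "(K has_vector_derivative v t) (at t)" if "\<bar>t\<bar> < d" for t
    by (rule geo_derivative[OF geo_weaken[OF gK] geo_weaken[OF gv] FG that]) auto
  have K0: "K 0 = 0" using Kb[of 0] d by (simp add: zero_prod_def[symmetric])
  have v0: "v 0 = (0, 1)" using vb[of 0] d by simp
  have veq: "v t = (1 / s) *\<^sub>R f' (K (t / s)) (v (t / s))" if t: "\<bar>t\<bar> < d" for t
  proof -
    have KW': "K (t / s) \<in> W" using KW td[OF t] by blast
    have "((\<lambda>t. K (t / s)) has_derivative (\<lambda>h. h *\<^sub>R (1 / s) *\<^sub>R v (t / s))) (at t)"
      using has_vector_derivative_rescale[OF Kv[OF td[OF t]]] by (simp add: has_vector_derivative_def)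
    moreover have "(f has_derivative f' (K (t / s))) (at (K (t / s)))" using f'(1) W KW' by blast
    ultimately have "((\<lambda>t. f (K (t / s))) has_derivative (\<lambda>h. f' (K (t / s)) (h *\<^sub>R (1 / s) *\<^sub>R v (t / s)))) (at t)"
      by (rule has_derivative_compose)
    then have "((\<lambda>t. f (K (t / s))) has_vector_derivative (1 / s) *\<^sub>R f' (K (t / s)) (v (t / s))) (at t)"
      by (simp add: has_vector_derivative_def linear_scale[OF lin[OF KW']])
    then have "(K has_vector_derivative (1 / s) *\<^sub>R f' (K (t / s)) (v (t / s))) (at t)"
      by (rule has_vector_derivative_transform_within_open[where S=I]) (use t Keq in \<open>auto simp: abs_less_iff\<close>)
    then show ?thesis using Kv[OF t] vector_derivative_unique_at by blast
  qed
  have contK: "continuous_on I K"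
    by (intro continuous_at_imp_continuous_on ballI has_vector_derivative_continuous[OF Kv]) (simp only: I_iff)
  have vcont: "continuous_on I v"
  proof (rule geo_continuous[OF geo_weaken[OF gv]])
    fix n
    have FC: "Ck_on (Suc (Suc m)) (F n) I" for n
    proof (induction n)
      case 0
      then show ?case unfolding F by (intro Ck_Pair Ck_const Ck_ident open_greaterThanLessThan)
    next
      case (Suc n)
      show ?case unfolding F
        by (rule Ck_compose[OF open_greaterThanLessThan assms(1) Ck_rescale[OF Suc] assms(3)])
          (use FW[OF tdI] W in blast)
    qed
    show "continuous_on I (G n)"
    proof -
      obtain g where g: "\<And>t. t \<in> I \<Longrightarrow> (F n has_vector_derivative g t) (at t)" "Ck_on (Suc m) g I"
        using Ck_vector_derivative_ex[OF open_greaterThanLessThan FC[of n]] by blast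
      have "G n t = g t" if "t \<in> I" for t
        using vector_derivative_unique_at[OF FG g(1)[OF that]] that by (auto simp: abs_less_iff)
      then show ?thesis
        by (intro continuous_on_eq[OF Ck_continuous[OF open_greaterThanLessThan g(2)]]) simp
    qed
  qed simp
  have KN: "K t \<in> N" if "\<bar>t\<bar> < d" for t using KW[OF that] W by blast
  \<comment> \<open>Bootstrapping: if \<open>K\<close> is \<open>C^j\<close>, so is the coefficient
    \<open>f' (K (t / s))\<close> of the equation for \<open>v\<close>; then \<open>v\<close> is
    \<open>C^j\<close> and \<open>K\<close> is \<open>C^(j+1)\<close>. This stops only where the
    smoothness of \<open>f'\<close> ends.\<close>
  have "Ck_on j K I" if "j \<le> Suc (Suc m)" for j
    using that
  proof (induction j)
    case 0
    then show ?case using contK by simp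
  next
    case (Suc j)
    have "Ck_on j v I"
    proof (rule solution_smooth[where B="\<lambda>t w. (1 / s) *\<^sub>R f' (K (t / s)) w" and c="\<lambda>t. 0" and \<theta>="\<theta> / \<bar>s\<bar>" and ?x0.0="(0, 1)"])
      show "linear (\<lambda>w. (1 / s) *\<^sub>R f' (K (t / s)) w)" if "t \<in> I" for t
        using linear_compose[OF lin linear_scaleR[of "1 / s"]] KW[OF tdI[OF that]] by (simp add: o_def)
      show "norm ((1 / s) *\<^sub>R f' (K (t / s)) x) \<le> \<theta> / \<bar>s\<bar> * norm x" if "t \<in> I" for t x
      proof -
        have "K (t / s) \<in> W" using KW[OF tdI[OF that]] by blast
        from mult_left_mono[OF opn[OF this, of x], of "1 / \<bar>s\<bar>"] show ?thesis by simp
      qed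
      show "0 \<le> \<theta> / \<bar>s\<bar>" using th by simp
      show "\<theta> / \<bar>s\<bar> < \<bar>s\<bar>" using th s0 by (simp add: divide_less_eq power2_eq_square)
      show "continuous_on I v" by (rule vcont)
      show "v t = (1 / s) *\<^sub>R f' (K (t / s)) (v (t / s)) + 0" if "t \<in> I" for t
        using veq[of t] that unfolding I_iff by simp
      show "\<exists>K. \<forall>t. \<bar>t\<bar> \<le> \<delta> \<longrightarrow> norm (v t - (0, 1)) \<le> K * \<bar>t\<bar>" if "\<delta> < d" for \<delta>
        using vb that by (intro exI[of _ R]) auto
      show "Ck_on j (\<lambda>t. (1 / s) *\<^sub>R f' (K (t / s)) w) I" for w
      proof (rule Ck_scaleR[OF open_greaterThanLessThan Ck_const[OF open_greaterThanLessThan]])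
        show "Ck_on j (\<lambda>t. f' (K (t / s)) w) I"
          by (rule Ck_compose[OF open_greaterThanLessThan assms(1) Ck_rescale Ck_mono[OF assms(1) f'(2)]])
            (use Suc KN[OF tdI] in auto)
      qed
    qed (rule Ck_const, simp)
    then show ?case
      by (rule Ck_vector_derivativeI[OF open_greaterThanLessThan, rotated]) (use Kv in \<open>auto simp: abs_less_iff\<close>)
  qed
  then have KC: "Ck_on (Suc (Suc m)) K I" by blast
  have "(K has_vector_derivative (0, 1)) (at 0)" using Kv[of 0] d(1) v0 by simp
  from that[OF d(1) KC K0 this KN Keq] show ?thesis .
qed

section \<open>Weighted bounds from smoothness\<close>

abbreviation obox :: "real \<Rightarrow> (real \<times> real) set" where "obox \<delta> \<equiv> {-\<delta><..<\<delta>} \<times> {-\<delta><..<\<delta>}"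
abbreviation kbox :: "real \<Rightarrow> (real \<times> real) set" where "kbox \<delta> \<equiv> {-\<delta>..\<delta>} \<times> {-\<delta>..\<delta>}"

lemma obox_kbox: "obox \<delta> \<subseteq> kbox \<delta>" by auto

lemma open_obox: "open (obox \<delta>)" by (intro open_Times open_greaterThanLessThan)

lemma bounded_on_kbox:
  fixes u :: "real \<times> real \<Rightarrow> real"
  assumes "continuous_on M u" "kbox \<delta> \<subseteq> M"
  shows "\<exists>C\<ge>0. \<forall>z\<in>kbox \<delta>. \<bar>u z\<bar> \<le> C"
proof -
  have "bounded (u ` kbox \<delta>)"
    by (intro compact_imp_bounded compact_continuous_image continuous_on_subset[OF assms] compact_Times) auto
  then obtain C where C: "\<And>z. z \<in> kbox \<delta> \<Longrightarrow> \<bar>u z\<bar> \<le> C" unfolding bounded_iff real_norm_def by blast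
  show ?thesis
    using C by (intro exI[of _ "max 0 C"]) (auto simp: max.coboundedI2)
qed

lemma Ck_partials:
  fixes u :: "real \<times> real \<Rightarrow> real"
  assumes "open M" "Ck_on (Suc k) u M"
  shows "\<exists>p q. (\<forall>z\<in>M. (u has_derivative (\<lambda>h. fst h * p z + snd h * q z)) (at z)) \<and> Ck_on k p M \<and> Ck_on k q M"
proof -
  obtain u' where u': "\<And>x. x \<in> M \<Longrightarrow> (u has_derivative u' x) (at x)" "\<And>v. Ck_on k (\<lambda>x. u' x v) M"
    using Ck_Suc_ex[OF assms] by blast
  have "(u has_derivative (\<lambda>h. fst h * u' z (1,0) + snd h * u' z (0,1))) (at z)" if "z \<in> M" for z
  proof -
    have "u' z = (\<lambda>h. fst h * u' z (1,0) + snd h * u' z (0,1))"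
      by (rule ext, subst linear_prod_expand[OF has_derivative_linear[OF u'(1)[OF that]]]) simp
    then show ?thesis using u'(1)[OF that] by simp
  qed
  then show ?thesis
    by (intro exI[of _ "\<lambda>z. u' z (1,0)"] exI[of _ "\<lambda>z. u' z (0,1)"] conjI ballI u'(2))
qed

lemma partial_fst:
  fixes u :: "real \<times> real \<Rightarrow> real"
  assumes "(u has_derivative (\<lambda>h. fst h * p + snd h * q)) (at (x, y))"
  shows "((\<lambda>\<xi>. u (\<xi>, y)) has_real_derivative p) (at x)"
proof -
  have "((\<lambda>\<xi>. (\<xi>, y)) has_derivative (\<lambda>h. (h, 0))) (at x)"
    by (auto intro!: derivative_eq_intros)
  from has_derivative_compose[OF this assms]
  show ?thesis
    unfolding has_field_derivative_def by (rule has_derivative_eq_rhs) (auto simp: mult.commute)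
qed

lemma partial_snd:
  fixes u :: "real \<times> real \<Rightarrow> real"
  assumes "(u has_derivative (\<lambda>h. fst h * p + snd h * q)) (at (x, y))"
  shows "((\<lambda>\<eta>. u (x, \<eta>)) has_real_derivative q) (at y)"
proof -
  have "((\<lambda>\<eta>. (x, \<eta>)) has_derivative (\<lambda>h. (0, h))) (at y)"
    by (auto intro!: derivative_eq_intros)
  from has_derivative_compose[OF this assms]
  show ?thesis
    unfolding has_field_derivative_def by (rule has_derivative_eq_rhs) (auto simp: mult.commute)
qed

lemma real_mvt_bound:
  fixes u v :: "real \<Rightarrow> real"
  assumes "\<And>\<xi>. \<bar>\<xi>\<bar> \<le> \<bar>x\<bar> \<Longrightarrow> (u has_real_derivative v \<xi>) (at \<xi>)" "\<And>\<xi>. \<bar>\<xi>\<bar> \<le> \<bar>x\<bar> \<Longrightarrow> \<bar>v \<xi>\<bar> \<le> B"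
  shows "\<bar>u x - u 0\<bar> \<le> B * \<bar>x\<bar>"
proof -
  have "norm (u x - u 0) \<le> B * norm (x - 0)"
  proof (rule field_differentiable_bound[where S="{-\<bar>x\<bar>..\<bar>x\<bar>}" and f'=v])
    show "(u has_field_derivative v \<xi>) (at \<xi> within {-\<bar>x\<bar>..\<bar>x\<bar>})" if "\<xi> \<in> {-\<bar>x\<bar>..\<bar>x\<bar>}" for \<xi>
      by (rule has_field_derivative_at_within[OF assms(1)]) (use that in auto)
    show "norm (v \<xi>) \<le> B" if "\<xi> \<in> {-\<bar>x\<bar>..\<bar>x\<bar>}" for \<xi>
      using assms(2)[of \<xi>] that by auto
  qed auto
  then show ?thesis by simp
qed

section \<open>Functions vanishing on the axis\<close>

lemma vanishing_bound1:
  fixes u :: "real \<times> real \<Rightarrow> real"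
  assumes "open M" "Ck_on 1 u M" "kbox \<delta> \<subseteq> M" "\<And>z. z \<in> M \<Longrightarrow> fst z = 0 \<Longrightarrow> u z = 0"
  shows "\<exists>C\<ge>0. \<forall>z\<in>kbox \<delta>. \<bar>u z\<bar> \<le> C * \<bar>fst z\<bar>"
proof -
  obtain p q where pq: "\<And>z. z \<in> M \<Longrightarrow> (u has_derivative (\<lambda>h. fst h * p z + snd h * q z)) (at z)"
    "Ck_on 0 p M" "Ck_on 0 q M"
    using Ck_partials[OF assms(1) assms(2)[unfolded One_nat_def]] by blast
  obtain C where C: "0 \<le> C" "\<And>z. z \<in> kbox \<delta> \<Longrightarrow> \<bar>p z\<bar> \<le> C"
    using bounded_on_kbox[OF pq(2)[unfolded Ck_on.simps(1)] assms(3)] by blast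
  have "\<bar>u z\<bar> \<le> C * \<bar>fst z\<bar>" if z: "z \<in> kbox \<delta>" for z
  proof -
    obtain x y where xy: "z = (x, y)" by (cases z)
    have seg: "(\<xi>, y) \<in> kbox \<delta>" if "\<bar>\<xi>\<bar> \<le> \<bar>x\<bar>" for \<xi> using z that by (auto simp: xy)
    have "\<bar>u (x, y) - u (0, y)\<bar> \<le> C * \<bar>x\<bar>"
      by (rule real_mvt_bound[where u="\<lambda>\<xi>. u (\<xi>, y)" and v="\<lambda>\<xi>. p (\<xi>, y)",
            OF partial_fst[OF pq(1)[OF subsetD[OF assms(3) seg]]] C(2)[OF seg]])
    moreover have "(0, y) \<in> M" using seg[of 0] assms(3) by auto
    then have "u (0, y) = 0" using assms(4) by simp
    ultimately show ?thesis by (simp add: xy)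
  qed
  with C(1) show ?thesis by blast
qed

text \<open>After subtraction of the linear term the \<open>x\<close>-derivative is
  \<open>p (x, y) - p (0, y)\<close>, itself of order \<open>x\<close>, so the mean value bound
  applies twice.\<close>

lemma vanishing_bound2:
  fixes u :: "real \<times> real \<Rightarrow> real"
  assumes "open M" "kbox \<delta> \<subseteq> M" "\<And>z. z \<in> M \<Longrightarrow> fst z = 0 \<Longrightarrow> u z = 0"
    "\<And>z. z \<in> M \<Longrightarrow> (u has_derivative (\<lambda>h. fst h * p z + snd h * q z)) (at z)" "Ck_on 1 p M"
  shows "\<exists>C\<ge>0. \<forall>z\<in>kbox \<delta>. \<bar>u z - fst z * p (0, snd z)\<bar> \<le> C * \<bar>fst z\<bar> ^ 2"
proof -
  obtain p1 p2 where p': "\<And>z. z \<in> M \<Longrightarrow> (p has_derivative (\<lambda>h. fst h * p1 z + snd h * p2 z)) (at z)"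
    "Ck_on 0 p1 M" "Ck_on 0 p2 M"
    using Ck_partials[OF assms(1) assms(5)[unfolded One_nat_def]] by blast
  obtain C where C: "0 \<le> C" "\<And>z. z \<in> kbox \<delta> \<Longrightarrow> \<bar>p1 z\<bar> \<le> C"
    using bounded_on_kbox[OF p'(2)[unfolded Ck_on.simps(1)] assms(2)] by blast
  have "\<bar>u z - fst z * p (0, snd z)\<bar> \<le> C * \<bar>fst z\<bar> ^ 2" if z: "z \<in> kbox \<delta>" for z
  proof -
    obtain x y where xy: "z = (x, y)" by (cases z)
    have seg: "(\<xi>, y) \<in> kbox \<delta>" if "\<bar>\<xi>\<bar> \<le> \<bar>x\<bar>" for \<xi> using z that by (auto simp: xy)
    have pb: "\<bar>p (\<xi>, y) - p (0, y)\<bar> \<le> C * \<bar>\<xi>\<bar>" if "\<bar>\<xi>\<bar> \<le> \<bar>x\<bar>" for \<xi>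
      by (rule real_mvt_bound[where u="\<lambda>\<xi>. p (\<xi>, y)" and v="\<lambda>\<xi>. p1 (\<xi>, y)",
            OF partial_fst[OF p'(1)[OF subsetD[OF assms(2) seg[OF order_trans[OF _ that]]]]]
              C(2)[OF seg[OF order_trans[OF _ that]]]])
    have "\<bar>(u (x, y) - x * p (0, y)) - (u (0, y) - 0 * p (0, y))\<bar> \<le> C * \<bar>x\<bar> * \<bar>x\<bar>"
    proof (rule real_mvt_bound[where u="\<lambda>\<xi>. u (\<xi>, y) - \<xi> * p (0, y)" and v="\<lambda>\<xi>. p (\<xi>, y) - p (0, y)"])
      fix \<xi> assume \<xi>: "\<bar>\<xi>\<bar> \<le> \<bar>x\<bar>"
      have "(\<xi>, y) \<in> M" using seg[OF \<xi>] assms(2) by blast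
      from partial_fst[OF assms(4)[OF this]]
      show "((\<lambda>\<xi>. u (\<xi>, y) - \<xi> * p (0, y)) has_real_derivative p (\<xi>, y) - p (0, y)) (at \<xi>)"
        by (auto intro!: derivative_eq_intros)
      show "\<bar>p (\<xi>, y) - p (0, y)\<bar> \<le> C * \<bar>x\<bar>"
        using pb[OF \<xi>] mult_left_mono[OF \<xi> C(1)] by linarith
    qed
    moreover have "(0, y) \<in> M" using seg[of 0] assms(2) by auto
    then have "u (0, y) = 0" using assms(3) by simp
    ultimately show ?thesis by (simp add: xy power2_eq_square mult.assoc)
  qed
  with C(1) show ?thesis by blast
qed

lemma wbd_smooth:
  assumes "open M" "kbox \<delta> \<subseteq> M"
  shows "Ck_on k u M \<Longrightarrow> \<exists>C\<ge>0. wbd (obox \<delta>) k 0 C u"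
proof (induction k arbitrary: u)
  case 0
  obtain C where C: "0 \<le> C" "\<And>z. z \<in> kbox \<delta> \<Longrightarrow> \<bar>u z\<bar> \<le> C"
    using bounded_on_kbox[OF 0[unfolded Ck_on.simps(1)] assms(2)] by blast
  have "continuous_on (obox \<delta>) u"
    by (rule continuous_on_subset[OF 0[unfolded Ck_on.simps(1)] order_trans[OF obox_kbox assms(2)]])
  moreover have "\<forall>z\<in>obox \<delta>. \<bar>u z\<bar> \<le> C * \<bar>fst z\<bar> ^ 0"
    unfolding power_0 mult_1_right using C(2) subsetD[OF obox_kbox] by blast
  ultimately show ?case unfolding wbd.simps using C(1) by blast
next
  case (Suc k)
  obtain p q where pq: "\<And>z. z \<in> M \<Longrightarrow> (u has_derivative (\<lambda>h. fst h * p z + snd h * q z)) (at z)"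
    "Ck_on k p M" "Ck_on k q M"
    using Ck_partials[OF assms(1) Suc.prems] by blast
  obtain C where C: "0 \<le> C" "\<And>z. z \<in> kbox \<delta> \<Longrightarrow> \<bar>u z\<bar> \<le> C"
    using bounded_on_kbox[OF Ck_continuous[OF assms(1) Suc.prems] assms(2)] by blast
  obtain C1 C2 where C1: "wbd (obox \<delta>) k 0 C1 p" and C2: "wbd (obox \<delta>) k 0 C2 q"
    using Suc.IH[OF pq(2)] Suc.IH[OF pq(3)] by blast
  define B where "B = max C (max C1 C2)"
  have B: "C \<le> B" "C1 \<le> B" "C2 \<le> B" by (auto simp: B_def)
  have "wbd (obox \<delta>) (Suc k) 0 B u"
  proof (rule wbd_SucI[where p=p and q=q])
    show "\<bar>u z\<bar> \<le> B * \<bar>fst z\<bar> ^ 0" if "z \<in> obox \<delta>" for z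
      using C(2)[OF subsetD[OF obox_kbox that]] B(1) by simp
    show "(u has_derivative (\<lambda>h. fst h * p z + snd h * q z)) (at z)" if "z \<in> obox \<delta>" for z
      using pq(1) that assms(2) obox_kbox by blast
  qed (use wbd_le[OF C1 B(2)] wbd_le[OF C2 B(3)] in simp_all)
  moreover have "0 \<le> B" using B(1) C(1) by simp
  ultimately show ?case by blast
qed

lemma partial_snd_vanishes:
  fixes u :: "real \<times> real \<Rightarrow> real"
  assumes "open M" "\<And>z. z \<in> M \<Longrightarrow> fst z = 0 \<Longrightarrow> u z = 0"
    "(u has_derivative (\<lambda>h. fst h * p + snd h * q)) (at z)" "z \<in> M" "fst z = 0"
  shows "q = 0"
proof -
  obtain y where z: "z = (0, y)" using assms(5) by (cases z) auto
  have op: "open ((\<lambda>\<eta>. (0, \<eta>)) -` M)"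
    by (intro open_vimage assms(1) continuous_intros)
  have "((\<lambda>\<eta>. u (0, \<eta>)) has_real_derivative q) (at y)"
    using partial_snd assms(3) z by blast
  then have "((\<lambda>\<eta>. 0) has_real_derivative q) (at y)"
    by (rule has_field_derivative_transform_within_open[OF _ op]) (use assms(2,4) z in auto)
  then show ?thesis using DERIV_unique[OF _ DERIV_const] by blast
qed

text \<open>Bounding by \<open>\<bar>x\<bar>\<close> costs one derivative, once and not at every
  order: \<open>q\<close> is a derivative along the axis and vanishes there again, while
  \<open>p\<close> needs only weight 0.\<close>

lemma wbd_vanishing1:
  assumes "open M" "kbox \<delta> \<subseteq> M"
  shows "Ck_on (Suc k) u M \<Longrightarrow> (\<And>z. z \<in> M \<Longrightarrow> fst z = 0 \<Longrightarrow> u z = 0) \<Longrightarrow> \<exists>C\<ge>0. wbd (obox \<delta>) k 1 C u"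
proof (induction k arbitrary: u)
  case 0
  obtain C where C: "0 \<le> C" "\<And>z. z \<in> kbox \<delta> \<Longrightarrow> \<bar>u z\<bar> \<le> C * \<bar>fst z\<bar>"
    using vanishing_bound1[OF assms(1) 0(1)[folded One_nat_def] assms(2) 0(2)] by blast
  have "continuous_on (obox \<delta>) u"
    by (rule continuous_on_subset[OF Ck_continuous[OF assms(1) 0(1)] order_trans[OF obox_kbox assms(2)]])
  moreover have "\<forall>z\<in>obox \<delta>. \<bar>u z\<bar> \<le> C * \<bar>fst z\<bar> ^ 1"
    unfolding power_one_right using C(2) subsetD[OF obox_kbox] by blast
  ultimately show ?case unfolding wbd.simps using C(1) by blast
next
  case (Suc k)
  have u1: "Ck_on 1 u M" by (rule Ck_mono[OF assms(1) Suc.prems(1)]) simp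
  obtain p q where pq: "\<And>z. z \<in> M \<Longrightarrow> (u has_derivative (\<lambda>h. fst h * p z + snd h * q z)) (at z)"
    "Ck_on (Suc k) p M" "Ck_on (Suc k) q M"
    using Ck_partials[OF assms(1) Suc.prems(1)] by blast
  obtain C where C: "0 \<le> C" "\<And>z. z \<in> kbox \<delta> \<Longrightarrow> \<bar>u z\<bar> \<le> C * \<bar>fst z\<bar>"
    using vanishing_bound1[OF assms(1) u1 assms(2) Suc.prems(2)] by blast
  have q0: "q z = 0" if "z \<in> M" "fst z = 0" for z
    by (rule partial_snd_vanishes[OF assms(1) Suc.prems(2) pq(1)[OF that(1)] that])
  have "Ck_on k p M" by (rule Ck_mono[OF assms(1) pq(2)]) simp
  then obtain C1 where C1: "wbd (obox \<delta>) k 0 C1 p"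
    using wbd_smooth[OF assms] by blast
  obtain C2 where C2: "wbd (obox \<delta>) k 1 C2 q"
    using Suc.IH[OF pq(3) q0] by blast
  define B where "B = max C (max C1 C2)"
  have B: "C \<le> B" "C1 \<le> B" "C2 \<le> B" by (auto simp: B_def)
  have "wbd (obox \<delta>) (Suc k) 1 B u"
  proof (rule wbd_SucI[where p=p and q=q])
    show "\<bar>u z\<bar> \<le> B * \<bar>fst z\<bar> ^ 1" if "z \<in> obox \<delta>" for z
      using C(2)[OF subsetD[OF obox_kbox that]] mult_right_mono[OF B(1), of "\<bar>fst z\<bar>"] by simp
    show "(u has_derivative (\<lambda>h. fst h * p z + snd h * q z)) (at z)" if "z \<in> obox \<delta>" for z
      using pq(1) that assms(2) obox_kbox by blast
  qed (use wbd_le[OF C1 B(2)] wbd_le[OF C2 B(3)] in simp_all)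
  moreover have "0 \<le> B" using B(1) C(1) by simp
  ultimately show ?case by blast
qed

text \<open>On the axis \<open>p\<close> is the limit of the quotients \<open>u (x, y) / x\<close>
  as \<open>x\<close> tends to 0. Their \<open>y\<close>-derivatives \<open>q (x, y) / x\<close>
  tend to \<open>q1\<close> for the same reason, since \<open>q\<close> also vanishes on the axis.
  Both limits are uniform in \<open>y\<close>, so limit and derivative may be exchanged.\<close>

lemma partials_commute_on_axis:
  fixes u p q :: "real \<times> real \<Rightarrow> real"
  assumes M: "open M" "kbox \<delta> \<subseteq> M" and u0: "\<And>z. z \<in> M \<Longrightarrow> fst z = 0 \<Longrightarrow> u z = 0"
    and u: "\<And>z. z \<in> M \<Longrightarrow> (u has_derivative (\<lambda>h. fst h * p z + snd h * q z)) (at z)"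
    and p: "\<And>z. z \<in> M \<Longrightarrow> (p has_derivative (\<lambda>h. fst h * p1 z + snd h * p2 z)) (at z)" "Ck_on 1 p M"
    and q: "\<And>z. z \<in> M \<Longrightarrow> (q has_derivative (\<lambda>h. fst h * q1 z + snd h * q2 z)) (at z)" "Ck_on 1 q1 M"
    and y: "\<bar>y\<bar> < \<delta>"
  shows "p2 (0, y) = q1 (0, y)"
proof -
  have q0: "q z = 0" if "z \<in> M" "fst z = 0" for z
    by (rule partial_snd_vanishes[OF M(1) u0 u[OF that(1)] that])
  obtain C1 where C1: "0 \<le> C1" "\<And>z. z \<in> kbox \<delta> \<Longrightarrow> \<bar>u z - fst z * p (0, snd z)\<bar> \<le> C1 * \<bar>fst z\<bar> ^ 2"
    using vanishing_bound2[OF M u0 u p(2)] by blast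
  obtain C2 where C2: "0 \<le> C2" "\<And>z. z \<in> kbox \<delta> \<Longrightarrow> \<bar>q z - fst z * q1 (0, snd z)\<bar> \<le> C2 * \<bar>fst z\<bar> ^ 2"
    using vanishing_bound2[OF M q0 q] by blast
  define d where "d = \<delta> - \<bar>y\<bar>"
  \<comment> \<open>Halving turns the error \<open>O(x)\<close> of the quotients into geometric
    decay in \<open>n\<close>, so that \<open>geo_derivative\<close> can be used.\<close>
  define x where "x n = \<delta> * (1 / 2) ^ n" for n
  have d: "0 < d" and \<delta>: "0 < \<delta>" using y by (auto simp: d_def)
  have x: "0 < x n" "x n \<le> \<delta>" for n
    using \<delta> by (auto simp: x_def mult_le_cancel_left1 power_le_one)
  have inbox: "(x n, y + t) \<in> kbox \<delta>" "(0, y + t) \<in> kbox \<delta>" if "\<bar>t\<bar> < d" for n t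
    using that x[of n] by (auto simp: d_def)
  have gen: "geo d 0 (\<lambda>n t. v (x n, y + t) / x n - w (0, y + t))"
    if C: "0 \<le> C" "\<And>z. z \<in> kbox \<delta> \<Longrightarrow> \<bar>v z - fst z * w (0, snd z)\<bar> \<le> C * \<bar>fst z\<bar> ^ 2" for C and v w :: "real \<times> real \<Rightarrow> real"
    unfolding geo_def
  proof (intro allI impI exI conjI)
    fix \<delta>' n t assume "\<delta>' < d" "\<bar>t\<bar> \<le> \<delta>'"
    then have t: "\<bar>t\<bar> < d" by simp
    have "\<bar>v (x n, y + t) - x n * w (0, y + t)\<bar> \<le> C * x n ^ 2"
      using C(2)[OF inbox(1)[OF t], of n] x[of n] by simp
    then have "\<bar>v (x n, y + t) - x n * w (0, y + t)\<bar> / x n \<le> C * x n"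
      using x[of n] by (simp add: divide_le_eq power2_eq_square mult.assoc)
    moreover have "v (x n, y + t) / x n - w (0, y + t) = (v (x n, y + t) - x n * w (0, y + t)) / x n"
      using x[of n] by (simp add: diff_divide_distrib)
    ultimately show "norm (v (x n, y + t) / x n - w (0, y + t)) \<le> C * \<delta> * (1 / 2) ^ n * \<bar>t\<bar> ^ 0"
      using x(1)[of n] by (simp add: abs_divide x_def mult.assoc)
  qed (use C \<delta> in auto)
  have der: "((\<lambda>t. u (x n, y + t) / x n) has_vector_derivative q (x n, y + t) / x n) (at t)"
    if t: "\<bar>t\<bar> < d" for n t
  proof -
    have "((\<lambda>\<eta>. u (x n, \<eta>)) has_real_derivative q (x n, y + t)) (at (t + y))"
      using partial_snd[OF u[OF subsetD[OF M(2) inbox(1)[OF t]]]] by (simp add: add.commute)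
    then have "((\<lambda>t. u (x n, t + y)) has_real_derivative q (x n, y + t)) (at t)"
      by (simp only: DERIV_shift)
    from DERIV_cdivide[OF this, of "x n"]
    show ?thesis
      by (simp add: has_real_derivative_iff_has_vector_derivative add.commute)
  qed
  have "((\<lambda>t. p (0, y + t)) has_vector_derivative q1 (0, y + 0)) (at 0)"
    using geo_derivative[OF gen[OF C1] gen[OF C2] der, of 0] d by simp
  then have 1: "((\<lambda>t. p (0, t + y)) has_real_derivative q1 (0, y)) (at 0)"
    by (simp add: has_real_derivative_iff_has_vector_derivative add.commute)
  have "(0, y) \<in> M" using inbox(2)[of 0] d M(2) by auto
  from partial_snd[OF p(1)[OF this]] have "((\<lambda>t. p (0, t + y)) has_real_derivative p2 (0, y)) (at 0)"
    using DERIV_shift[of "\<lambda>\<eta>. p (0, \<eta>)" "p2 (0, y)" 0 y] by simp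
  from DERIV_unique[OF this 1] show ?thesis .
qed

text \<open>By symmetry of the second derivatives on the axis, the \<open>y\<close>-derivative of the remainder
  \<open>u - x * p (0, y)\<close> is the same remainder for \<open>q\<close>, which carries the induction.\<close>
lemma wbd_vanishing2:
  assumes M: "open M" "kbox \<delta> \<subseteq> M"
  shows "Ck_on (Suc (Suc k)) u M \<Longrightarrow> (\<And>z. z \<in> M \<Longrightarrow> fst z = 0 \<Longrightarrow> u z = 0) \<Longrightarrow>
    (\<And>z. z \<in> M \<Longrightarrow> (u has_derivative (\<lambda>h. fst h * p z + snd h * q z)) (at z)) \<Longrightarrow>
    \<exists>C\<ge>0. wbd (obox \<delta>) k 2 C (\<lambda>z. u z - fst z * p (0, snd z))"
proof (induction k arbitrary: u p q)
  case (0 u p q)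
  have p: "Ck_on 1 p M" using Ck_SucD[OF M(1) 0(1,3), of "(1, 0)"] by simp
  obtain C where C: "0 \<le> C" "\<And>z. z \<in> kbox \<delta> \<Longrightarrow> \<bar>u z - fst z * p (0, snd z)\<bar> \<le> C * \<bar>fst z\<bar> ^ 2"
    using vanishing_bound2[OF M 0(2,3) p] by blast
  have sub: "obox \<delta> \<subseteq> M" using M(2) obox_kbox by blast
  have "continuous_on (obox \<delta>) (\<lambda>z. p (0, snd z))"
  proof (rule continuous_on_compose2[OF Ck_continuous[OF M(1) p]])
    show "(\<lambda>z. (0, snd z)) ` obox \<delta> \<subseteq> M" using M(2) by force
  qed (intro continuous_intros)
  then have "continuous_on (obox \<delta>) (\<lambda>z. u z - fst z * p (0, snd z))"
    by (intro continuous_intros continuous_on_subset[OF Ck_continuous[OF M(1) 0(1)] sub])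
  moreover have "\<forall>z\<in>obox \<delta>. \<bar>u z - fst z * p (0, snd z)\<bar> \<le> C * \<bar>fst z\<bar> ^ 2"
    using C(2) subsetD[OF obox_kbox] by blast
  ultimately show ?case unfolding wbd.simps using C(1) by blast
next
  case (Suc k u p q)
  have p: "Ck_on (Suc (Suc k)) p M" using Ck_SucD[OF M(1) Suc.prems(1,3), of "(1, 0)"] by simp
  have q: "Ck_on (Suc (Suc k)) q M" using Ck_SucD[OF M(1) Suc.prems(1,3), of "(0, 1)"] by simp
  obtain p1 p2 where p': "\<And>z. z \<in> M \<Longrightarrow> (p has_derivative (\<lambda>h. fst h * p1 z + snd h * p2 z)) (at z)"
    using Ck_partials[OF M(1) p] by blast
  obtain q1 q2 where q': "\<And>z. z \<in> M \<Longrightarrow> (q has_derivative (\<lambda>h. fst h * q1 z + snd h * q2 z)) (at z)" "Ck_on (Suc k) q1 M"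
    using Ck_partials[OF M(1) q] by blast
  have p11: "Ck_on 1 p M" by (rule Ck_mono[OF M(1) p]) simp
  have q11: "Ck_on 1 q1 M" by (rule Ck_mono[OF M(1) q'(2)]) simp
  have comm: "p2 (0, y) = q1 (0, y)" if "\<bar>y\<bar> < \<delta>" for y
    by (rule partials_commute_on_axis[OF M Suc.prems(2,3) p' p11 q'(1) q11 that])
  have q0: "q z = 0" if "z \<in> M" "fst z = 0" for z
    by (rule partial_snd_vanishes[OF M(1) Suc.prems(2) Suc.prems(3)[OF that(1)] that])
  obtain C where C: "0 \<le> C" "\<And>z. z \<in> kbox \<delta> \<Longrightarrow> \<bar>u z - fst z * p (0, snd z)\<bar> \<le> C * \<bar>fst z\<bar> ^ 2"
    using vanishing_bound2[OF M Suc.prems(2,3) p11] by blast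
  \<comment> \<open>An open set on which the projection to the axis stays in \<open>M\<close>, so
    that \<open>p (0, snd z)\<close> is smooth there.\<close>
  define M' where "M' = M \<inter> (\<lambda>z. (0, snd z)) -` M"
  have M': "open M'" "kbox \<delta> \<subseteq> M'" "M' \<subseteq> M"
  proof -
    show "open M'" unfolding M'_def by (intro open_Int open_vimage M(1) continuous_intros)
    have "(0, snd z) \<in> kbox \<delta>" if "z \<in> kbox \<delta>" for z using that by (cases z) auto
    then show "kbox \<delta> \<subseteq> M'" unfolding M'_def using M(2) by blast
    show "M' \<subseteq> M" unfolding M'_def by blast
  qed
  have axis: "Ck_on (Suc k) (\<lambda>z. (0, snd z)) M'"
    by (intro Ck_Pair Ck_const Ck_snd Ck_ident M'(1))
  have pk: "Ck_on (Suc k) p M" by (rule Ck_mono[OF M(1) p]) simp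
  have "Ck_on (Suc k) (\<lambda>z. p (0, snd z)) M'"
    by (rule Ck_compose[OF M'(1) M(1) axis pk]) (simp add: M'_def)
  then have v: "Ck_on (Suc k) (\<lambda>z. p z - p (0, snd z)) M'"
    by (intro Ck_diff M'(1) Ck_subset[OF M'(1,3) pk])
  have "p z - p (0, snd z) = 0" if "fst z = 0" for z
    using that by (cases z) auto
  then obtain C1 where C1: "wbd (obox \<delta>) k 1 C1 (\<lambda>z. p z - p (0, snd z))"
    using wbd_vanishing1[OF M'(1,2) v] by blast
  obtain C2 where C2: "wbd (obox \<delta>) k 2 C2 (\<lambda>z. q z - fst z * q1 (0, snd z))"
    using Suc.IH[OF q q0 q'(1)] by blast
  define B where "B = max C (max C1 C2)"
  have B: "C \<le> B" "C1 \<le> B" "C2 \<le> B" by (auto simp: B_def)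
  have "wbd (obox \<delta>) (Suc k) 2 B (\<lambda>z. u z - fst z * p (0, snd z))"
  proof (rule wbd_SucI[where p="\<lambda>z. p z - p (0, snd z)" and q="\<lambda>z. q z - fst z * q1 (0, snd z)"])
    fix z assume z: "z \<in> obox \<delta>"
    show "\<bar>u z - fst z * p (0, snd z)\<bar> \<le> B * \<bar>fst z\<bar> ^ 2"
      using C(2)[OF subsetD[OF obox_kbox z]] mult_right_mono[OF B(1), of "\<bar>fst z\<bar> ^ 2"] by simp
    have zM: "z \<in> M" "(0, snd z) \<in> M" using z M(2) by auto
    have "((\<lambda>z. (0::real, snd z)) has_derivative (\<lambda>h. (0, snd h))) (at z)"
      by (auto intro!: derivative_eq_intros)
    from has_derivative_compose[OF this p'[OF zM(2)]]
    have "((\<lambda>z. p (0, snd z)) has_derivative (\<lambda>h. snd h * p2 (0, snd z))) (at z)" by simp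
    from has_derivative_diff[OF Suc.prems(3)[OF zM(1)] has_derivative_mult[OF has_derivative_fst[OF has_derivative_ident] this]]
    show "((\<lambda>z. u z - fst z * p (0, snd z)) has_derivative
        (\<lambda>h. fst h * (p z - p (0, snd z)) + snd h * (q z - fst z * q1 (0, snd z)))) (at z)"
    proof (rule has_derivative_eq_rhs)
      have "p2 (0, snd z) = q1 (0, snd z)" using comm z by (auto simp: abs_less_iff)
      then show "(\<lambda>h. fst h * p z + snd h * q z - (fst z * (snd h * p2 (0, snd z)) + fst h * p (0, snd z))) =
          (\<lambda>h. fst h * (p z - p (0, snd z)) + snd h * (q z - fst z * q1 (0, snd z)))"
        by (intro ext) (simp add: algebra_simps)
    qed
  qed (use wbd_le[OF C1 B(2)] wbd_le[OF C2 B(3)] in simp_all)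
  moreover have "0 \<le> B" using B(1) C(1) by simp
  ultimately show ?case by blast
qed

section \<open>Rescaling and cutting off\<close>

lemma scale_obox: "0 < r \<Longrightarrow> r \<le> \<delta> \<Longrightarrow> z \<in> obox 1 \<Longrightarrow> r *\<^sub>R z \<in> obox \<delta>"
proof -
  assume r: "0 < r" "r \<le> \<delta>" and z: "z \<in> obox 1"
  have "\<bar>r * x\<bar> < \<delta>" if "\<bar>x\<bar> < 1" for x
  proof -
    have "r * \<bar>x\<bar> < r * 1" by (rule mult_strict_left_mono[OF that r(1)])
    moreover have "\<bar>r * x\<bar> = r * \<bar>x\<bar>" using r by (simp add: abs_mult)
    ultimately show ?thesis using r by linarith
  qed
  from this[of "fst z"] this[of "snd z"] z show ?thesis by (auto simp: mem_Times_iff abs_less_iff)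
qed

lemma has_derivative_scale:
  fixes u :: "real \<times> real \<Rightarrow> real"
  assumes "(u has_derivative (\<lambda>h. fst h * p + snd h * q)) (at (r *\<^sub>R z))"
  shows "((\<lambda>z. u (r *\<^sub>R z)) has_derivative (\<lambda>h. fst h * (r * p) + snd h * (r * q))) (at z)"
proof -
  have "((\<lambda>z. r *\<^sub>R z) has_derivative (\<lambda>h. r *\<^sub>R h)) (at z)"
    by (auto intro!: derivative_eq_intros)
  from has_derivative_compose[OF this assms] show ?thesis
    by (rule has_derivative_eq_rhs) (auto simp: algebra_simps)
qed

lemma wbd_scale_bound:
  assumes "wbd (obox \<delta>) k w C u" "0 < r" "r \<le> \<delta>" "z \<in> obox 1"
  shows "\<bar>u (r *\<^sub>R z)\<bar> \<le> C * (r ^ w * \<bar>fst z\<bar> ^ w)"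
  using wbd_bound[OF assms(1) scale_obox[OF assms(2-4)]] assms(2) by (simp add: abs_mult power_mult_distrib)

lemma wbd_scale:
  assumes r: "0 < r" "r \<le> \<delta>" "r \<le> 1" and C: "0 \<le> C"
  shows "wbd (obox \<delta>) k w C u \<Longrightarrow> wbd (obox 1) k w C (\<lambda>z. u (r *\<^sub>R z))"
proof (induction k arbitrary: u w)
  have b: "\<bar>u (r *\<^sub>R z)\<bar> \<le> C * \<bar>fst z\<bar> ^ w" if "wbd (obox \<delta>) k w C u" "z \<in> obox 1" for k w u z
  proof -
    have "C * (r ^ w * \<bar>fst z\<bar> ^ w) \<le> C * (1 * \<bar>fst z\<bar> ^ w)"
      using C r by (intro mult_left_mono mult_right_mono power_le_one) auto
    then show ?thesis using wbd_scale_bound[OF that(1) r(1,2) that(2)] by simp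
  qed
  {
    case 0
    have "continuous_on (obox 1) (\<lambda>z. u (r *\<^sub>R z))"
      by (rule continuous_on_compose2[OF wbd_continuous[OF 0]])
        (use scale_obox[OF r(1,2)] in \<open>auto intro!: continuous_intros\<close>)
    then show ?case using b[OF 0] unfolding wbd.simps by blast
  next
    case (Suc k)
    obtain p q where pq: "\<And>z. z \<in> obox \<delta> \<Longrightarrow> (u has_derivative (\<lambda>h. fst h * p z + snd h * q z)) (at z)"
      "wbd (obox \<delta>) k (w - 1) C p" "wbd (obox \<delta>) k w C q"
      using wbd_SucE Suc.prems by blast
    have rC: "\<bar>r\<bar> * C \<le> C" using r C by (simp add: mult_left_le_one_le)
    show ?case
      by (rule wbd_SucI[OF b[OF Suc.prems] has_derivative_scale[OF pq(1)[OF scale_obox[OF r(1,2)]]]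
            wbd_le[OF wbd_cmult[OF Suc.IH[OF pq(2)]] rC] wbd_le[OF wbd_cmult[OF Suc.IH[OF pq(3)]] rC]])
  }
qed

text \<open>The partial derivatives acquire a factor \<open>r\<close> from the chain rule, and the
  function itself acquires one from its positive weight.\<close>

lemma wbd_scale_gain:
  assumes r: "0 < r" "r \<le> \<delta>" "r \<le> 1" and C: "0 \<le> C" and u: "wbd (obox \<delta>) (Suc k) (Suc w) C u"
  shows "wbd (obox 1) (Suc k) (Suc w) (r * C) (\<lambda>z. u (r *\<^sub>R z))"
proof -
  obtain p q where pq: "\<And>z. z \<in> obox \<delta> \<Longrightarrow> (u has_derivative (\<lambda>h. fst h * p z + snd h * q z)) (at z)"
    "wbd (obox \<delta>) k (Suc w - 1) C p" "wbd (obox \<delta>) k (Suc w) C q"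
    using wbd_SucE u by blast
  have ar: "\<bar>r\<bar> * C \<le> r * C" using r by simp
  show ?thesis
  proof (rule wbd_SucI[OF _ has_derivative_scale[OF pq(1)[OF scale_obox[OF r(1,2)]]]
        wbd_le[OF wbd_cmult[OF wbd_scale[OF r C pq(2)]] ar] wbd_le[OF wbd_cmult[OF wbd_scale[OF r C pq(3)]] ar]])
    fix z assume z: "z \<in> obox 1"
    have "\<bar>u (r *\<^sub>R z)\<bar> \<le> C * (r ^ Suc w * \<bar>fst z\<bar> ^ Suc w)"
      by (rule wbd_scale_bound[OF u r(1,2) z])
    also have "\<dots> \<le> C * (r * \<bar>fst z\<bar> ^ Suc w)"
      using C r power_decreasing[of 1 "Suc w" r] by (intro mult_left_mono mult_right_mono) auto
    finally show "\<bar>u (r *\<^sub>R z)\<bar> \<le> r * C * \<bar>fst z\<bar> ^ Suc w" by (simp add: mult_ac)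
  qed
qed

text \<open>Without positive weight the function itself owes its factor \<open>r\<close> to
  \<open>u 0 = 0\<close>: the origin is reached along one segment in \<open>x\<close> and one in
  \<open>y\<close>, whence the 2.\<close>

lemma wbd_scale_small:
  assumes r: "0 < r" "r \<le> \<delta>" "r \<le> 1" and C: "0 \<le> C" and u: "wbd (obox \<delta>) (Suc k) 0 C u" "u 0 = 0"
  shows "wbd (obox 1) (Suc k) 0 (2 * r * C) (\<lambda>z. u (r *\<^sub>R z))"
proof -
  obtain p q where pq: "\<And>z. z \<in> obox \<delta> \<Longrightarrow> (u has_derivative (\<lambda>h. fst h * p z + snd h * q z)) (at z)"
    "wbd (obox \<delta>) k (0 - 1) C p" "wbd (obox \<delta>) k 0 C q"
    using wbd_SucE u(1) by blast
  have ar: "\<bar>r\<bar> * C \<le> 2 * r * C" using r C by simp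
  note der = has_derivative_scale[OF pq(1)[OF scale_obox[OF r(1,2)]]]
  have pb: "\<bar>r * p (r *\<^sub>R z)\<bar> \<le> r * C" "\<bar>r * q (r *\<^sub>R z)\<bar> \<le> r * C" if "z \<in> obox 1" for z
    using wbd_bound[OF pq(2) scale_obox[OF r(1,2) that]] wbd_bound[OF pq(3) scale_obox[OF r(1,2) that]] r
    by (simp_all add: abs_mult)
  show ?thesis
  proof (rule wbd_SucI[OF _ der
        wbd_le[OF wbd_cmult[OF wbd_scale[OF r C pq(2)]] ar] wbd_le[OF wbd_cmult[OF wbd_scale[OF r C pq(3)]] ar]])
    fix z assume z: "z \<in> obox 1"
    obtain x y where xy: "z = (x, y)" by (cases z)
    have seg: "(\<xi>, y) \<in> obox 1" if "\<bar>\<xi>\<bar> \<le> \<bar>x\<bar>" for \<xi> using z that by (auto simp: xy)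
    have seg0: "(0, \<eta>) \<in> obox 1" if "\<bar>\<eta>\<bar> \<le> \<bar>y\<bar>" for \<eta> using z that by (auto simp: xy)
    have "\<bar>u (r *\<^sub>R (x, y)) - u (r *\<^sub>R (0, y))\<bar> \<le> r * C * \<bar>x\<bar>"
      by (rule real_mvt_bound[where u="\<lambda>\<xi>. u (r *\<^sub>R (\<xi>, y))" and v="\<lambda>\<xi>. r * p (r *\<^sub>R (\<xi>, y))",
          OF partial_fst[OF der[OF seg]] pb(1)[OF seg]])
    also have "\<dots> \<le> r * C * 1" using z r C by (intro mult_left_mono) (auto simp: xy)
    finally have 1: "\<bar>u (r *\<^sub>R (x, y)) - u (r *\<^sub>R (0, y))\<bar> \<le> r * C" by simp
    have "\<bar>u (r *\<^sub>R (0, y)) - u (r *\<^sub>R (0, 0))\<bar> \<le> r * C * \<bar>y\<bar>"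
      by (rule real_mvt_bound[where u="\<lambda>\<eta>. u (r *\<^sub>R (0, \<eta>))" and v="\<lambda>\<eta>. r * q (r *\<^sub>R (0, \<eta>))",
          OF partial_snd[OF der[OF seg0]] pb(2)[OF seg0]])
    also have "\<dots> \<le> r * C * 1" using z r C by (intro mult_left_mono) (auto simp: xy)
    finally have 2: "\<bar>u (r *\<^sub>R (0, y)) - u (r *\<^sub>R (0, 0))\<bar> \<le> r * C" by simp
    have "u (r *\<^sub>R (0, 0)) = 0" using u(2) by (simp add: zero_prod_def)
    then show "\<bar>u (r *\<^sub>R z)\<bar> \<le> 2 * r * C * \<bar>fst z\<bar> ^ 0" using 1 2 by (simp add: xy)
  qed
qed

text \<open>\<open>u (r z) / r\<close> is the nonlinear part of a map conjugated by the dilation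
  \<open>r\<close>. Division by \<open>r\<close> cancels the gain in the first derivatives, so their
  smallness has to come from \<open>p\<close> vanishing at 0 and \<open>q\<close> vanishing on the
  axis.\<close>

lemma wbd_rescaled_nonlinearity:
  assumes r: "0 < r" "r \<le> \<delta>" "r \<le> 1" and C: "0 \<le> C" and u: "wbd (obox \<delta>) (Suc (Suc k)) 1 C u"
    and u0: "(u has_derivative (\<lambda>h. 0)) (at 0)"
  shows "wbd (obox 1) (Suc (Suc k)) 1 (2 * r * C) (\<lambda>z. u (r *\<^sub>R z) / r)"
proof -
  obtain p q where pq: "\<And>z. z \<in> obox \<delta> \<Longrightarrow> (u has_derivative (\<lambda>h. fst h * p z + snd h * q z)) (at z)"
    "wbd (obox \<delta>) (Suc k) (1 - 1) C p" "wbd (obox \<delta>) (Suc k) 1 C q"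
    using wbd_SucE u by blast
  have "0 \<in> obox \<delta>" using r by (auto simp: zero_prod_def)
  from has_derivative_unique[OF pq(1)[OF this] u0] have p0: "p 0 = 0"
    by (metis fst_conv snd_conv mult_1 mult_zero_left add_0_right)
  have P: "wbd (obox 1) (Suc k) 0 (2 * r * C) (\<lambda>z. p (r *\<^sub>R z))"
    by (rule wbd_scale_small[OF r C pq(2)[simplified diff_self_eq_0] p0])
  have Q: "wbd (obox 1) (Suc k) 1 (2 * r * C) (\<lambda>z. q (r *\<^sub>R z))"
    using wbd_le[OF wbd_scale_gain[OF r C, of k 0 q], of "2 * r * C"] pq(3) r C by (simp del: wbd.simps)
  have der: "((\<lambda>z. u (r *\<^sub>R z) / r) has_derivative (\<lambda>h. fst h * p (r *\<^sub>R z) + snd h * q (r *\<^sub>R z))) (at z)"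
    if "z \<in> obox 1" for z
    using has_derivative_mult_left[OF has_derivative_scale[OF pq(1)[OF scale_obox[OF r(1,2) that]]], of "1 / r"] r(1)
    by (simp add: algebra_simps)
  show ?thesis
  proof (rule wbd_SucI[OF _ der _ Q])
    show "wbd (obox 1) (Suc k) (1 - 1) (2 * r * C) (\<lambda>z. p (r *\<^sub>R z))" using P by simp
    fix z assume z: "z \<in> obox 1"
    obtain x y where xy: "z = (x, y)" by (cases z)
    have seg: "(\<xi>, y) \<in> obox 1" if "\<bar>\<xi>\<bar> \<le> \<bar>x\<bar>" for \<xi> using z that by (auto simp: xy)
    have b: "\<bar>p (r *\<^sub>R z)\<bar> \<le> 2 * r * C" if "z \<in> obox 1" for z using wbd_bound[OF P that] by simp
    have "\<bar>u (r *\<^sub>R (x, y)) / r - u (r *\<^sub>R (0, y)) / r\<bar> \<le> 2 * r * C * \<bar>x\<bar>"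
      by (rule real_mvt_bound[where u="\<lambda>\<xi>. u (r *\<^sub>R (\<xi>, y)) / r" and v="\<lambda>\<xi>. p (r *\<^sub>R (\<xi>, y))",
          OF partial_fst[OF der[OF seg]] b[OF seg]])
    moreover have "u (r *\<^sub>R (0, y)) = 0"
      using wbd_bound[OF u scale_obox[OF r(1,2) seg[of 0]]] by simp
    ultimately show "\<bar>u (r *\<^sub>R z) / r\<bar> \<le> 2 * r * C * \<bar>fst z\<bar> ^ 1" by (simp add: xy)
  qed
qed

section \<open>Extension by zero and cut-off functions\<close>

lemma wbd_extend:
  assumes U: "open U" "closed K" "K \<subseteq> U" and M: "0 \<le> M"
  shows "wbd U k w M u \<Longrightarrow> (\<And>z. z \<in> U - K \<Longrightarrow> u z = 0) \<Longrightarrow> wbd UNIV k w M (\<lambda>z. if z \<in> U then u z else 0)"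
proof (induction k arbitrary: u w)
  have b: "\<bar>if z \<in> U then u z else 0\<bar> \<le> M * \<bar>fst z\<bar> ^ w" if "wbd U k w M u" for k w u z
    using wbd_bound[OF that, of z] M by auto
  have op: "open (- K)" using U(2) by auto
  {
    case 0
    have "isCont (\<lambda>z. if z \<in> U then u z else 0) z" for z
    proof (cases "z \<in> U")
      case True
      have "isCont u z" using wbd_continuous[OF 0(1)] U(1) True by (simp add: continuous_on_eq_continuous_at)
      moreover have "\<forall>\<^sub>F x in nhds z. (if x \<in> U then u x else 0) = u x"
        using eventually_nhds_in_open[OF U(1) True] by eventually_elim simp
      ultimately show ?thesis by (simp add: isCont_cong)
    next
      case False
      then have "z \<in> - K" using U(3) by auto
      from eventually_nhds_in_open[OF op this]
      have "\<forall>\<^sub>F x in nhds z. (if x \<in> U then u x else 0) = 0"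
        by eventually_elim (use 0(2) in auto)
      then show ?thesis by (simp add: isCont_cong)
    qed
    then show ?case using b[OF 0(1)] by (simp add: continuous_on_eq_continuous_at)
  next
    case (Suc k)
    obtain p q where pq: "\<And>z. z \<in> U \<Longrightarrow> (u has_derivative (\<lambda>h. fst h * p z + snd h * q z)) (at z)"
      "wbd U k (w - 1) M p" "wbd U k w M q"
      using wbd_SucE Suc.prems(1) by blast
    \<comment> \<open>Where a function vanishes on an open set its partial derivatives vanish too,
      so the support hypothesis passes to \<open>p\<close> and \<open>q\<close>.\<close>
    have zero: "p z = 0 \<and> q z = 0" if z: "z \<in> U - K" for z
    proof -
      have "((\<lambda>z. 0) has_derivative (\<lambda>h. fst h * p z + snd h * q z)) (at z)"
        by (rule has_derivative_transform_within_open[OF pq(1) _ z]) (use z U Suc.prems(2) in auto)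
      from has_derivative_unique[OF this has_derivative_const]
      have "(\<lambda>h. fst h * p z + snd h * q z) = (\<lambda>h. 0)" .
      from fun_cong[OF this, of "(1, 0)"] fun_cong[OF this, of "(0, 1)"] show ?thesis by simp
    qed
    show ?case
    proof (rule wbd_SucI[OF b[OF Suc.prems(1)] _ Suc.IH[OF pq(2)] Suc.IH[OF pq(3)]])
      fix z
      show "((\<lambda>z. if z \<in> U then u z else 0) has_derivative
          (\<lambda>h. fst h * (if z \<in> U then p z else 0) + snd h * (if z \<in> U then q z else 0))) (at z)"
      proof (cases "z \<in> U")
        case True
        then show ?thesis
          using has_derivative_transform_within_open[OF pq(1)[OF True] U(1) True, of "\<lambda>z. if z \<in> U then u z else 0"] by simp
      next
        case False
        then have "z \<in> - K" using U by auto
        have "((\<lambda>z. if z \<in> U then u z else 0) has_derivative (\<lambda>h. 0)) (at z)"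
          by (rule has_derivative_transform_within_open[OF has_derivative_const op \<open>z \<in> - K\<close>])
            (use Suc.prems(2) in auto)
        then show ?thesis using False by simp
      qed
    qed (use zero in auto)
  }
qed

text \<open>The cut-off needs only finitely many derivatives, so truncated powers can take the place
  of a smooth bump function.\<close>

lemma Ck_max_power: "Ck_on n (\<lambda>t::real. max 0 t ^ Suc n) UNIV"
proof (induction n)
  case 0
  then show ?case by (auto intro!: continuous_intros)
next
  case (Suc n)
  show ?case
  proof (rule Ck_vector_derivativeI[OF open_UNIV])
    show "Ck_on n (\<lambda>t::real. (2 + real n) * max 0 t ^ Suc n) UNIV"
      by (rule Ck_mult[OF open_UNIV Ck_const[OF open_UNIV] Suc.IH])
    fix t :: real
    have "((\<lambda>t. max 0 t ^ Suc (Suc n)) has_real_derivative (2 + real n) * max 0 t ^ Suc n) (at t)"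
    proof -
      consider "t < 0" | "0 < t" | "t = 0" by linarith
      then show ?thesis
      proof cases
        case 1
        have "((\<lambda>t. 0) has_real_derivative (2 + real n) * max 0 t ^ Suc n) (at t)" using 1 by simp
        then show ?thesis
          by (rule has_field_derivative_transform_within_open[where S="{..<0}"]) (use 1 in auto)
      next
        case 2
        have "((\<lambda>t. t ^ Suc (Suc n)) has_real_derivative (2 + real n) * max 0 t ^ Suc n) (at t)"
          using DERIV_pow[of "Suc (Suc n)" t] 2 by (simp add: add.commute)
        then show ?thesis
          by (rule has_field_derivative_transform_within_open[where S="{0<..}"]) (use 2 in auto)
      next
        case 3
        have "isCont (\<lambda>h::real. max 0 h ^ Suc n) 0" by (intro continuous_intros)
        then have "((\<lambda>h::real. max 0 h ^ Suc n) \<longlongrightarrow> 0) (at 0)" by (simp add: isCont_def)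
        moreover have "\<forall>\<^sub>F h in at 0. max 0 h ^ Suc n = (max 0 (0 + h) ^ Suc (Suc n) - max 0 0 ^ Suc (Suc n)) / (h::real)"
          unfolding eventually_at_filter by (rule always_eventually) (auto simp: max_def)
        ultimately have "((\<lambda>h::real. (max 0 (0 + h) ^ Suc (Suc n) - max 0 0 ^ Suc (Suc n)) / h) \<longlongrightarrow> 0) (at 0)"
          by (rule Lim_transform_eventually)
        then show ?thesis unfolding 3 DERIV_def by simp
      qed
    qed
    then show "((\<lambda>t. max 0 t ^ Suc (Suc n)) has_vector_derivative (2 + real n) * max 0 t ^ Suc n) (at t)"
      by (simp only: has_real_derivative_iff_has_vector_derivative)
  qed
qed

lemma Ck_cutoff_exists:
  "\<exists>\<eta> :: real \<times> real \<Rightarrow> real. Ck_on k \<eta> UNIV \<and> (\<forall>z\<in>kbox (1/3). \<eta> z = 1) \<and>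
    (\<forall>z. z \<notin> obox (2/3) \<longrightarrow> \<eta> z = 0)"
proof -
  define m where "m t = max 0 t ^ Suc k" for t :: real
  \<comment> \<open>\<open>t \<mapsto> m (1 - m t)\<close> is \<open>1\<close> for \<open>t \<le> 0\<close> and \<open>0\<close> for \<open>t \<ge> 1\<close>\<close>
  define c where "c x = m (1 - m (3 * x\<^sup>2 - 1/3))" for x :: real
  have mC: "Ck_on k m UNIV" unfolding m_def by (rule Ck_max_power)
  have mz: "m t = 0" if "t \<le> 0" for t using that by (simp add: m_def)
  have m11: "m 1 = 1" by (simp add: m_def)
  have m1: "1 \<le> m t" if "1 \<le> t" for t using that one_le_power[of t "Suc k"] by (simp add: m_def max_def)
  have "Ck_on k (\<lambda>x. m (3 * x\<^sup>2 - 1/3)) UNIV"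
    by (rule Ck_compose[OF _ _ _ mC]) (auto intro!: Ck_intros)
  then have "Ck_on k (\<lambda>x. 1 - m (3 * x\<^sup>2 - 1/3)) UNIV"
    by (rule Ck_diff[OF open_UNIV Ck_const[OF open_UNIV]])
  then have cC: "Ck_on k c UNIV"
    unfolding c_def by (rule Ck_compose[OF open_UNIV open_UNIV _ mC]) simp
  \<comment> \<open>\<open>3 * x\<^sup>2 - 1/3\<close> grows from 0 at
    \<open>\<bar>x\<bar> = 1/3\<close> to 1 at \<open>\<bar>x\<bar> = 2/3\<close>.\<close>
  have c1: "c x = 1" if "\<bar>x\<bar> \<le> 1/3" for x
  proof -
    have "x\<^sup>2 \<le> (1/3)\<^sup>2" using that by (intro abs_le_square_iff[THEN iffD1]) simp
    then have "m (3 * x\<^sup>2 - 1/3) = 0" by (intro mz) (simp add: power2_eq_square)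
    then show ?thesis by (simp add: c_def m11)
  qed
  have c0: "c x = 0" if "2/3 \<le> \<bar>x\<bar>" for x
  proof -
    have "(2/3)\<^sup>2 \<le> x\<^sup>2" using that by (intro abs_le_square_iff[THEN iffD1]) simp
    then have "1 \<le> m (3 * x\<^sup>2 - 1/3)" by (intro m1) (simp add: power2_eq_square)
    then show ?thesis by (simp add: c_def mz)
  qed
  show ?thesis
  proof (intro exI[of _ "\<lambda>z. c (fst z) * c (snd z)"] conjI ballI allI impI)
    show "Ck_on k (\<lambda>z. c (fst z) * c (snd z)) UNIV"
      by (rule Ck_mult[OF open_UNIV Ck_compose[OF open_UNIV open_UNIV Ck_fst[OF open_UNIV Ck_ident[OF open_UNIV]] cC]
            Ck_compose[OF open_UNIV open_UNIV Ck_snd[OF open_UNIV Ck_ident[OF open_UNIV]] cC]]) auto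
    show "c (fst z) * c (snd z) = 1" if "z \<in> kbox (1/3)" for z
      using that c1 by (cases z) (auto simp: abs_le_iff)
    show "c (fst z) * c (snd z) = 0" if "z \<notin> obox (2/3)" for z
    proof -
      have "2/3 \<le> \<bar>fst z\<bar> \<or> 2/3 \<le> \<bar>snd z\<bar>" using that by (cases z) (auto simp: abs_real_def)
      then show ?thesis using c0 by auto
    qed
  qed
qed

section \<open>Linearization when the unstable manifold is straight\<close>

lemma kbox_in_open:
  assumes "open M" "0 \<in> M"
  obtains \<delta> where "0 < \<delta>" "kbox \<delta> \<subseteq> M"
proof -
  obtain e where e: "0 < e" "ball 0 e \<subseteq> M" using assms open_contains_ball by metis
  have "kbox (e / 3) \<subseteq> ball 0 e"
  proof
    fix z assume z: "z \<in> kbox (e / 3)"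
    have "norm z \<le> \<bar>fst z\<bar> + \<bar>snd z\<bar>" using norm_Pair_le[of "fst z" "snd z"] by simp
    moreover have "\<bar>fst z\<bar> \<le> e / 3" "\<bar>snd z\<bar> \<le> e / 3" using z by (auto simp: mem_Times_iff)
    ultimately show "z \<in> ball 0 e" using e(1) by simp
  qed
  with e that[of "e / 3"] show ?thesis by auto
qed

lemma kbox_mono: "\<delta>' \<le> \<delta> \<Longrightarrow> kbox \<delta>' \<subseteq> kbox \<delta>"
  by (intro Sigma_mono) auto

text \<open>With \<open>t = s * y\<close> the equation becomes
  \<open>a t = l / b (t / s) * a (t / s)\<close>, whose coefficient is 1 at 0. So the constant 1
  solves it up to order 1, and near 0 the coefficient stays below some
  \<open>\<theta> < \<bar>s\<bar>\<close>, as iteration with weight \<open>p = 1\<close>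
  requires.\<close>

lemma normal_bundle_linearization:
  fixes b :: "real \<Rightarrow> real"
  assumes \<delta>: "0 < \<delta>" and b: "Ck_on (Suc k) b {-\<delta><..<\<delta>}" "b 0 = l" and l: "l \<noteq> 0" and s: "1 < \<bar>s\<bar>"
  shows "\<exists>d a. 0 < d \<and> d \<le> \<delta> \<and> Ck_on (Suc k) a {-d<..<d} \<and> a 0 = 1 \<and>
    (\<forall>y. \<bar>s * y\<bar> < d \<longrightarrow> a (s * y) * b y = l * a y)"
proof -
  define \<theta> where "\<theta> = (1 + \<bar>s\<bar>) / 2"
  have th: "1 < \<theta>" "\<theta> < \<bar>s\<bar>" using s by (auto simp: \<theta>_def)
  have "isCont b 0"
    using Ck_continuous[OF open_greaterThanLessThan b(1)] \<delta> by (auto simp: continuous_on_eq_continuous_at)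
  then have bn: "(b \<longlongrightarrow> b 0) (nhds 0)" by (simp add: isCont_def tendsto_at_iff_tendsto_nhds)
  have b0: "b 0 \<noteq> 0" using b(2) l by simp
  have "((\<lambda>t. \<bar>l / b t\<bar>) \<longlongrightarrow> \<bar>l / b 0\<bar>) (nhds 0)"
    by (rule tendsto_rabs[OF tendsto_divide[OF tendsto_const bn b0]])
  then have "\<forall>\<^sub>F t in nhds 0. \<bar>l / b t\<bar> < \<theta>"
    using th(1) l b(2) by (intro order_tendstoD(2)) auto
  moreover have "\<forall>\<^sub>F t in nhds 0. b t \<noteq> 0"
    using bn b(2) l by (intro tendsto_imp_eventually_ne) auto
  ultimately have "\<forall>\<^sub>F t in nhds 0. \<bar>l / b t\<bar> < \<theta> \<and> b t \<noteq> 0" by eventually_elim simp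
  then obtain e where e: "0 < e" "\<And>t. \<bar>t\<bar> < e \<Longrightarrow> \<bar>l / b t\<bar> < \<theta> \<and> b t \<noteq> 0"
    by (auto simp: eventually_nhds_metric dist_real_def)
  define d where "d = min e \<delta>"
  have d: "0 < d" "d \<le> \<delta>" "d \<le> e" using e \<delta> by (auto simp: d_def)
  interpret dilation s d by unfold_locales (rule s)
  have tdI: "\<bar>t / s\<bar> < d" if "t \<in> I" for t
    using abs_divide_le_abs[OF s1, of t] that unfolding I_iff by linarith
  have bne: "b (t / s) \<noteq> 0" and ble: "\<bar>l / b (t / s)\<bar> \<le> \<theta>" if "t \<in> I" for t
    using e(2)[of "t / s"] tdI[OF that] d(3) by auto
  have bC: "Ck_on (Suc k) b I"
    by (rule Ck_subset[OF open_greaterThanLessThan _ b(1)]) (use d in auto)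
  have BC: "Ck_on (Suc k) (\<lambda>t. l / b (t / s) * w) I" for w
    by (rule Ck_mult[OF open_greaterThanLessThan Ck_divide[OF open_greaterThanLessThan Ck_const[OF open_greaterThanLessThan]
            Ck_rescale[OF bC] bne] Ck_const[OF open_greaterThanLessThan]])
  have lin: "linear (\<lambda>w. l / b (t / s) * w)" for t
    by (intro linearI) (auto simp: algebra_simps add_divide_distrib)
  have bd: "norm (l / b (t / s) * x) \<le> \<theta> * norm x" if "t \<in> I" for t x
    using mult_right_mono[OF ble[OF that], of "\<bar>x\<bar>"] by (simp add: abs_mult)
  have x0: "\<exists>K. \<forall>t. \<bar>t\<bar> \<le> \<delta>' \<longrightarrow> norm (l / b (t / s) * 1 + 0 - 1) \<le> K * \<bar>t\<bar> ^ 1" if "\<delta>' < d" for \<delta>'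
    unfolding power_one_right
  proof (rule vanishing_linear_bound[OF _ _ that])
    have "Ck_on 1 (\<lambda>t. l / b (t / s) * 1) I" by (rule Ck_mono[OF open_greaterThanLessThan BC]) simp
    then show "Ck_on 1 (\<lambda>t. l / b (t / s) * 1 + 0 - 1) I"
      by (intro Ck_diff Ck_add Ck_const open_greaterThanLessThan)
  qed (use b(2) l in simp)
  have th0: "0 \<le> \<theta>" "\<theta> < \<bar>s\<bar> ^ 1" using th by auto
  obtain a where a: "continuous_on I a" "\<And>t. t \<in> I \<Longrightarrow> a t = l / b (t / s) * a (t / s) + 0"
    "\<And>\<delta>'. \<delta>' < d \<Longrightarrow> \<exists>K. \<forall>t. \<bar>t\<bar> \<le> \<delta>' \<longrightarrow> norm (a t - 1) \<le> K * \<bar>t\<bar> ^ 1"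
    using iteration_solution[OF lin bd th0 Ck_continuous[OF open_greaterThanLessThan BC] continuous_on_const x0] by metis
  have a3: "\<exists>K. \<forall>t. \<bar>t\<bar> \<le> \<delta>' \<longrightarrow> norm (a t - 1) \<le> K * \<bar>t\<bar>" if "\<delta>' < d" for \<delta>'
    using a(3)[OF that] by simp
  have aC: "Ck_on (Suc k) a I"
    by (rule solution_smooth[OF lin bd th0(1) th(2) a(1,2) a3 BC Ck_const[OF open_greaterThanLessThan]])
  have a0: "a 0 = 1" using a(3)[OF d(1)] by auto
  have "a (s * y) * b y = l * a y" if "\<bar>s * y\<bar> < d" for y
  proof -
    have yI: "s * y \<in> I" using that unfolding I_iff .
    show ?thesis using a(2)[OF yI] bne[OF yI] s0 by simp
  qed
  with d(1,2) aC a0 show ?thesis by blast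
qed

text \<open>For \<open>\<epsilon> = 0\<close> the inequalities reduce to
  \<open>\<bar>l\<bar> < 1\<close>,
  \<open>\<bar>l\<bar> ^ 2 * \<bar>s\<bar> ^ k < \<bar>l\<bar>\<close> and
  \<open>\<bar>l\<bar> * \<bar>s\<bar> ^ k < \<bar>s\<bar>\<close>. They are strict and hence
  persist for small \<open>\<epsilon>\<close>.\<close>

lemma spectral_gap:
  fixes l s D :: real
  assumes "l \<noteq> 0" "\<bar>l\<bar> < 1" "1 < \<bar>s\<bar>" "\<bar>l\<bar> * \<bar>s\<bar> ^ k < 1"
  obtains \<epsilon> where "0 < \<epsilon>" "\<bar>l\<bar> + D * \<epsilon> \<le> 1"
    "(\<bar>l\<bar> + D * \<epsilon>) ^ 2 * (\<bar>s\<bar> + D * \<epsilon> * (1 + 1 / \<bar>l\<bar>)) ^ k < \<bar>l\<bar>"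
    "(\<bar>l\<bar> + D * \<epsilon>) ^ 1 * (\<bar>s\<bar> + D * \<epsilon> * (1 + 1 / \<bar>l\<bar>)) ^ k < \<bar>s\<bar>"
proof -
  have "((\<lambda>\<epsilon>. \<bar>l\<bar> + D * \<epsilon>) \<longlongrightarrow> \<bar>l\<bar> + D * 0) (at_right 0)" by (intro tendsto_intros)
  then have 1: "\<forall>\<^sub>F \<epsilon> in at_right 0. \<bar>l\<bar> + D * \<epsilon> < 1"
    using assms(2) by (intro order_tendstoD(2)) auto
  have "((\<lambda>\<epsilon>. (\<bar>l\<bar> + D * \<epsilon>) ^ 2 * (\<bar>s\<bar> + D * \<epsilon> * (1 + 1 / \<bar>l\<bar>)) ^ k) \<longlongrightarrow>
      (\<bar>l\<bar> + D * 0) ^ 2 * (\<bar>s\<bar> + D * 0 * (1 + 1 / \<bar>l\<bar>)) ^ k) (at_right 0)" by (intro tendsto_intros)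
  moreover have "\<bar>l\<bar> ^ 2 * \<bar>s\<bar> ^ k < \<bar>l\<bar>"
  proof -
    have "\<bar>l\<bar> * (\<bar>l\<bar> * \<bar>s\<bar> ^ k) < \<bar>l\<bar> * 1"
      using assms(1,4) by (intro mult_strict_left_mono) auto
    then show ?thesis unfolding power2_eq_square mult.assoc mult_1_right .
  qed
  ultimately have 2: "\<forall>\<^sub>F \<epsilon> in at_right 0. (\<bar>l\<bar> + D * \<epsilon>) ^ 2 * (\<bar>s\<bar> + D * \<epsilon> * (1 + 1 / \<bar>l\<bar>)) ^ k < \<bar>l\<bar>"
    by (intro order_tendstoD(2)) auto
  have "((\<lambda>\<epsilon>. (\<bar>l\<bar> + D * \<epsilon>) ^ 1 * (\<bar>s\<bar> + D * \<epsilon> * (1 + 1 / \<bar>l\<bar>)) ^ k) \<longlongrightarrow>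
      (\<bar>l\<bar> + D * 0) ^ 1 * (\<bar>s\<bar> + D * 0 * (1 + 1 / \<bar>l\<bar>)) ^ k) (at_right 0)" by (intro tendsto_intros)
  from order_tendstoD(2)[OF this, of "\<bar>s\<bar>"]
  have 3: "\<forall>\<^sub>F \<epsilon> in at_right 0. (\<bar>l\<bar> + D * \<epsilon>) ^ 1 * (\<bar>s\<bar> + D * \<epsilon> * (1 + 1 / \<bar>l\<bar>)) ^ k < \<bar>s\<bar>"
    using assms(3,4) by simp
  have 4: "\<forall>\<^sub>F \<epsilon> in at_right (0::real). 0 < \<epsilon>" by (simp add: eventually_at_right_less)
  have "\<forall>\<^sub>F \<epsilon> in at_right 0. 0 < \<epsilon> \<and> \<bar>l\<bar> + D * \<epsilon> < 1 \<and>
      (\<bar>l\<bar> + D * \<epsilon>) ^ 2 * (\<bar>s\<bar> + D * \<epsilon> * (1 + 1 / \<bar>l\<bar>)) ^ k < \<bar>l\<bar> \<and>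
      (\<bar>l\<bar> + D * \<epsilon>) ^ 1 * (\<bar>s\<bar> + D * \<epsilon> * (1 + 1 / \<bar>l\<bar>)) ^ k < \<bar>s\<bar>"
    using 1 2 3 4 by eventually_elim blast
  then obtain \<epsilon> where "0 < \<epsilon> \<and> \<bar>l\<bar> + D * \<epsilon> < 1 \<and>
      (\<bar>l\<bar> + D * \<epsilon>) ^ 2 * (\<bar>s\<bar> + D * \<epsilon> * (1 + 1 / \<bar>l\<bar>)) ^ k < \<bar>l\<bar> \<and>
      (\<bar>l\<bar> + D * \<epsilon>) ^ 1 * (\<bar>s\<bar> + D * \<epsilon> * (1 + 1 / \<bar>l\<bar>)) ^ k < \<bar>s\<bar>"
    using eventually_happens'[OF trivial_limit_at_right_real] by blast
  then show ?thesis using that[of \<epsilon>] by (simp add: less_imp_le)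
qed

lemma wbd_cutoff:
  assumes \<eta>: "wbd (obox 1) k 0 C \<eta>" "0 \<le> C" "\<And>z. z \<notin> obox (2/3) \<Longrightarrow> \<eta> z = 0"
    and u: "wbd (obox 1) k w M u" "0 \<le> M"
  shows "wbd UNIV k w (2 ^ k * (C * M)) (\<lambda>z. if z \<in> obox 1 then \<eta> z * u z else 0)"
proof (rule wbd_extend[where K="kbox (2/3)"])
  interpret narrow "obox 1" by unfold_locales (auto simp: open_obox)
  show "wbd (obox 1) k w (2 ^ k * (C * M)) (\<lambda>z. \<eta> z * u z)"
    using wbd_mult[OF \<eta>(1) u(1) \<eta>(2) u(2)] by simp
  show "closed (kbox (2/3))" by (intro closed_Times closed_atLeastAtMost)
  show "kbox (2/3) \<subseteq> obox 1" by auto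
  show "\<eta> z * u z = 0" if "z \<in> obox 1 - kbox (2/3)" for z
    using \<eta>(3)[of z] that obox_kbox[of "2/3"] by auto
qed (use assms in \<open>auto simp: open_obox\<close>)


text \<open>\<open>F z\<close> may lie outside \<open>W\<close>. The final equation holds
  nevertheless, because the corrections satisfy their equations on the whole strip; \<open>W\<close>
  only delimits where the cut-off is 1 and where smoothness of \<open>h\<close> is claimed.\<close>

theorem straightened_linearization:
  fixes F :: "real \<times> real \<Rightarrow> real \<times> real" and l s :: real
  assumes M: "open M" "0 \<in> M" and FC: "Ck_on (Suc (Suc k)) F M" and k: "2 \<le> k"
    and axis: "\<And>t. (0, t) \<in> M \<Longrightarrow> F (0, t) = (0, s * t)"
    and DF: "(F has_derivative (\<lambda>h. (l * fst h, s * snd h))) (at 0)"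
    and ls: "l \<noteq> 0" "\<bar>l\<bar> < 1" "1 < \<bar>s\<bar>" "\<bar>l\<bar> * \<bar>s\<bar> ^ k < 1"
  obtains W h h' where "open W" "0 \<in> W" "W \<subseteq> M" "Ck_on k h W" "h 0 = 0" "(h has_derivative h') (at 0)" "bij h'"
    "\<And>z. z \<in> W \<Longrightarrow> h (F z) = (l * fst (h z), s * snd (h z))"
proof -
  obtain j where kj: "k = Suc (Suc j)" using k by (metis le_Suc_ex add_2_eq_Suc)
  define F1 F2 where "F1 = (\<lambda>z. fst (F z))" and "F2 = (\<lambda>z. snd (F z))"
  have F1C: "Ck_on (Suc (Suc k)) F1 M" and F2C: "Ck_on (Suc (Suc k)) F2 M"
    unfolding F1_def F2_def by (rule Ck_fst[OF M(1) FC], rule Ck_snd[OF M(1) FC])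
  have ax1: "F1 z = 0" and ax2: "F2 z = s * snd z" if "z \<in> M" "fst z = 0" for z
    using axis[of "snd z"] that by (cases z; simp add: F1_def F2_def)+
  have D1: "(F1 has_derivative (\<lambda>h. l * fst h)) (at 0)" and D2: "(F2 has_derivative (\<lambda>h. s * snd h)) (at 0)"
    unfolding F1_def F2_def using has_derivative_fst[OF DF] has_derivative_snd[OF DF] by simp_all
  obtain p q where pq: "\<And>z. z \<in> M \<Longrightarrow> (F1 has_derivative (\<lambda>h. fst h * p z + snd h * q z)) (at z)"
    "Ck_on (Suc k) p M"
    using Ck_partials[OF M(1) F1C] by blast
  have p0: "p 0 = l"
    using fun_cong[OF has_derivative_unique[OF pq(1)[OF M(2)] D1], of "(1, 0)"] by simp
  obtain \<delta> where \<delta>: "0 < \<delta>" "kbox \<delta> \<subseteq> M" using kbox_in_open[OF M] .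
  \<comment> \<open>The derivative of \<open>F1\<close> transverse to the axis, that is, the action
    of \<open>F\<close> on the normal bundle; it is the coefficient in the equation for
    \<open>a\<close>.\<close>
  have bC: "Ck_on (Suc k) (\<lambda>t. p (0, t)) {-\<delta><..<\<delta>}"
  proof (rule Ck_compose[OF open_greaterThanLessThan M(1) _ pq(2)])
    show "Ck_on (Suc k) (\<lambda>t::real. (0::real, t)) {-\<delta><..<\<delta>}" by (intro Ck_Pair Ck_const Ck_ident open_greaterThanLessThan)
  qed (use \<delta> in auto)
  have b0: "p (0, 0) = l" using p0 by (simp add: zero_prod_def)
  obtain d a where d: "0 < d" "d \<le> \<delta>" and aC: "Ck_on (Suc k) a {-d<..<d}" and a0: "a 0 = 1"
    and aeq: "\<And>y. \<bar>s * y\<bar> < d \<Longrightarrow> a (s * y) * p (0, y) = l * a y"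
    using normal_bundle_linearization[OF \<delta>(1) bC b0 ls(1,3)] by blast
  \<comment> \<open>Here \<open>a\<close> may be evaluated at \<open>F2 z\<close>,
    \<open>snd z\<close> and \<open>s * snd z\<close>, all of which enter the estimate of
    \<open>G1\<close>.\<close>
  define M2 where "M2 = M \<inter> (F2 -` {-d<..<d} \<inter> M) \<inter> {z. \<bar>snd z\<bar> < d} \<inter> {z. \<bar>s * snd z\<bar> < d}"
  have M2: "open M2" "0 \<in> M2" "M2 \<subseteq> M"
  proof -
    have o1: "open (F2 -` {-d<..<d} \<inter> M)"
      by (rule continuous_open_preimage[OF Ck_continuous[OF M(1) F2C] M(1) open_greaterThanLessThan, unfolded Int_commute[of M]])
    have o2: "open {z::real \<times> real. \<bar>snd z\<bar> < d}" and o3: "open {z::real \<times> real. \<bar>s * snd z\<bar> < d}"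
      by (intro open_Collect_less continuous_intros)+
    show "open M2" unfolding M2_def by (rule open_Int[OF open_Int[OF open_Int[OF M(1) o1] o2] o3])
    have "F2 0 = 0" using ax2[OF M(2)] by simp
    then show "0 \<in> M2" using M(2) d(1) by (simp add: M2_def)
    show "M2 \<subseteq> M" by (auto simp: M2_def)
  qed
  have inM2: "\<bar>F2 z\<bar> < d" "\<bar>snd z\<bar> < d" "\<bar>s * snd z\<bar> < d" if "z \<in> M2" for z
    using that by (auto simp: M2_def abs_less_iff)
  obtain \<delta>2 where \<delta>2: "0 < \<delta>2" "kbox \<delta>2 \<subseteq> M2" using kbox_in_open[OF M2(1,2)] .
  define \<delta>1 where "\<delta>1 = min \<delta>2 1"
  have \<delta>1: "0 < \<delta>1" "\<delta>1 \<le> 1" "kbox \<delta>1 \<subseteq> M2" "kbox \<delta>1 \<subseteq> M"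
    using \<delta>2 kbox_mono[of \<delta>1 \<delta>2] M2(3) by (auto simp: \<delta>1_def)
  interpret Q: narrow "obox \<delta>1"
    using \<delta>1(2) by unfold_locales (auto simp: open_obox)
  \<comment> \<open>\<open>G1\<close> and \<open>G2\<close> are the defects of the approximate
    solutions \<open>a y * x\<close> and \<open>y\<close>. \<open>G2\<close> is at the same time the
    nonlinear part of the second component of \<open>F\<close>, as \<open>g1\<close> is of the
    first.\<close>
  define G1 where "G1 z = a (F2 z) * F1 z - l * (a (snd z) * fst z)" for z
  define G2 where "G2 z = F2 z - s * snd z" for z
  define g1 where "g1 z = F1 z - l * fst z" for z
  have snC: "Ck_on n (\<lambda>z::real \<times> real. s * snd z) U" if "open U" for n U
    by (intro Ck_mult Ck_const Ck_snd Ck_ident that)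
  have asC: "Ck_on (Suc k) (\<lambda>z. a (s * snd z)) M2"
  proof (rule Ck_compose[OF M2(1) open_greaterThanLessThan snC[OF M2(1)] aC])
    show "s * snd z \<in> {-d<..<d}" if "z \<in> M2" for z using inM2(3)[OF that] by (auto simp: abs_less_iff)
  qed
  have F2C': "Ck_on (Suc k) F2 M2" by (rule Ck_subset[OF M2(1,3) Ck_mono[OF M(1) F2C]]) simp
  have aFC: "Ck_on (Suc k) (\<lambda>z. a (F2 z)) M2"
  proof (rule Ck_compose[OF M2(1) open_greaterThanLessThan F2C' aC])
    show "F2 z \<in> {-d<..<d}" if "z \<in> M2" for z using inM2(1)[OF that] by (auto simp: abs_less_iff)
  qed
  \<comment> \<open>Replacing \<open>a (F2 z)\<close> by \<open>a (s * snd z)\<close> costs a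
    product of two functions of order 1, and replacing \<open>F1 z\<close> by its linear part in
    \<open>x\<close> costs a remainder of order 2. What is left is linear in \<open>x\<close> and
    cancels by the equation for \<open>a\<close>.\<close>
  obtain C1 where C1: "0 \<le> C1" "wbd (obox \<delta>1) k 2 C1 G1"
  proof -
    have v1: "a (F2 z) - a (s * snd z) = 0" if "z \<in> M2" "fst z = 0" for z
      using ax2[of z] that M2(3) by auto
    obtain c1 where c1: "0 \<le> c1" "wbd (obox \<delta>1) k 1 c1 (\<lambda>z. a (F2 z) - a (s * snd z))"
      using wbd_vanishing1[OF M2(1) \<delta>1(3) Ck_diff[OF M2(1) aFC asC] v1] by blast
    have F1k: "Ck_on (Suc k) F1 M" by (rule Ck_mono[OF M(1) F1C]) simp
    obtain c2 where c2: "0 \<le> c2" "wbd (obox \<delta>1) k 1 c2 F1"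
      using wbd_vanishing1[OF M(1) \<delta>1(4) F1k ax1] by blast
    have ask: "Ck_on k (\<lambda>z. a (s * snd z)) M2" by (rule Ck_mono[OF M2(1) asC]) simp
    obtain c3 where c3: "0 \<le> c3" "wbd (obox \<delta>1) k 0 c3 (\<lambda>z. a (s * snd z))"
      using wbd_smooth[OF M2(1) \<delta>1(3) ask] by blast
    obtain c4 where c4: "0 \<le> c4" "wbd (obox \<delta>1) k 2 c4 (\<lambda>z. F1 z - fst z * p (0, snd z))"
      using wbd_vanishing2[OF M(1) \<delta>1(4) F1C ax1 pq(1)] by blast
    have "wbd (obox \<delta>1) k (1 + 1) (2 ^ k * (c1 * c2)) (\<lambda>z. (a (F2 z) - a (s * snd z)) * F1 z)"
      by (rule Q.wbd_mult[OF c1(2) c2(2) c1(1) c2(1)])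
    moreover have "wbd (obox \<delta>1) k (0 + 2) (2 ^ k * (c3 * c4)) (\<lambda>z. a (s * snd z) * (F1 z - fst z * p (0, snd z)))"
      by (rule Q.wbd_mult[OF c3(2) c4(2) c3(1) c4(1)])
    ultimately have "wbd (obox \<delta>1) k 2 (2 ^ k * (c1 * c2) + 2 ^ k * (c3 * c4))
        (\<lambda>z. (a (F2 z) - a (s * snd z)) * F1 z + a (s * snd z) * (F1 z - fst z * p (0, snd z)))"
      by (intro wbd_add) (simp_all only: add_0 one_add_one)
    then have "wbd (obox \<delta>1) k 2 (2 ^ k * (c1 * c2) + 2 ^ k * (c3 * c4)) G1"
    proof (rule wbd_cong[OF open_obox, rotated])
      fix z assume "z \<in> obox \<delta>1"
      then have "z \<in> M2" using \<delta>1(3) obox_kbox by blast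
      from aeq[OF inM2(3)[OF this]]
      have e: "a (s * snd z) * p (0, snd z) = l * a (snd z)" .
      have "(a (F2 z) - a (s * snd z)) * F1 z + a (s * snd z) * (F1 z - fst z * p (0, snd z))
          = a (F2 z) * F1 z - (a (s * snd z) * p (0, snd z)) * fst z" by (simp add: algebra_simps)
      then show "(a (F2 z) - a (s * snd z)) * F1 z + a (s * snd z) * (F1 z - fst z * p (0, snd z)) = G1 z"
        unfolding e by (simp add: G1_def)
    qed
    moreover have "0 \<le> 2 ^ k * (c1 * c2) + 2 ^ k * (c3 * c4)" using c1 c2 c3 c4 by simp
    ultimately show ?thesis using that by blast
  qed
  have fC: "Ck_on (Suc k) g1 M" "Ck_on (Suc k) G2 M"
    unfolding g1_def[abs_def] G2_def[abs_def]
    by (intro Ck_diff M(1) Ck_mult Ck_const Ck_fst Ck_snd Ck_ident Ck_mono[OF M(1) F1C] Ck_mono[OF M(1) F2C], simp)+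
  have v: "g1 z = 0" "G2 z = 0" if "z \<in> M" "fst z = 0" for z
    using ax1[OF that] ax2[OF that] that by (auto simp: g1_def G2_def)
  obtain C2 where C2: "0 \<le> C2" "wbd (obox \<delta>1) k 1 C2 G2"
    using wbd_vanishing1[OF M(1) \<delta>1(4) fC(2) v(2)] by blast
  obtain C3 where C3: "0 \<le> C3" "wbd (obox \<delta>1) k 1 C3 g1"
    using wbd_vanishing1[OF M(1) \<delta>1(4) fC(1) v(1)] by blast
  define C where "C = max C2 C3"
  have C: "0 \<le> C" "C2 \<le> C" "C3 \<le> C" using C2 C3 by (auto simp: C_def)
  have Dg: "(g1 has_derivative (\<lambda>h. 0)) (at 0)" "(G2 has_derivative (\<lambda>h. 0)) (at 0)"
    unfolding g1_def[abs_def] G2_def[abs_def]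
    using has_derivative_diff[OF D1 has_derivative_mult_right[OF has_derivative_fst[OF has_derivative_ident]], of l]
      has_derivative_diff[OF D2 has_derivative_mult_right[OF has_derivative_snd[OF has_derivative_ident]], of s]
    by simp_all
  obtain \<eta> :: "real \<times> real \<Rightarrow> real" where \<eta>: "Ck_on k \<eta> UNIV" "\<And>z. z \<in> kbox (1/3) \<Longrightarrow> \<eta> z = 1" "\<And>z. z \<notin> obox (2/3) \<Longrightarrow> \<eta> z = 0"
    using Ck_cutoff_exists[of k] by blast
  obtain E where E: "0 \<le> E" "wbd (obox 1) k 0 E \<eta>"
    using wbd_smooth[OF open_UNIV subset_UNIV \<eta>(1)] by blast
  define D :: real where "D = 2 ^ Suc k"
  obtain \<epsilon> where eps: "0 < \<epsilon>" "\<bar>l\<bar> + D * \<epsilon> \<le> 1"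
    "(\<bar>l\<bar> + D * \<epsilon>) ^ 2 * (\<bar>s\<bar> + D * \<epsilon> * (1 + 1 / \<bar>l\<bar>)) ^ k < \<bar>l\<bar>"
    "(\<bar>l\<bar> + D * \<epsilon>) ^ 1 * (\<bar>s\<bar> + D * \<epsilon> * (1 + 1 / \<bar>l\<bar>)) ^ k < \<bar>s\<bar>"
    using spectral_gap[OF ls] .
  \<comment> \<open>Makes the cut-off nonlinearity at most \<open>\<epsilon>\<close>:
    \<open>2 ^ k * E\<close> is the price of multiplying by the cut-off, \<open>2 * C\<close> comes
    from rescaling, and the 1 keeps the denominator positive.\<close>
  define r where "r = min \<delta>1 (\<epsilon> / (2 ^ k * (E * (2 * C)) + 1))"
  have den: "0 < 2 ^ k * (E * (2 * C)) + 1" using E C by (intro add_nonneg_pos) auto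
  have r: "0 < r" "r \<le> \<delta>1" "r \<le> 1" using \<delta>1 eps(1) den by (auto simp: r_def)
  have re: "2 ^ k * (E * (2 * r * C)) \<le> \<epsilon>"
  proof -
    have "2 ^ k * (E * (2 * r * C)) = (2 ^ k * (E * (2 * C))) * r" by simp
    also have "\<dots> \<le> (2 ^ k * (E * (2 * C)) + 1) * r" using r(1) by simp
    also have "\<dots> \<le> (2 ^ k * (E * (2 * C)) + 1) * (\<epsilon> / (2 ^ k * (E * (2 * C)) + 1))"
      using den by (intro mult_left_mono) (auto simp: r_def)
    also have "\<dots> = \<epsilon>" using den by simp
    finally show ?thesis .
  qed
  \<comment> \<open>Applied to \<open>g1\<close> and \<open>G2\<close> this gives the perturbation
    of the linear map in rescaled coordinates, applied to \<open>G1\<close> and \<open>G2\<close>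
    the right-hand sides of the two equations.\<close>
  define cut where "cut u z = (if z \<in> obox 1 then \<eta> z * (u (r *\<^sub>R z) / r) else 0)" for u z
  \<comment> \<open>Unbounded in \<open>y\<close>, where orbits escape; invariant, since the
    modified map does not expand \<open>\<bar>x\<bar>\<close>.\<close>
  define S where "S = {z::real \<times> real. \<bar>fst z\<bar> < 1}"
  interpret S: narrow S
    unfolding S_def by unfold_locales (auto intro!: open_Collect_less continuous_intros)
  have convS: "convex S"
  proof -
    have "S = {-1<..<1} \<times> UNIV" by (auto simp: S_def abs_less_iff mem_Times_iff)
    then show ?thesis by (simp add: convex_Times)
  qed
  have cutW: "wbd S k 1 \<epsilon> (cut u)"
    if "wbd (obox \<delta>1) k 1 c u" "c \<le> C" "(u has_derivative (\<lambda>h. 0)) (at 0)" for u c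
  proof -
    have "wbd (obox 1) k 1 (2 * r * C) (\<lambda>z. u (r *\<^sub>R z) / r)"
      unfolding kj by (rule wbd_rescaled_nonlinearity[OF r C(1) wbd_le[OF that(1)[unfolded kj] that(2)] that(3)])
    from wbd_cutoff[OF E(2,1) \<eta>(3) this]
    have "wbd UNIV k 1 (2 ^ k * (E * (2 * r * C))) (cut u)"
      unfolding cut_def[abs_def] using r C by simp
    then show ?thesis by (intro wbd_subset[OF wbd_le[OF _ re]]) auto
  qed
  have cg1: "wbd S k 1 \<epsilon> (cut g1)" by (rule cutW[OF C3(2) C(3) Dg(1)])
  have cG2: "wbd S k 1 \<epsilon> (cut G2)" by (rule cutW[OF C2(2) C(2) Dg(2)])
  have cg2: "wbd S k 0 \<epsilon> (cut G2)" by (rule S.wbd_weight[OF cG2]) (use eps in auto)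
  define M1 where "M1 = 2 ^ k * (E * (\<bar>1 / r\<bar> * C1))"
  have M1: "0 \<le> M1" using E C1 by (simp add: M1_def)
  have cG1: "wbd S k 2 M1 (cut G1)"
  proof -
    have "wbd (obox 1) k 2 (\<bar>1 / r\<bar> * C1) (\<lambda>z. 1 / r * G1 (r *\<^sub>R z))"
      by (rule wbd_cmult[OF wbd_scale[OF r C1]])
    then have "wbd (obox 1) k 2 (\<bar>1 / r\<bar> * C1) (\<lambda>z. G1 (r *\<^sub>R z) / r)" by simp
    from wbd_cutoff[OF E(2,1) \<eta>(3) this]
    have "wbd UNIV k 2 M1 (cut G1)"
      unfolding cut_def[abs_def] M1_def using C1 by simp
    then show ?thesis by (rule wbd_subset) auto
  qed
  have D1': "1 \<le> D" unfolding D_def by (rule one_le_power) simp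
  have maps: "(l * fst z + cut g1 z, s * snd z + cut G2 z) \<in> S" if z: "z \<in> S" for z
  proof -
    have "\<bar>l * fst z + cut g1 z\<bar> \<le> \<bar>l\<bar> * \<bar>fst z\<bar> + \<epsilon> * \<bar>fst z\<bar>"
      using wbd_bound[OF cg1 z] abs_triangle_ineq[of "l * fst z" "cut g1 z"] by (simp add: abs_mult)
    also have "\<dots> \<le> (\<bar>l\<bar> + D * \<epsilon>) * \<bar>fst z\<bar>"
      using mult_right_mono[OF mult_right_mono[OF D1', of \<epsilon>], of "\<bar>fst z\<bar>"] eps(1) by (simp add: algebra_simps)
    also have "\<dots> \<le> 1 * \<bar>fst z\<bar>" using eps(2) by (intro mult_right_mono) auto
    finally show ?thesis using z by (simp add: S_def)
  qed
  have R1: "1 \<le> \<bar>s\<bar> + D * \<epsilon> * (1 + 1 / \<bar>l\<bar>)"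
  proof -
    have "0 \<le> D * \<epsilon> * (1 + 1 / \<bar>l\<bar>)" using D1' eps(1) by simp
    then show ?thesis using ls(3) by linarith
  qed
  have eps0: "0 \<le> \<epsilon>" and DD: "2 ^ Suc k \<le> D" using eps(1) by (auto simp: D_def)
  \<comment> \<open>Weight 2 is played against the eigenvalue \<open>l\<close>, and below weight 1
    against \<open>s\<close>; these are the two inequalities that \<open>spectral_gap\<close>
    supplied.\<close>
  obtain u1 c1 where u1: "wbd S k 2 c1 u1"
    "\<And>z. z \<in> S \<Longrightarrow> u1 (l * fst z + cut g1 z, s * snd z + cut G2 z) = l * u1 z - cut G1 z"
    using S.homological_equation[OF ls(1) eps0 DD eps(2) R1 cg1 cg2 maps convS eps(3) M1 cG1] by blast
  obtain u2 c2 where u2: "wbd S k 1 c2 u2"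
    "\<And>z. z \<in> S \<Longrightarrow> u2 (l * fst z + cut g1 z, s * snd z + cut G2 z) = s * u2 z - cut G2 z"
    using S.homological_equation[OF ls(1) eps0 DD eps(2) R1 cg1 cg2 maps convS eps(4) eps0 cG2] by blast
  \<comment> \<open>The approximate solutions divided by \<open>r\<close>, plus the corrections,
    which live in the rescaled variable. The function \<open>a\<close> was not rescaled and is
    evaluated at \<open>snd z\<close> itself.\<close>
  define h where "h z = (a (snd z) * (fst z / r) + u1 (z /\<^sub>R r), snd z / r + u2 (z /\<^sub>R r))" for z
  define W where "W = obox (r / 3)"
  have W: "open W" "0 \<in> W" using r by (auto simp: W_def zero_prod_def open_obox)
  have Wk: "z \<in> M2 \<and> z /\<^sub>R r \<in> kbox (1/3) \<and> z /\<^sub>R r \<in> obox 1 \<and> z /\<^sub>R r \<in> S" if "z \<in> W" for z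
  proof -
    have zz: "\<bar>fst z\<bar> < r / 3" "\<bar>snd z\<bar> < r / 3" using that by (auto simp: W_def mem_Times_iff abs_less_iff)
    have "r / 3 / r = 1 / 3" using r(1) by simp
    with divide_strict_right_mono[OF zz(1) r(1)] divide_strict_right_mono[OF zz(2) r(1)]
    have "\<bar>fst z\<bar> / r < 1 / 3" "\<bar>snd z\<bar> / r < 1 / 3" by linarith+
    moreover have "fst (z /\<^sub>R r) = fst z / r" "snd (z /\<^sub>R r) = snd z / r"
      by (simp_all add: divide_inverse_commute)
    ultimately have "\<bar>fst (z /\<^sub>R r)\<bar> < 1 / 3" "\<bar>snd (z /\<^sub>R r)\<bar> < 1 / 3"
      using r(1) by simp_all
    then have "z /\<^sub>R r \<in> kbox (1/3)" "z /\<^sub>R r \<in> obox 1" "z /\<^sub>R r \<in> S"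
      unfolding S_def mem_Times_iff mem_Collect_eq atLeastAtMost_iff greaterThanLessThan_iff by linarith+
    moreover have "z \<in> kbox \<delta>1" using zz r by (auto simp: mem_Times_iff abs_less_iff)
    ultimately show ?thesis using \<delta>1(3) by blast
  qed
  have WM: "W \<subseteq> M" using Wk M2(3) by blast
  have divC: "Ck_on k (\<lambda>z. z /\<^sub>R r) W" by (intro Ck_scaleR Ck_const Ck_ident W(1))
  have uC: "Ck_on k (\<lambda>z. u (z /\<^sub>R r)) W" if "wbd S k w c u" for u w c
    by (rule Ck_compose[OF W(1) S.S_open divC wbd_Ck[OF S.S_open that]]) (use Wk in blast)
  have aW: "Ck_on k (\<lambda>z. a (snd z)) W"
  proof (rule Ck_compose[OF W(1) open_greaterThanLessThan Ck_snd[OF W(1) Ck_ident[OF W(1)]]])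
    show "Ck_on k a {-d<..<d}" by (rule Ck_mono[OF open_greaterThanLessThan aC]) simp
    show "snd z \<in> {-d<..<d}" if "z \<in> W" for z using inM2(2)[of z] Wk[OF that] by (simp add: abs_less_iff)
  qed
  have hC: "Ck_on k h W"
    unfolding h_def[abs_def] divide_inverse
    by (intro Ck_Pair Ck_add Ck_mult Ck_const Ck_fst Ck_snd Ck_ident aW uC[OF u1(1)] uC[OF u2(1)] W(1))
  have S0: "0 \<in> S" by (simp add: S_def)
  have u10: "u1 0 = 0" and u20: "u2 0 = 0"
    using wbd_bound[OF u1(1) S0] wbd_bound[OF u2(1) S0] by simp_all
  have h0: "h 0 = 0" by (simp add: h_def u10 u20 prod_eq_iff)
  obtain p1 q1 where d1: "\<forall>z\<in>S. (u1 has_derivative (\<lambda>h. fst h * p1 z + snd h * q1 z)) (at z)"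
    "wbd S (Suc j) (2 - 1) c1 p1" "wbd S (Suc j) 2 c1 q1"
    using u1(1)[unfolded kj] unfolding wbd.simps(2)[of S "Suc j"] by blast
  obtain p2 q2 where d2: "\<forall>z\<in>S. (u2 has_derivative (\<lambda>h. fst h * p2 z + snd h * q2 z)) (at z)"
    "wbd S (Suc j) 1 c2 q2"
    using u2(1)[unfolded kj] unfolding wbd.simps(2)[of S "Suc j"] by blast
  \<comment> \<open>These partial derivatives have positive weight and so vanish at 0. Only
    \<open>p2\<close> has weight 0, which leaves one off-diagonal entry in
    \<open>h'\<close>.\<close>
  have z1: "p1 0 = 0" "q1 0 = 0" "q2 0 = 0"
    using wbd_bound[OF d1(2) S0] wbd_bound[OF d1(3) S0] wbd_bound[OF d2(2) S0] by simp_all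
  define h' where "h' z = (fst z / r, snd z / r + fst z / r * p2 0)" for z :: "real \<times> real"
  have hder: "(h has_derivative h') (at 0)"
  proof -
    have dv: "((\<lambda>z::real \<times> real. z /\<^sub>R r) has_derivative (\<lambda>z. z /\<^sub>R r)) (at 0)"
      by (auto intro!: derivative_eq_intros)
    have e1: "((\<lambda>z. u1 (z /\<^sub>R r)) has_derivative (\<lambda>z. 0)) (at 0)"
      using has_derivative_compose[OF dv, of u1] bspec[OF d1(1) S0] by (simp add: z1)
    have "((\<lambda>z. u2 (z /\<^sub>R r)) has_derivative (\<lambda>z. fst (z /\<^sub>R r) * p2 0 + snd (z /\<^sub>R r) * q2 0)) (at 0)"
      by (rule has_derivative_compose[OF dv]) (use bspec[OF d2(1) S0] in simp)
    then have e2: "((\<lambda>z. u2 (z /\<^sub>R r)) has_derivative (\<lambda>z. fst z / r * p2 0)) (at 0)"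
      by (simp add: z1 divide_inverse mult_ac)
    have l1: "((\<lambda>z::real \<times> real. fst z / r) has_derivative (\<lambda>z. fst z / r)) (at 0)"
      by (rule bounded_linear_imp_has_derivative[OF bounded_linear_compose[OF bounded_linear_divide bounded_linear_fst]])
    have e4: "((\<lambda>z::real \<times> real. snd z / r) has_derivative (\<lambda>z. snd z / r)) (at 0)"
      by (rule bounded_linear_imp_has_derivative[OF bounded_linear_compose[OF bounded_linear_divide bounded_linear_snd]])
    obtain a' where "((\<lambda>z::real \<times> real. a (snd z)) has_derivative a') (at 0)"
      using Ck_Suc_ex[OF W(1) aW[unfolded kj]] W(2) by blast
    from has_derivative_mult[OF this l1]
    have e3: "((\<lambda>z::real \<times> real. a (snd z) * (fst z / r)) has_derivative (\<lambda>z. fst z / r)) (at 0)"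
      by (simp add: a0)
    from has_derivative_Pair[OF has_derivative_add[OF e3 e1] has_derivative_add[OF e4 e2]]
    show ?thesis unfolding h_def[abs_def] h'_def[abs_def] by simp
  qed
  have bijh: "bij h'"
  proof (rule o_bij[where g="\<lambda>z. (r * fst z, r * (snd z - fst z * p2 0))"])
    show "(\<lambda>z. (r * fst z, r * (snd z - fst z * p2 0))) \<circ> h' = id" "h' \<circ> (\<lambda>z. (r * fst z, r * (snd z - fst z * p2 0))) = id"
      using r(1) by (auto simp: h'_def fun_eq_iff)
  qed
  have conj: "h (F z) = (l * fst (h z), s * snd (h z))" if z: "z \<in> W" for z
  proof -
    note zk = Wk[OF z]
    have cutz: "cut u (z /\<^sub>R r) = u z / r" for u
      using zk \<eta>(2)[of "z /\<^sub>R r"] r(1) by (simp add: cut_def)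
    have Fz: "(l * fst (z /\<^sub>R r) + g1 z / r, s * snd (z /\<^sub>R r) + G2 z / r) = F z /\<^sub>R r"
      by (rule prod_eqI) (simp_all add: g1_def G2_def F1_def F2_def divide_inverse algebra_simps)
    have U1: "u1 (F z /\<^sub>R r) = l * u1 (z /\<^sub>R r) - G1 z / r"
      using u1(2)[of "z /\<^sub>R r"] zk unfolding cutz Fz by blast
    have U2: "u2 (F z /\<^sub>R r) = s * u2 (z /\<^sub>R r) - G2 z / r"
      using u2(2)[of "z /\<^sub>R r"] zk unfolding cutz Fz by blast
    show ?thesis
      unfolding h_def U1 U2 using r(1)
      by (simp add: G1_def G2_def F1_def F2_def diff_divide_distrib algebra_simps)
  qed
  from that[OF W WM hC h0 hder bijh conj] show ?thesis .
qed

section \<open>Straightening the unstable manifold\<close>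

text \<open>The map \<open>(x, y) \<mapsto> K y + (x, 0)\<close> carries the vertical axis onto the
  unstable curve. As \<open>K\<close> has tangent \<open>(0, 1)\<close> at 0, its derivative there
  is the identity, and conjugation by it keeps the linear part diagonal. \<open>K\<close> is as
  smooth as \<open>f\<close>, so no derivative is lost in straightening.\<close>

theorem planar_linearization:
  fixes f :: "real \<times> real \<Rightarrow> real \<times> real" and l s :: real
  assumes N: "open N" "0 \<in> N" and fC: "Ck_on (Suc (Suc k)) f N" and k: "2 \<le> k" and f0: "f 0 = 0"
    and Df: "(f has_derivative (\<lambda>h. (l * fst h, s * snd h))) (at 0)"
    and ls: "l \<noteq> 0" "\<bar>l\<bar> < 1" "1 < \<bar>s\<bar>" "\<bar>l\<bar> * \<bar>s\<bar> ^ k < 1"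
  shows "\<exists>W h h'. open W \<and> 0 \<in> W \<and> Ck_on k h W \<and> h 0 = 0 \<and> (h has_derivative h') (at 0) \<and> bij h' \<and>
    (\<forall>z\<in>W. h (f z) = (l * fst (h z), s * snd (h z)))"
proof -
  have lam: "\<bar>l\<bar> \<le> \<bar>s\<bar>" using ls(2,3) by simp
  show ?thesis
  proof (rule unstable_curve[OF N fC f0 Df lam ls(3)])
    fix d K
    assume d: "0 < d" and KC: "Ck_on (Suc (Suc k)) K {-d<..<d}" and K0: "K 0 = 0"
      and K': "(K has_vector_derivative (0, 1)) (at 0)"
      and KN: "\<And>t. \<bar>t\<bar> < d \<Longrightarrow> K t \<in> N" and Keq: "\<And>t. \<bar>t\<bar> < d \<Longrightarrow> K t = f (K (t / s))"
    define P where "P z = K (snd z) + (fst z, 0)" for z :: "real \<times> real"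
    define U where "U = {z::real \<times> real. snd z \<in> {-d<..<d}}"
    have U: "open U" "0 \<in> U"
    proof -
      have "U = UNIV \<times> {-d<..<d}" by (auto simp: U_def)
      then show "open U" by (simp add: open_Times)
      show "0 \<in> U" using d by (simp add: U_def)
    qed
    have PC: "Ck_on (Suc (Suc k)) P U"
      unfolding P_def[abs_def]
    proof (rule Ck_add[OF U(1)])
      show "Ck_on (Suc (Suc k)) (\<lambda>z. K (snd z)) U"
        by (rule Ck_compose[OF U(1) open_greaterThanLessThan Ck_snd[OF U(1) Ck_ident[OF U(1)]] KC]) (simp add: U_def)
      show "Ck_on (Suc (Suc k)) (\<lambda>z. (fst z, 0)) U" by (intro Ck_Pair Ck_fst Ck_ident Ck_const U(1))
    qed
    have P0: "P 0 = 0" by (simp add: P_def K0 zero_prod_def[symmetric])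
    have DP: "(P has_derivative (\<lambda>h. h)) (at 0)"
    proof -
      have "(K has_derivative (\<lambda>h. h *\<^sub>R (0, 1))) (at (snd (0 :: real \<times> real)))"
        using K' by (simp add: has_vector_derivative_def)
      from has_derivative_compose[OF has_derivative_snd[OF has_derivative_ident] this]
      have "((\<lambda>z. K (snd z)) has_derivative (\<lambda>h. snd h *\<^sub>R (0, 1))) (at (0 :: real \<times> real))" .
      from has_derivative_add[OF this has_derivative_Pair[OF has_derivative_fst[OF has_derivative_ident] has_derivative_const]]
      show ?thesis unfolding P_def[abs_def] by (rule has_derivative_eq_rhs) auto
    qed
    have k1: "1 \<le> Suc (Suc k)" by simp
    have bid: "bij (\<lambda>h::real \<times> real. h)" by (simp add: bij_def)
    obtain U' V g where U': "open U'" "U' \<subseteq> U" "0 \<in> U'" and V: "open V" and hom: "homeomorphism U' V P g"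
      and gC: "Ck_on (Suc (Suc k)) g V"
      using Ck_inverse_function_theorem[OF U(1) PC k1 U(2) DP bid] by blast
    have gP: "g (P z) = z" if "z \<in> U'" for z using hom that by (simp add: homeomorphism_def)
    have Pg: "P (g y) = y" "g y \<in> U'" if "y \<in> V" for y using hom that by (auto simp: homeomorphism_def)
    have PV: "P z \<in> V" if "z \<in> U'" for z using hom that by (auto simp: homeomorphism_def)
    have V0: "0 \<in> V" and g0: "g 0 = 0" using PV[OF U'(3)] gP[OF U'(3)] P0 by simp_all
    define N1 where "N1 = N \<inter> f -` V"
    have N1: "open N1" "0 \<in> N1" "N1 \<subseteq> N"
      unfolding N1_def using continuous_open_preimage[OF Ck_continuous[OF N(1) fC] N(1) V] N(2) f0 V0 by auto
    \<comment> \<open>On \<open>M\<close> the conjugate \<open>g (f (P z))\<close> is defined, the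
      functional equation of \<open>K\<close> may be used at \<open>s * snd z\<close>, and
      \<open>g\<close> inverts \<open>P\<close> at the image point \<open>(0, s * snd z)\<close> on
      the axis.\<close>
    define M where "M = (U' \<inter> P -` N1) \<inter> {z. \<bar>s * snd z\<bar> < d} \<inter> (\<lambda>z. (0, s * snd z)) -` U'"
    have PCU': "Ck_on (Suc (Suc k)) P U'" by (rule Ck_subset[OF U'(1,2) PC])
    have M: "open M" "0 \<in> M"
    proof -
      have o1: "open (U' \<inter> P -` N1)"
        by (rule continuous_open_preimage[OF Ck_continuous[OF U'(1) PCU'] U'(1) N1(1)])
      have o2: "open {z::real \<times> real. \<bar>s * snd z\<bar> < d}" by (intro open_Collect_less continuous_intros)
      have o3: "open ((\<lambda>z::real \<times> real. (0::real, s * snd z)) -` U')" by (intro open_vimage U'(1) continuous_intros)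
      show "open M" unfolding M_def by (rule open_Int[OF open_Int[OF o1 o2] o3])
      show "0 \<in> M" unfolding M_def using U'(3) P0 N1(2) d by (simp add: zero_prod_def[symmetric])
    qed
    have inM: "z \<in> U'" "P z \<in> N" "f (P z) \<in> V" "\<bar>s * snd z\<bar> < d" "(0, s * snd z) \<in> U'" if "z \<in> M" for z
      using that unfolding M_def N1_def by auto
    define F where "F z = g (f (P z))" for z
    have MU: "M \<subseteq> U'" using inM(1) by blast
    have PM: "Ck_on (Suc (Suc k)) P M" by (rule Ck_subset[OF M(1) MU PCU'])
    have fP: "Ck_on (Suc (Suc k)) (\<lambda>z. f (P z)) M" by (rule Ck_compose[OF M(1) N(1) PM fC inM(2)])
    have FC: "Ck_on (Suc (Suc k)) F M"
      unfolding F_def[abs_def] by (rule Ck_compose[OF M(1) V fP gC inM(3)])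
    have axis: "F (0, t) = (0, s * t)" if t: "(0, t) \<in> M" for t
    proof -
      have "f (K t) = K (s * t)" using Keq[of "s * t"] inM(4)[OF t] ls(3) by auto
      then have "f (P (0, t)) = P (0, s * t)" by (simp add: P_def zero_prod_def[symmetric])
      then show ?thesis using gP[OF inM(5)[OF t]] by (simp add: F_def)
    qed
    obtain g' where g': "(g has_derivative g') (at 0)"
      using Ck_Suc_ex[OF V gC] V0 by blast
    have "((\<lambda>z. g (P z)) has_derivative (\<lambda>h. g' h)) (at 0)"
      by (rule has_derivative_compose[OF DP]) (simp add: P0 g')
    then have "((\<lambda>z. z) has_derivative (\<lambda>h. g' h)) (at 0)"
      by (rule has_derivative_transform_within_open[OF _ U'(1,3) gP])
    then have "g' = (\<lambda>h. h)" using has_derivative_unique[OF _ has_derivative_ident] by blast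
    with g' have Dg: "(g has_derivative (\<lambda>h. h)) (at 0)" by simp
    have DF: "(F has_derivative (\<lambda>h. (l * fst h, s * snd h))) (at 0)"
    proof -
      have "((\<lambda>z. f (P z)) has_derivative (\<lambda>h. (l * fst h, s * snd h))) (at 0)"
        by (rule has_derivative_compose[OF DP, where g=f]) (simp add: P0 Df)
      then show ?thesis unfolding F_def[abs_def]
        by (rule has_derivative_compose[where g=g and g'="\<lambda>h. h"]) (simp add: P0 f0 Dg)
    qed
    show ?thesis
    proof (rule straightened_linearization[OF M FC k axis DF ls])
      fix W h h'
      assume W: "open W" "0 \<in> W" "W \<subseteq> M" and hC: "Ck_on k h W" and h: "h 0 = 0" "(h has_derivative h') (at 0)" "bij h'"
        and conj: "\<And>z. z \<in> W \<Longrightarrow> h (F z) = (l * fst (h z), s * snd (h z))"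
      define W' where "W' = V \<inter> g -` W"
      have W': "open W'" "0 \<in> W'"
        unfolding W'_def using continuous_open_preimage[OF Ck_continuous[OF V gC] V W(1)] V0 g0 W(2) by auto
      have gk: "Ck_on k g W'" by (rule Ck_subset[OF W'(1) _ Ck_mono[OF V gC]]) (auto simp: W'_def)
      have C: "Ck_on k (\<lambda>z. h (g z)) W'" by (rule Ck_compose[OF W'(1) W(1) gk hC]) (simp add: W'_def)
      have D: "((\<lambda>z. h (g z)) has_derivative h') (at 0)"
        by (rule has_derivative_compose[OF Dg]) (simp add: g0 h)
      have cj: "\<forall>z\<in>W'. h (g (f z)) = (l * fst (h (g z)), s * snd (h (g z)))"
      proof
        fix z assume "z \<in> W'"
        then show "h (g (f z)) = (l * fst (h (g z)), s * snd (h (g z)))"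
          using conj[of "g z"] Pg(1)[of z] by (simp add: W'_def F_def)
      qed
      have "h (g 0) = 0" by (simp add: g0 h(1))
      with W' C D h(3) cj
      have "open W' \<and> 0 \<in> W' \<and> Ck_on k (\<lambda>z. h (g z)) W' \<and> h (g 0) = 0 \<and> ((\<lambda>z. h (g z)) has_derivative h') (at 0) \<and>
          bij h' \<and> (\<forall>z\<in>W'. h (g (f z)) = (l * fst (h (g z)), s * snd (h (g z))))"
        by (intro conjI)
      then show ?thesis
        by - (rule exI[of _ W'], rule exI[of _ "\<lambda>z. h (g z)"], rule exI[of _ h'])
    qed
  qed
qed

section \<open>Linear coordinates\<close>

lemma eigenbasis:
  fixes A :: "real^2 \<Rightarrow> real^2" and l s :: real
  assumes "linear A" "u \<noteq> 0" "A u = l *\<^sub>R u" "w \<noteq> 0" "A w = s *\<^sub>R w" "l \<noteq> s"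
  shows "bij (\<lambda>z. fst z *\<^sub>R u + snd z *\<^sub>R w)"
proof -
  let ?L = "\<lambda>z :: real \<times> real. fst z *\<^sub>R u + snd z *\<^sub>R w"
  have lin: "linear ?L" by (intro linearI) (auto simp: algebra_simps)
  have "z = 0" if z: "?L z = 0" for z
  proof -
    have "A (?L z) = fst z *\<^sub>R l *\<^sub>R u + snd z *\<^sub>R s *\<^sub>R w"
      using assms(1,3,5) by (simp add: linear_add linear_scale)
    then have "fst z *\<^sub>R l *\<^sub>R u + snd z *\<^sub>R s *\<^sub>R w = 0" using z linear_0[OF assms(1)] by simp
    \<comment> \<open>The operator \<open>A - s\<close> applied to the combination, which removes
      the \<open>w\<close> term.\<close>
    moreover have "(fst z * (l - s)) *\<^sub>R u = (fst z *\<^sub>R l *\<^sub>R u + snd z *\<^sub>R s *\<^sub>R w) - s *\<^sub>R ?L z"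
      by (simp add: algebra_simps)
    ultimately have "(fst z * (l - s)) *\<^sub>R u = 0" using z by simp
    then have "fst z = 0" using assms(2,6) by simp
    with z have "snd z = 0" using assms(4) by simp
    with \<open>fst z = 0\<close> show "z = 0" by (simp add: prod_eq_iff)
  qed
  then have inj: "inj ?L" using linear_injective_0[OF lin] by blast
  have "dim (range ?L) = dim (UNIV :: (real \<times> real) set)"
    by (rule dim_image_eq[OF lin]) (use inj in simp)
  also have "\<dots> = DIM(real^2)" by simp
  finally have "span (range ?L) = UNIV" by (simp only: dim_eq_full)
  moreover have "span (range ?L) = range ?L"
    unfolding span_eq_iff by (rule linear_subspace_image[OF lin subspace_UNIV])
  ultimately have "range ?L = UNIV" by simp
  with inj show ?thesis by (simp add: bij_def)
qed

text \<open>The local inverse of the planar chart is conjugated by the eigenbasis map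
  \<open>L\<close> on both sides, so that the linear model is the derivative of \<open>f\<close>
  itself and not its diagonal form.\<close>

theorem theorem0p7:
  fixes r :: nat and f :: "real^2 \<Rightarrow> real^2" and lam \<sigma> :: real
  assumes "r \<ge> 4"
    and "Ck_diffeo r f UNIV UNIV"
    and "f 0 = 0"
    and "\<exists>u. u \<noteq> 0 \<and> frechet_derivative f (at 0) u = lam *\<^sub>R u"
    and "\<exists>w. w \<noteq> 0 \<and> frechet_derivative f (at 0) w = \<sigma> *\<^sub>R w"
    and "\<bar>lam\<bar> < 1" and "1 < \<bar>\<sigma>\<bar>"
    and "\<bar>lam\<bar> * \<bar>\<sigma>\<bar> ^ (r - 2) < 1"
  shows "\<exists>U V \<phi>. 0 \<in> U \<and> 0 \<in> V \<and> Ck_diffeo (r - 2) \<phi> U V \<and> \<phi> 0 = 0 \<and>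
           (\<forall>x\<in>U. frechet_derivative f (at 0) x \<in> U \<longrightarrow>
                   f (\<phi> x) = \<phi> (frechet_derivative f (at 0) x))"
proof -
  define A where "A = frechet_derivative f (at 0)"
  obtain u where u: "u \<noteq> 0" "A u = lam *\<^sub>R u" using assms(4) unfolding A_def by blast
  obtain w where w: "w \<noteq> 0" "A w = \<sigma> *\<^sub>R w" using assms(5) unfolding A_def by blast
  define k where "k = r - 2"
  have rk: "r = Suc (Suc k)" "2 \<le> k" using assms(1) by (auto simp: k_def)
  have bijf: "bij f" and fC: "Ck_on (Suc (Suc k)) f UNIV" and ifC: "Ck_on (Suc (Suc k)) (inv f) UNIV"
    using assms(2) by (auto simp: Ck_diffeo_def rk(1))
  obtain f' where f': "(f has_derivative f') (at 0)" using Ck_Suc_ex[OF open_UNIV fC] by blast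
  have fA: "(f has_derivative A) (at 0)" using f' frechet_derivative_at[OF f'] by (simp add: A_def)
  have linA: "linear A" using fA by (rule has_derivative_linear)
  obtain g' where g': "(inv f has_derivative g') (at (f 0))" using Ck_Suc_ex[OF open_UNIV ifC] by blast
  \<comment> \<open>The weighted estimates divide by this eigenvalue. It is nonzero because the
    derivative of \<open>inv f\<close> inverts \<open>A\<close>.\<close>
  have lam0: "lam \<noteq> 0"
  proof
    assume "lam = 0"
    have "((\<lambda>x. inv f (f x)) has_derivative (\<lambda>h. g' (A h))) (at 0)"
      by (rule has_derivative_compose[OF fA g'])
    then have "((\<lambda>x. x) has_derivative (\<lambda>h. g' (A h))) (at 0)"
      using bijf by (simp add: bij_is_inj)
    then have "(\<lambda>h. g' (A h)) = (\<lambda>h. h)" by (rule has_derivative_unique[OF _ has_derivative_ident])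
    from fun_cong[OF this, of u] have "g' 0 = u" using u(2) \<open>lam = 0\<close> by simp
    then show False using linear_0[OF has_derivative_linear[OF g']] u(1) by simp
  qed
  define L where "L z = fst z *\<^sub>R u + snd z *\<^sub>R w" for z
  have bijL: "bij L"
    unfolding L_def[abs_def] by (rule eigenbasis[OF linA u w]) (use assms(6,7) in auto)
  have linL: "linear L" unfolding L_def[abs_def] by (intro linearI) (auto simp: algebra_simps)
  have AL: "A (L z) = L (lam * fst z, \<sigma> * snd z)" for z
    using linA u(2) w(2) by (simp add: L_def linear_add linear_scale mult.commute)
  define G where "G = inv L"
  have GL: "G (L z) = z" for z unfolding G_def using bijL by (simp add: bij_is_inj)
  have LG: "L (G x) = x" for x unfolding G_def using bijL by (simp add: bij_is_surj surj_f_inv_f)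
  have blL: "bounded_linear L" using linL by (simp add: linear_conv_bounded_linear)
  have blG: "bounded_linear G"
    unfolding linear_conv_bounded_linear[symmetric]
  proof (rule linearI)
    fix x y :: "real^2" and c :: real
    show "G (x + y) = G x + G y"
      using GL[of "G x + G y"] by (simp add: linear_add[OF linL] LG)
    show "G (c *\<^sub>R x) = c *\<^sub>R G x"
      using GL[of "c *\<^sub>R G x"] by (simp add: linear_scale[OF linL] LG)
  qed
  have GA: "G (A x) = (lam * fst (G x), \<sigma> * snd (G x))" for x
    using AL[of "G x"] by (simp add: LG GL)
  have L0: "L 0 = 0" and G0: "G 0 = 0"
    using linear_0[OF linL] linear_0[OF bounded_linear.linear[OF blG]] by simp_all
  have LC: "Ck_on n L S" if "open S" for n S using Ck_bounded_linear[OF that blL] .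
  have GC: "Ck_on n G S" if "open S" for n S using Ck_bounded_linear[OF that blG] .
  define p where "p z = G (f (L z))" for z
  have pC: "Ck_on (Suc (Suc k)) p UNIV"
    unfolding p_def[abs_def]
    by (rule Ck_linear_compose[OF open_UNIV blG Ck_compose[OF open_UNIV open_UNIV LC[OF open_UNIV] fC]]) simp
  have p0: "p 0 = 0" by (simp add: p_def L0 G0 assms(3))
  have "((\<lambda>z. f (L z)) has_derivative (\<lambda>h. A (L h))) (at 0)"
    by (rule has_derivative_compose[OF bounded_linear_imp_has_derivative[OF blL]]) (simp add: L0 fA)
  from bounded_linear.has_derivative[OF blG this]
  have Dp: "(p has_derivative (\<lambda>h. (lam * fst h, \<sigma> * snd h))) (at 0)"
    unfolding p_def[abs_def] by (simp add: GA GL)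
  obtain W h h' where W: "open W" "0 \<in> W" and hC: "Ck_on k h W" and h: "h 0 = 0" "(h has_derivative h') (at 0)" "bij h'"
    and conj: "\<forall>z\<in>W. h (p z) = (lam * fst (h z), \<sigma> * snd (h z))"
    using planar_linearization[OF open_UNIV UNIV_I pC rk(2) p0 Dp lam0 assms(6,7) assms(8)[folded k_def]] by blast
  have k1: "1 \<le> k" using rk(2) by simp
  obtain U' V' g where U': "open U'" "U' \<subseteq> W" "0 \<in> U'" and V': "open V'" and hom: "homeomorphism U' V' h g"
    and gC: "Ck_on k g V'"
    using Ck_inverse_function_theorem[OF W(1) hC k1 W(2) h(2,3)] by blast
  have gh: "g (h z) = z" "h z \<in> V'" if "z \<in> U'" for z using hom that by (auto simp: homeomorphism_def)
  have hg: "h (g y) = y" "g y \<in> U'" if "y \<in> V'" for y using hom that by (auto simp: homeomorphism_def)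
  \<comment> \<open>Points of \<open>U'\<close> whose image under \<open>p\<close> is still in
    \<open>U'\<close>, so that \<open>g\<close> inverts \<open>h\<close> at \<open>p z\<close> as
    well; this turns the equation for \<open>h\<close> into one for its inverse.\<close>
  define B where "B = U' \<inter> p -` U'"
  have B: "open B" "0 \<in> B"
  proof -
    have "continuous_on U' p" using Ck_continuous[OF open_UNIV pC] continuous_on_subset by blast
    then show "open B" unfolding B_def by (rule continuous_open_preimage[OF _ U'(1) U'(1)])
    show "0 \<in> B" using U'(3) p0 by (simp add: B_def)
  qed
  define V1 where "V1 = V' \<inter> g -` B"
  have V1: "open V1"
    unfolding V1_def by (rule continuous_open_preimage[OF Ck_continuous[OF V' gC] V' B(1)])
  define U where "U = G -` V1"
  define V where "V = G -` B"
  define \<phi> where "\<phi> x = L (g (G x))" for x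
  define \<psi> where "\<psi> x = L (h (G x))" for x
  have contG: "continuous_on UNIV G" using blG by (rule linear_continuous_on)
  have oU: "open U" and oV: "open V"
    unfolding U_def V_def using contG V1 B(1) by (simp_all add: open_vimage)
  have hB: "h z \<in> V1" if "z \<in> B" for z
    using that gh[of z] by (simp add: B_def V1_def)
  have U0: "0 \<in> U" using hB[OF B(2)] by (simp add: U_def G0 h(1))
  have V0: "0 \<in> V" using B(2) by (simp add: V_def G0)
  have \<phi>V: "\<phi> x \<in> V" and \<psi>\<phi>: "\<psi> (\<phi> x) = x" if "x \<in> U" for x
    using that hg(1)[of "G x"] by (auto simp: U_def V_def V1_def \<phi>_def \<psi>_def GL LG)
  have \<psi>U: "\<psi> y \<in> U" and \<phi>\<psi>: "\<phi> (\<psi> y) = y" if "y \<in> V" for y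
    using that hB[of "G y"] gh(1)[of "G y"] by (auto simp: U_def V_def B_def \<phi>_def \<psi>_def GL LG)
  have bij: "bij_betw \<phi> U V"
    by (rule bij_betw_byWitness[where f'=\<psi>]) (use \<phi>V \<psi>\<phi> \<psi>U \<phi>\<psi> in auto)
  have \<phi>C: "Ck_on k \<phi> U"
  proof -
    have "Ck_on k (\<lambda>x. g (G x)) U"
      by (rule Ck_compose[OF oU V' GC[OF oU] gC]) (simp add: U_def V1_def)
    then show ?thesis unfolding \<phi>_def[abs_def] by (rule Ck_linear_compose[OF oU blL])
  qed
  have \<psi>C: "Ck_on k \<psi> V"
  proof -
    have "Ck_on k (\<lambda>x. h (G x)) V"
      by (rule Ck_compose[OF oV W(1) GC[OF oV] hC]) (use U'(2) in \<open>auto simp: V_def B_def\<close>)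
    then show ?thesis unfolding \<psi>_def[abs_def] by (rule Ck_linear_compose[OF oV blL])
  qed
  have "Ck_on k (inv_into U \<phi>) V"
  proof (rule Ck_cong[OF oV _ \<psi>C])
    show "\<psi> y = inv_into U \<phi> y" if "y \<in> V" for y
      using inv_into_f_f[OF bij_betw_imp_inj_on[OF bij] \<psi>U[OF that]] \<phi>\<psi>[OF that] by simp
  qed
  then have diffeo: "Ck_diffeo (r - 2) \<phi> U V"
    unfolding Ck_diffeo_def k_def[symmetric] using oU oV bij \<phi>C by blast
  have \<phi>0: "\<phi> 0 = 0" using gh(1)[OF U'(3)] by (simp add: \<phi>_def G0 h(1) L0)
  have "f (\<phi> x) = \<phi> (A x)" if x: "x \<in> U" for x
  proof -
    define z where "z = g (G x)"
    have GV: "G x \<in> V'" and zB: "z \<in> B" using x by (auto simp: U_def V1_def z_def)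
    have hz: "h z = G x" using hg(1)[OF GV] by (simp add: z_def)
    have zW: "z \<in> W" "p z \<in> U'" using zB U'(2) by (auto simp: B_def)
    have "g (G (A x)) = g (h (p z))" using bspec[OF conj zW(1)] by (simp add: hz GA)
    also have "\<dots> = p z" by (rule gh(1)[OF zW(2)])
    finally show ?thesis by (simp add: \<phi>_def z_def[symmetric] p_def LG)
  qed
  then show ?thesis
    using U0 V0 diffeo \<phi>0 unfolding A_def by blast
qed

end
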